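(* Let $G$ be the simply connected $4$-dimensional real Lie group whose Lie algebra $\mathfrak{g}$ has a basis $\{X,Y,Z,W\}$ with $$[X,Z]=X,\qquad [Y,Z]=Y,\qquad [X,W]=Y,\qquad [Y,W]=-X,$$ all other brackets of distinct basis elements (up to antisymmetry) being zero. Let $g$ be the left invariant Riemannian metric on $G$ for which $\{X,Y,Z,W\}$ is orthonormal. Let $q\in\mathbb{R}$ with $0<|q|<1$, let $Q=qW$ (a left invariant vector field on $G$), and let $F$ be the left invariant Randers metric $$F(x,y)=\sqrt{g(x)(y,y)}+g(x)(Q(x),y),\qquad x\in G,\ y\in T_xG.$$ Then $F$ is of Berwald type, $(G,F)$ is geodesically complete, and its flag curvature is given as follows: if $U=aX+bY+cZ+dW$ and $V=\tilde aX+\tilde bY+\tilde cZ+\tilde dW$ in $\mathfrak{g}$ are orthonormal with respect to $g$ and $P=\mathrm{span}\{U,V\}$, then $$K(P,U)=\frac{-\left\{(a\tilde b-b\tilde a)^2+(a\tilde c-c\tilde a)^2+(b\tilde c-c\tilde b)^2\right\}}{(1+dq)^2}\ \le\ 0 .$$ In particular, $(G,F)$ has non-positive flag curvature.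
   Context: Elements of the Lie algebra $\mathfrak{g}$ are identified with left invariant vector fields on $G$. A Riemannian metric $g$ on $G$ is left invariant if $g(x)(y,z)=g(e)(T_xl_{x^{-1}}y,T_xl_{x^{-1}}z)$ for all $x\in G$ and $y,z\in T_xG$, where $l_a$ is left translation by $a$ and $e$ is the unit element. A Finsler metric $F$ is left invariant if $F(x,y)=F(e,T_xl_{x^{-1}}y)$. A Finsler metric on a manifold $M$ is a non-negative function $F:TM\to\mathbb{R}$, smooth on $TM\setminus\{0\}$, with $F(x,\lambda y)=\lambda F(x,y)$ for $\lambda>0$, and with positive definite Hessian $\left[\frac12\frac{\partial^2F^2}{\partial y^i\partial y^j}\right]$ at every $(x,y)$ with $y\neq0$. A Randers metric is a Finsler metric of the form $F(x,y)=\sqrt{g(x)(y,y)}+g(x)(Q(x),y)$ with $g$ a Riemannian metric and $Q$ a vector field satisfying $\sqrt{g(Q,Q)}<1$. A Finsler metric is of Berwald type if the coefficients of its Chern connection in natural coordinates depend only on the base point $x$, so that the Chern connection defines an affine connection on $M$. The Randers metric above is of Berwald type if and only if $Q$ is parallel with respect to the Levi-Civita connection of $g$; in that case the Chern connection of $F$ is the Levi-Civita connection of $g$, and the curvature tensors and geodesics of $F$ and $g$ coincide. Geodesically complete means that every geodesic extends to all of $\mathbb{R}$. Flag curvature: for a nonzero tangent vector $U$ and a tangent plane $P=\mathrm{span}\{U,V\}$ at the same point, $$K(P,U)=\frac{g_U(R(V,U)U,V)}{g_U(U,U)\,g_U(V,V)-g_U(U,V)^2},$$ where $g_U(V_1,V_2)=\frac12\frac{\partial^2}{\partial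 s\,\partial t}F^2(U+sV_1+tV_2)\big|_{s=t=0}$, $R(V,U)U=\nabla_V\nabla_UU-\nabla_U\nabla_VU-\nabla_{[V,U]}U$, and $\nabla$ is the Chern connection of $F$. Non-positive flag curvature means $K(P,U)\le0$ for all such pairs $(P,U)$. *)

theory Defs
  imports "HOL-Analysis.Analysis" "HOL-Algebra.Group"
begin

section \<open>Smooth manifolds\<close>

primrec Ck_on :: "nat \<Rightarrow> 'e::real_normed_vector set \<Rightarrow> ('e \<Rightarrow> 'f::real_normed_vector) \<Rightarrow> bool" where
  "Ck_on 0 S f \<longleftrightarrow> continuous_on S f"
| "Ck_on (Suc k) S f \<longleftrightarrow>
     (\<forall>x\<in>S. f differentiable (at x)) \<and> (\<forall>v. Ck_on k S (\<lambda>x. frechet_derivative f (at x) v))"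

text \<open>Only used for open sets \<open>S\<close> of Euclidean spaces.\<close>

definition smooth_on :: "'e::real_normed_vector set \<Rightarrow> ('e \<Rightarrow> 'f::real_normed_vector) \<Rightarrow> bool" where
  "smooth_on S f \<longleftrightarrow> (\<forall>k. Ck_on k S f)"

text \<open>The points of a manifold are all the points of a topological type \<open>'a\<close>.  A chart is a domain
  together with a coordinate map, whose values outside the domain are irrelevant.\<close>

type_synonym ('a, 'e) chart = "'a set \<times> ('a \<Rightarrow> 'e)"

abbreviation cdom :: "('a, 'e) chart \<Rightarrow> 'a set" where "cdom c \<equiv> fst c"
abbreviation cmap :: "('a, 'e) chart \<Rightarrow> 'a \<Rightarrow> 'e" where "cmap c \<equiv> snd c"
abbreviation cimg :: "('a, 'e) chart \<Rightarrow> 'e set" where "cimg c \<equiv> cmap c ` cdom c"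
abbreviation cinv :: "('a, 'e) chart \<Rightarrow> 'e \<Rightarrow> 'a" where "cinv c \<equiv> inv_into (cdom c) (cmap c)"

definition smooth_manifold ::
    "('a::{t2_space,second_countable_topology}, 'e::euclidean_space) chart set \<Rightarrow> bool" where
  "smooth_manifold A \<longleftrightarrow>
     (\<Union>c\<in>A. cdom c) = UNIV \<and>
     (\<forall>c\<in>A. open (cdom c) \<and> open (cimg c) \<and> homeomorphism (cdom c) (cimg c) (cmap c) (cinv c)) \<and>
     (\<forall>c\<in>A. \<forall>c'\<in>A. smooth_on (cmap c ` (cdom c \<inter> cdom c')) (cmap c' \<circ> cinv c))"

definition prod_atlas :: "('a, 'e) chart set \<Rightarrow> ('b, 'f) chart set \<Rightarrow> ('a \<times> 'b, 'e \<times> 'f) chart set" where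
  "prod_atlas A B = {(cdom c \<times> cdom d, map_prod (cmap c) (cmap d)) | c d. c \<in> A \<and> d \<in> B}"

definition smooth_map ::
    "('a::topological_space, 'e::real_normed_vector) chart set \<Rightarrow>
     ('b::topological_space, 'f::real_normed_vector) chart set \<Rightarrow> ('a \<Rightarrow> 'b) \<Rightarrow> bool" where
  "smooth_map A B f \<longleftrightarrow> continuous_on UNIV f \<and>
     (\<forall>c\<in>A. \<forall>d\<in>B. smooth_on (cmap c ` (cdom c \<inter> f -` cdom d)) (cmap d \<circ> f \<circ> cinv c))"

definition smooth_near ::
    "('a::topological_space, 'e::real_normed_vector) chart set \<Rightarrow> 'a \<Rightarrow> ('a \<Rightarrow> real) \<Rightarrow> bool" where
  "smooth_near A p f \<longleftrightarrow> (\<exists>S. open S \<and> p \<in> S \<and>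
     (\<forall>c\<in>A. smooth_on (cmap c ` (S \<inter> cdom c)) (f \<circ> cinv c)))"


section \<open>Tangent vectors and vector fields\<close>

text \<open>A tangent vector at \<open>p\<close> is a directional derivative acting on the real functions that are
  smooth near \<open>p\<close>; by convention it is \<open>0\<close> on all other functions, so that tangent vectors are equal
  as soon as they agree on the smooth functions.  The zero vector is \<open>\<lambda>f. 0\<close>.\<close>

type_synonym 'a tvec = "('a \<Rightarrow> real) \<Rightarrow> real"
type_synonym 'a vfield = "'a \<Rightarrow> 'a tvec"

text \<open>The tangent vector \<open>\<Sum>i. \<eta>\<^sub>i \<partial>/\<partial>x\<^sup>i\<close> at \<open>p\<close> in the natural coordinates of the chart \<open>c\<close>.\<close>

definition dvec ::
    "('a::topological_space, 'e::real_normed_vector) chart set \<Rightarrow> ('a, 'e) chart \<Rightarrow> 'a \<Rightarrow> 'e \<Rightarrow> 'a tvec" where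
  "dvec A c p \<eta> = (\<lambda>f. if smooth_near A p f
                       then frechet_derivative (f \<circ> cinv c) (at (cmap c p)) \<eta> else 0)"

definition tangent_space ::
    "('a::topological_space, 'e::real_normed_vector) chart set \<Rightarrow> 'a \<Rightarrow> 'a tvec set" where
  "tangent_space A p = {dvec A c p \<eta> | c \<eta>. c \<in> A \<and> p \<in> cdom c}"

definition components :: "('a, real^'n) chart \<Rightarrow> 'a tvec \<Rightarrow> real^'n" where
  "components c v = (\<chi> i. v (\<lambda>q. cmap c q $ i))"

definition local_field :: "('a, real^'n) chart \<Rightarrow> 'a vfield \<Rightarrow> real^'n \<Rightarrow> real^'n" where
  "local_field c X x = components c (X (cinv c x))"

definition vector_field :: "('a::topological_space, real^'n) chart set \<Rightarrow> 'a vfield \<Rightarrow> bool" where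
  "vector_field A X \<longleftrightarrow> (\<forall>p. X p \<in> tangent_space A p) \<and>
     (\<forall>c\<in>A. smooth_on (cimg c) (local_field c X))"

definition lie_bracket ::
    "('a::topological_space, real^'n) chart set \<Rightarrow> 'a vfield \<Rightarrow> 'a vfield \<Rightarrow> 'a vfield" where
  "lie_bracket A X Y = (\<lambda>p f. if smooth_near A p f
                             then X p (\<lambda>q. Y q f) - Y p (\<lambda>q. X q f) else 0)"

text \<open>Tangent map of a diffeomorphism \<open>\<phi>\<close> (independent of the base point in this representation).\<close>

definition tangent_map :: "('a \<Rightarrow> 'b) \<Rightarrow> 'a tvec \<Rightarrow> 'b tvec" where
  "tangent_map \<phi> v = (\<lambda>f. v (f \<circ> \<phi>))"


section \<open>Lie groups and left invariance\<close>

definition lie_group ::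
    "('a::{t2_space,second_countable_topology}, 'm) monoid_scheme \<Rightarrow> ('a, 'e::euclidean_space) chart set \<Rightarrow> bool" where
  "lie_group G A \<longleftrightarrow> group G \<and> carrier G = UNIV \<and> smooth_manifold A \<and>
     smooth_map (prod_atlas A A) A (\<lambda>(x, y). x \<otimes>\<^bsub>G\<^esub> y) \<and>
     smooth_map A A (\<lambda>x. inv\<^bsub>G\<^esub> x)"

definition lie_algebra ::
    "('a::topological_space, 'm) monoid_scheme \<Rightarrow> ('a, real^'n) chart set \<Rightarrow> 'a vfield set" where
  "lie_algebra G A = {X. vector_field A X \<and>
     (\<forall>a x. X (a \<otimes>\<^bsub>G\<^esub> x) = tangent_map (\<lambda>z. a \<otimes>\<^bsub>G\<^esub> z) (X x))}"

definition lin_comb :: "real list \<Rightarrow> 'a vfield list \<Rightarrow> 'a vfield" where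
  "lin_comb as Bs = (\<lambda>x f. \<Sum>i<length Bs. as ! i * (Bs ! i) x f)"

definition lie_algebra_basis ::
    "('a::topological_space, 'm) monoid_scheme \<Rightarrow> ('a, real^'n) chart set \<Rightarrow> 'a vfield list \<Rightarrow> bool" where
  "lie_algebra_basis G A Bs \<longleftrightarrow> set Bs \<subseteq> lie_algebra G A \<and>
     (\<forall>U\<in>lie_algebra G A. \<exists>!as. length as = length Bs \<and> U = lin_comb as Bs)"

definition riemannian_metric ::
    "('a::topological_space, real^'n) chart set \<Rightarrow> ('a \<Rightarrow> 'a tvec \<Rightarrow> 'a tvec \<Rightarrow> real) \<Rightarrow> bool" where
  "riemannian_metric A g \<longleftrightarrow>
     (\<forall>p. \<forall>u\<in>tangent_space A p. \<forall>v\<in>tangent_space A p. \<forall>w\<in>tangent_space A p. \<forall>r s.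
        g p (\<lambda>f. r * u f + s * v f) w = r * g p u w + s * g p v w) \<and>
     (\<forall>p. \<forall>u\<in>tangent_space A p. \<forall>v\<in>tangent_space A p. g p u v = g p v u) \<and>
     (\<forall>p. \<forall>u\<in>tangent_space A p. u \<noteq> (\<lambda>f. 0) \<longrightarrow> 0 < g p u u) \<and>
     (\<forall>c\<in>A. \<forall>i j. smooth_on (cimg c)
        (\<lambda>x. g (cinv c x) (dvec A c (cinv c x) (axis i 1)) (dvec A c (cinv c x) (axis j 1))))"

definition left_invariant_metric ::
    "('a::topological_space, 'm) monoid_scheme \<Rightarrow> ('a, real^'n) chart set \<Rightarrow>
     ('a \<Rightarrow> 'a tvec \<Rightarrow> 'a tvec \<Rightarrow> real) \<Rightarrow> bool" where
  "left_invariant_metric G A g \<longleftrightarrow>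
     (\<forall>x. \<forall>y\<in>tangent_space A x. \<forall>z\<in>tangent_space A x.
        g x y z = g \<one>\<^bsub>G\<^esub> (tangent_map (\<lambda>a. inv\<^bsub>G\<^esub> x \<otimes>\<^bsub>G\<^esub> a) y) (tangent_map (\<lambda>a. inv\<^bsub>G\<^esub> x \<otimes>\<^bsub>G\<^esub> a) z))"

definition orthonormal :: "('v \<Rightarrow> 'v \<Rightarrow> real) \<Rightarrow> 'v list \<Rightarrow> bool" where
  "orthonormal h vs \<longleftrightarrow>
     (\<forall>i<length vs. \<forall>j<length vs. h (vs ! i) (vs ! j) = (if i = j then 1 else 0))"


section \<open>Finsler metrics and the Chern connection\<close>

text \<open>Partial derivatives of functions of natural coordinates \<open>(x, y)\<close> on the tangent bundle.\<close>

definition partial_x :: "'n \<Rightarrow> (real^'n \<Rightarrow> real^'n \<Rightarrow> real) \<Rightarrow> real^'n \<Rightarrow> real^'n \<Rightarrow> real" where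
  "partial_x k h x y = deriv (\<lambda>t. h (x + t *\<^sub>R axis k 1) y) 0"

definition partial_y :: "'n \<Rightarrow> (real^'n \<Rightarrow> real^'n \<Rightarrow> real) \<Rightarrow> real^'n \<Rightarrow> real^'n \<Rightarrow> real" where
  "partial_y k h x y = deriv (\<lambda>t. h x (y + t *\<^sub>R axis k 1)) 0"

context
  fixes A :: "('a::topological_space, real^'n) chart set"
    and F :: "'a \<Rightarrow> 'a tvec \<Rightarrow> real"
begin

definition local_F :: "('a, real^'n) chart \<Rightarrow> real^'n \<Rightarrow> real^'n \<Rightarrow> real" where
  "local_F c x y = F (cinv c x) (dvec A c (cinv c x) y)"

definition local_F2 :: "('a, real^'n) chart \<Rightarrow> real^'n \<Rightarrow> real^'n \<Rightarrow> real" where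
  "local_F2 c x y = (local_F c x y)\<^sup>2"

definition gmat :: "('a, real^'n) chart \<Rightarrow> real^'n \<Rightarrow> real^'n \<Rightarrow> real^'n^'n" where
  "gmat c x y = (\<chi> i j. 1/2 * partial_y i (partial_y j (local_F2 c)) x y)"

definition finsler_metric :: bool where
  "finsler_metric \<longleftrightarrow>
     (\<forall>p. \<forall>y\<in>tangent_space A p. 0 \<le> F p y) \<and>
     (\<forall>c\<in>A. smooth_on (cimg c \<times> (- {0})) (\<lambda>(x, y). local_F c x y)) \<and>
     (\<forall>p. \<forall>y\<in>tangent_space A p. \<forall>r>0. F p (\<lambda>f. r * y f) = r * F p y) \<and>
     (\<forall>c\<in>A. \<forall>x\<in>cimg c. \<forall>y. y \<noteq> 0 \<longrightarrow> (\<forall>v. v \<noteq> 0 \<longrightarrow> 0 < v \<bullet> (gmat c x y *v v)))"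

text \<open>Spray coefficients \<open>G\<^sup>i = 1/4 g\<^sup>i\<^sup>l ([F\<^sup>2]\<^sub>x\<^sub>k\<^sub>y\<^sub>l y\<^sup>k - [F\<^sup>2]\<^sub>x\<^sub>l)\<close>, nonlinear connection
  \<open>N\<^sup>i\<^sub>j = \<partial>G\<^sup>i/\<partial>y\<^sup>j\<close>, horizontal derivatives \<open>\<delta>\<^sub>k = \<partial>/\<partial>x\<^sup>k - N\<^sup>m\<^sub>k \<partial>/\<partial>y\<^sup>m\<close>, and Chern connection
  coefficients \<open>\<Gamma>\<^sup>i\<^sub>j\<^sub>k = 1/2 g\<^sup>i\<^sup>l (\<delta>\<^sub>k g\<^sub>l\<^sub>j + \<delta>\<^sub>j g\<^sub>l\<^sub>k - \<delta>\<^sub>l g\<^sub>j\<^sub>k)\<close>, as in Bao--Chern--Shen.\<close>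

definition spray :: "('a, real^'n) chart \<Rightarrow> 'n \<Rightarrow> real^'n \<Rightarrow> real^'n \<Rightarrow> real" where
  "spray c i x y = 1/4 * (\<Sum>l\<in>UNIV. matrix_inv (gmat c x y) $ i $ l *
     ((\<Sum>k\<in>UNIV. partial_x k (partial_y l (local_F2 c)) x y * y $ k) - partial_x l (local_F2 c) x y))"

definition nonlinear_conn :: "('a, real^'n) chart \<Rightarrow> 'n \<Rightarrow> 'n \<Rightarrow> real^'n \<Rightarrow> real^'n \<Rightarrow> real" where
  "nonlinear_conn c i j = partial_y j (spray c i)"

definition hderiv :: "('a, real^'n) chart \<Rightarrow> 'n \<Rightarrow> (real^'n \<Rightarrow> real^'n \<Rightarrow> real) \<Rightarrow>
    real^'n \<Rightarrow> real^'n \<Rightarrow> real" where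
  "hderiv c k h x y = partial_x k h x y - (\<Sum>m\<in>UNIV. nonlinear_conn c m k x y * partial_y m h x y)"

definition chern :: "('a, real^'n) chart \<Rightarrow> 'n \<Rightarrow> 'n \<Rightarrow> 'n \<Rightarrow> real^'n \<Rightarrow> real^'n \<Rightarrow> real" where
  "chern c i j k x y = 1/2 * (\<Sum>l\<in>UNIV. matrix_inv (gmat c x y) $ i $ l *
     (hderiv c k (\<lambda>x y. gmat c x y $ l $ j) x y + hderiv c j (\<lambda>x y. gmat c x y $ l $ k) x y
      - hderiv c l (\<lambda>x y. gmat c x y $ j $ k) x y))"

definition berwald_type :: bool where
  "berwald_type \<longleftrightarrow> finsler_metric \<and>
     (\<forall>c\<in>A. \<forall>x\<in>cimg c. \<forall>y y'. y \<noteq> 0 \<longrightarrow> y' \<noteq> 0 \<longrightarrow>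
        (\<forall>i j k. chern c i j k x y = chern c i j k x y'))"


section \<open>Geodesics\<close>

text \<open>Solutions of \<open>\<nabla>\<^sub>\<gamma>\<^sub>'\<gamma>' = 0\<close> with reference vector \<open>\<gamma>'\<close>, including the constant curves.\<close>

definition geodesic :: "real set \<Rightarrow> (real \<Rightarrow> 'a) \<Rightarrow> bool" where
  "geodesic I \<gamma> \<longleftrightarrow> continuous_on I \<gamma> \<and>
     (\<forall>t\<in>I. \<forall>c\<in>A. \<gamma> t \<in> cdom c \<longrightarrow>
        (let x = cmap c \<circ> \<gamma>; x' = (\<lambda>s. vector_derivative x (at s)) in
          (\<forall>\<^sub>F s in nhds t. x differentiable (at s)) \<and>
          (x' has_vector_derivative
             (\<chi> i. - (\<Sum>j\<in>UNIV. \<Sum>k\<in>UNIV. chern c i j k (x t) (x' t) * x' t $ j * x' t $ k))) (at t)))"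

definition geodesically_complete :: bool where
  "geodesically_complete \<longleftrightarrow>
     (\<forall>I \<gamma>. open I \<and> is_interval I \<and> geodesic I \<gamma> \<longrightarrow>
        (\<exists>\<gamma>'. geodesic UNIV \<gamma>' \<and> (\<forall>t\<in>I. \<gamma>' t = \<gamma> t)))"


section \<open>Flag curvature\<close>

definition fundamental_tensor :: "'a \<Rightarrow> 'a tvec \<Rightarrow> 'a tvec \<Rightarrow> 'a tvec \<Rightarrow> real" where
  "fundamental_tensor p u v w =
     1/2 * deriv (\<lambda>s. deriv (\<lambda>t. (F p (\<lambda>f. u f + s * v f + t * w f))\<^sup>2) 0) 0"

text \<open>The Chern connection is a connection on the pulled-back tangent bundle: it acts on sections
  \<open>s\<close> that may depend on the direction \<open>y \<noteq> 0\<close> as well as on \<open>x\<close>, and \<open>\<nabla>\<^sub>V\<close> is taken along the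
  horizontal lift of \<open>V\<close>.  For Berwald metrics, and \<open>s\<close> depending on \<open>x\<close> only, this is the covariant
  derivative of the affine connection defined by \<open>F\<close>.\<close>

definition chern_nabla :: "('a, real^'n) chart \<Rightarrow> (real^'n \<Rightarrow> real^'n) \<Rightarrow>
    (real^'n \<Rightarrow> real^'n \<Rightarrow> real^'n) \<Rightarrow> real^'n \<Rightarrow> real^'n \<Rightarrow> real^'n" where
  "chern_nabla c V s x y = (\<chi> i. \<Sum>k\<in>UNIV. V x $ k *
     (hderiv c k (\<lambda>x y. s x y $ i) x y + (\<Sum>j\<in>UNIV. chern c i j k x y * s x y $ j)))"

text \<open>\<open>R(V,U)U = \<nabla>\<^sub>V\<nabla>\<^sub>UU - \<nabla>\<^sub>U\<nabla>\<^sub>VU - \<nabla>\<^sub>[\<^sub>V\<^sub>,\<^sub>U\<^sub>]U\<close> at \<open>p\<close> with flagpole \<open>U p\<close>, computed in the natural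
  coordinates of a chart \<open>c\<close> around \<open>p\<close>.\<close>

definition chern_curvature :: "('a, real^'n) chart \<Rightarrow> 'a \<Rightarrow> 'a vfield \<Rightarrow> 'a vfield \<Rightarrow> 'a tvec" where
  "chern_curvature c p V U =
     (let v = local_field c V; u = local_field c U; w = local_field c (lie_bracket A V U);
          s = (\<lambda>x y. u x); x = cmap c p; y = u x in
      dvec A c p (chern_nabla c v (chern_nabla c u s) x y
                  - chern_nabla c u (chern_nabla c v s) x y
                  - chern_nabla c w s x y))"

text \<open>\<open>K(P, U)\<close> at \<open>p\<close> for \<open>P\<close> spanned by \<open>U p\<close> and \<open>V p\<close>.\<close>

definition flag_curvature :: "('a, real^'n) chart \<Rightarrow> 'a \<Rightarrow> 'a vfield \<Rightarrow> 'a vfield \<Rightarrow> real" where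
  "flag_curvature c p U V =
     fundamental_tensor p (U p) (chern_curvature c p V U) (V p) /
     (fundamental_tensor p (U p) (U p) (U p) * fundamental_tensor p (U p) (V p) (V p)
      - (fundamental_tensor p (U p) (U p) (V p))\<^sup>2)"

text \<open>A flag at \<open>p\<close> is given by linearly independent tangent vectors; all choices of smooth
  extensions and of charts are covered.\<close>

definition nonpositive_flag_curvature :: bool where
  "nonpositive_flag_curvature \<longleftrightarrow>
     (\<forall>p. \<forall>c\<in>A. p \<in> cdom c \<longrightarrow>
        (\<forall>U V. vector_field A U \<and> vector_field A V \<and>
           (\<forall>r s. (\<lambda>f. r * U p f + s * V p f) = (\<lambda>f. 0) \<longrightarrow> r = 0 \<and> s = 0) \<longrightarrow>
           flag_curvature c p U V \<le> 0))"

end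

definition randers ::
    "('a \<Rightarrow> 'a tvec \<Rightarrow> 'a tvec \<Rightarrow> real) \<Rightarrow> 'a vfield \<Rightarrow> 'a \<Rightarrow> 'a tvec \<Rightarrow> real" where
  "randers g Q x y = sqrt (g x y y) + g x (Q x) y"

end

(*
Fix the orthonormal left invariant frame e = (X, Y, Z, W).  In a chart, let \<theta> x y be the frame
components of the vector y at x.  Then F = N(\<theta> x y) for the Randers norm N u = |u| + q u_4, and the
Levi-Civita connection of g is \<nabla>_v s = \<theta>^-1 (v (\<theta> s) + \<omega> (\<theta> v) (\<theta> s)), where \<omega> has constant coefficients,
takes values in the skew endomorphisms and annihilates W.  Rotations by \<omega> preserve N, so F is constant
along the horizontal lift of this connection; by the Koszul-type formula for the Chern connection this
alone forces the Chern connection to be the Levi-Civita connection, independently of y.  The curvature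
in the frame is therefore algebraic in \<omega>.  It is orthogonal to the flagpole and to W, so that
the fundamental tensor only rescales the Riemannian sectional curvature by |u|^2 / N(u)^2.

In the frame, geodesics solve u' = - \<omega> u u with |u| constant.  By left invariance all solutions with
|u| <= r exist for a uniform time, and uniqueness allows them to be glued to solutions on the whole
line.
*)

theory Submission
  imports Defs
begin

subsection \<open>Smooth functions on open sets\<close>

text \<open>Why horizontal constancy suffices: it expresses the x-derivatives of F^2 by its
  y-derivatives, with coefficients \<Gamma>. One further y-derivative puts this into the spray,
  which becomes \<Gamma> y y / 2; two put it into the horizontal derivatives of the fundamental
  tensor, where the third y-derivatives of F^2 cancel. What remains is the usual Christoffel
  identity, and multiplying by the inverse of the fundamental tensor returns \<Gamma>. So the
  inverse matrix is never computed; its existence is enough. The definitions speak of coordinates in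
  arbitrary charts, while the algebra is simple only in the frame. The coframe \<theta> and its
  Maurer-Cartan equation carry statements from one side to the other. All of this is done in any
  dimension, for an orthonormal left invariant frame whose torsion-free \<omega> is skew and has
  values orthogonal to a vector b with |b| < 1. Completeness is obtained without maximal solutions:
  a time T of existence valid for all base points and all |u| <= r is enlarged to 3/2 T by
  restarting at T/2 and -T/2.\<close>

lemma frechet_derivative_eqI:
  "(f has_derivative f') (at x) \<Longrightarrow> frechet_derivative f (at x) = f'"
  by (rule frechet_derivative_at[symmetric])

lemma has_vector_derivative_along_line:
  fixes f :: "'a::real_normed_vector \<Rightarrow> 'b::real_normed_vector"
  assumes "f differentiable (at (x + s *\<^sub>R v))"
  shows "((\<lambda>s. f (x + s *\<^sub>R v)) has_vector_derivative frechet_derivative f (at (x + s *\<^sub>R v)) v) (at s)"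
proof -
  have f': "(f has_derivative frechet_derivative f (at (x + s *\<^sub>R v))) (at (x + s *\<^sub>R v))"
    using assms by (simp add: frechet_derivative_works)
  have "((\<lambda>s. x + s *\<^sub>R v) has_derivative (\<lambda>h. h *\<^sub>R v)) (at s)"
    by (auto intro!: derivative_eq_intros)
  from has_derivative_compose[OF this f']
  show ?thesis
    using linear_frechet_derivative[OF assms]
    by (simp add: has_vector_derivative_def linear_cmul)
qed

lemma Ck_on_subset: "Ck_on k S f \<Longrightarrow> T \<subseteq> S \<Longrightarrow> Ck_on k T f"
  by (induction k arbitrary: f) (auto intro: continuous_on_subset)

text \<open>Openness makes \<open>frechet_derivative\<close> at points of S see only values on S, so
  equality passes to the derivatives and the induction continues.\<close>

lemma Ck_on_cong:
  assumes "open S" "\<And>x. x \<in> S \<Longrightarrow> f x = g x" "Ck_on k S f"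
  shows "Ck_on k S g"
  using assms(2,3)
proof (induction k arbitrary: f g)
  case 0
  then show ?case by (auto cong: continuous_on_cong_simp)
next
  case (Suc k)
  have d: "(g has_derivative frechet_derivative f (at x)) (at x)" if "x \<in> S" for x
  proof (rule has_derivative_transform_within_open[OF _ assms(1) that])
    show "(f has_derivative frechet_derivative f (at x)) (at x)"
      using Suc.prems(2) that by (simp flip: frechet_derivative_works)
  qed (use Suc.prems(1) in auto)
  have "Ck_on k S (\<lambda>x. frechet_derivative g (at x) v)" for v
    using Suc.IH[of "\<lambda>x. frechet_derivative f (at x) v" "\<lambda>x. frechet_derivative g (at x) v"]
      Suc.prems(2) frechet_derivative_eqI[OF d] by auto
  then show ?case using d by (auto simp: differentiable_def)
qed

lemma Ck_on_SucD: "Ck_on (Suc k) S f \<Longrightarrow> Ck_on k S f"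
proof (induction k arbitrary: f)
  case 0
  then show ?case
    by (auto intro!: continuous_at_imp_continuous_on differentiable_imp_continuous_within)
next
  case (Suc k)
  then show ?case by (metis Ck_on.simps(2))
qed

lemma Ck_on_const: "Ck_on k S (\<lambda>x. c)"
  by (induction k arbitrary: c) auto

lemma Ck_on_bounded_linear:
  assumes "bounded_linear h"
  shows "Ck_on k S h"
proof (cases k)
  case 0
  then show ?thesis using assms by (simp add: linear_continuous_on)
next
  case (Suc n)
  have "frechet_derivative h (at x) = h" for x
    by (rule frechet_derivative_eqI, rule bounded_linear.has_derivative[OF assms, of "\<lambda>x. x" "\<lambda>x. x"]) simp
  then show ?thesis
    using Suc assms by (simp add: Ck_on_const bounded_linear_imp_differentiable)
qed

lemma Ck_on_add:
  assumes "open S" "Ck_on k S f" "Ck_on k S g"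
  shows "Ck_on k S (\<lambda>x. f x + g x)"
  using assms(2,3)
proof (induction k arbitrary: f g)
  case 0
  then show ?case by (auto intro: continuous_intros)
next
  case (Suc k)
  have d: "((\<lambda>x. f x + g x) has_derivative
      (\<lambda>v. frechet_derivative f (at x) v + frechet_derivative g (at x) v)) (at x)"
    if "x \<in> S" for x
    using Suc.prems that by (auto intro!: has_derivative_add simp: frechet_derivative_works)
  have "Ck_on k S (\<lambda>x. frechet_derivative (\<lambda>x. f x + g x) (at x) v)" for v
    by (rule Ck_on_cong[OF assms(1) _ Suc.IH[of "\<lambda>x. frechet_derivative f (at x) v"
          "\<lambda>x. frechet_derivative g (at x) v"]])
      (use Suc.prems frechet_derivative_eqI[OF d] in auto)
  then show ?case using d by (auto simp: differentiable_def)
qed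

text \<open>The Leibniz rule gives two terms of the same bilinear shape, each with one factor
  differentiated and the other still C^k by \<open>Ck_on_SucD\<close>; hence the induction over both
  functions at once.\<close>

lemma Ck_on_bilinear:
  assumes "bounded_bilinear op2" "open S" "Ck_on k S f" "Ck_on k S g"
  shows "Ck_on k S (\<lambda>x. op2 (f x) (g x))"
  using assms(3,4)
proof (induction k arbitrary: f g)
  case 0
  then show ?case using bounded_bilinear.continuous_on[OF assms(1)] by auto
next
  case (Suc k)
  have d: "((\<lambda>x. op2 (f x) (g x)) has_derivative
      (\<lambda>v. op2 (f x) (frechet_derivative g (at x) v) + op2 (frechet_derivative f (at x) v) (g x))) (at x)"
    if "x \<in> S" for x
    using Suc.prems that
    by (auto intro!: bounded_bilinear.FDERIV[OF assms(1)] simp: frechet_derivative_works)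
  have "Ck_on k S (\<lambda>x. frechet_derivative (\<lambda>x. op2 (f x) (g x)) (at x) v)" for v
    by (rule Ck_on_cong[OF assms(2) _ Ck_on_add[OF assms(2)
            Suc.IH[of f "\<lambda>x. frechet_derivative g (at x) v"]
            Suc.IH[of "\<lambda>x. frechet_derivative f (at x) v" g]]])
      (use Suc.prems frechet_derivative_eqI[OF d] Ck_on_SucD in auto)
  then show ?case using d by (auto simp: differentiable_def)
qed

lemma Ck_on_linear_compose:
  assumes "bounded_linear h" "open S" "Ck_on k S f"
  shows "Ck_on k S (\<lambda>x. h (f x))"
  using assms(3)
proof (induction k arbitrary: f)
  case 0
  then show ?case using bounded_linear.continuous_on[OF assms(1)] by auto
next
  case (Suc k)
  have d: "((\<lambda>x. h (f x)) has_derivative (\<lambda>v. h (frechet_derivative f (at x) v))) (at x)"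
    if "x \<in> S" for x
    using Suc.prems that
    by (auto intro!: bounded_linear.has_derivative[OF assms(1)] simp: frechet_derivative_works)
  have "Ck_on k S (\<lambda>x. frechet_derivative (\<lambda>x. h (f x)) (at x) v)" for v
    by (rule Ck_on_cong[OF assms(2) _ Suc.IH[of "\<lambda>x. frechet_derivative f (at x) v"]])
      (use Suc.prems frechet_derivative_eqI[OF d] in auto)
  then show ?case using d by (auto simp: differentiable_def)
qed

lemma Ck_on_sum:
  assumes "open S" "\<And>i. i \<in> I \<Longrightarrow> Ck_on k S (f i)"
  shows "Ck_on k S (\<lambda>x. \<Sum>i\<in>I. f i x)"
  using assms(2)
  by (induction I rule: infinite_finite_induct) (auto intro!: Ck_on_add[OF assms(1)] Ck_on_const)

text \<open>The chain rule applies the derivative of f to a vector that moves with x, whereas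
  \<open>Ck_on\<close> controls fixed directions only. Expanding that vector in \<open>Basis\<close>
  reduces to fixed directions, which is why the middle space is Euclidean.\<close>

lemma Ck_on_compose:
  fixes g :: "'a::real_normed_vector \<Rightarrow> 'b::euclidean_space"
  assumes "open S" "open T" "Ck_on k T f" "Ck_on k S g" "g ` S \<subseteq> T"
  shows "Ck_on k S (\<lambda>x. f (g x))"
  using assms(3,4)
proof (induction k arbitrary: f)
  case 0
  then show ?case using continuous_on_compose2[of T f S g] assms by auto
next
  case (Suc k)
  have d: "((\<lambda>x. f (g x)) has_derivative
       (\<lambda>v. frechet_derivative f (at (g x)) (frechet_derivative g (at x) v))) (at x)"
    if "x \<in> S" for x
    using Suc.prems that assms(5)
    by (intro has_derivative_compose[of g _ x UNIV f]) (auto simp: frechet_derivative_works)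
  have e: "frechet_derivative f (at (g x)) w =
      (\<Sum>i\<in>Basis. (w \<bullet> i) *\<^sub>R frechet_derivative f (at (g x)) i)" if "x \<in> S" for x w
  proof -
    have l: "linear (frechet_derivative f (at (g x)))"
      using Suc.prems that assms(5) by (auto intro!: linear_frechet_derivative)
    have "frechet_derivative f (at (g x)) w = frechet_derivative f (at (g x)) (\<Sum>i\<in>Basis. (w \<bullet> i) *\<^sub>R i)"
      by (simp add: euclidean_representation)
    then show ?thesis by (simp only: linear_sum[OF l] linear_cmul[OF l])
  qed
  have "Ck_on k S (\<lambda>x. \<Sum>i\<in>Basis. (frechet_derivative g (at x) v \<bullet> i) *\<^sub>R frechet_derivative f (at (g x)) i)" for v
    using Suc.prems Suc.IH Ck_on_SucD[OF Suc.prems(2)]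
    by (intro Ck_on_sum[OF assms(1)] Ck_on_bilinear[OF bounded_bilinear_scaleR assms(1)]
        Ck_on_linear_compose[OF bounded_linear_inner_left assms(1)]) auto
  then have "Ck_on k S (\<lambda>x. frechet_derivative (\<lambda>x. f (g x)) (at x) v)" for v
    by (rule Ck_on_cong[OF assms(1), rotated]) (simp add: frechet_derivative_eqI[OF d] flip: e)
  then show ?case using d by (auto simp: differentiable_def)
qed

lemma Ck_on_inverse: "open S \<Longrightarrow> 0 \<notin> S \<Longrightarrow> Ck_on k S (inverse :: real \<Rightarrow> real)"
proof (induction k)
  case 0
  then show ?case by (auto intro!: continuous_on_inverse continuous_on_id)
next
  case (Suc k)
  have d: "(inverse has_derivative (\<lambda>v. - (inverse x * v * inverse x))) (at x)" if "x \<in> S" for x :: real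
    using has_derivative_inverse'[of x UNIV] that Suc.prems by auto
  have "Ck_on k S (\<lambda>x. frechet_derivative inverse (at x) v)" for v :: real
    by (rule Ck_on_cong[OF Suc.prems(1), of "\<lambda>x. (- v) * (inverse x * inverse x)"])
      (use Suc frechet_derivative_eqI[OF d] in \<open>auto intro!: Ck_on_linear_compose[OF
         bounded_linear_mult_right] Ck_on_linear_compose[OF bounded_linear_minus[OF bounded_linear_ident]]
         Ck_on_bilinear[OF bounded_bilinear_mult]\<close>)
  then show ?case using d by (auto simp: differentiable_def)
qed

text \<open>The derivative 1 / (2 sqrt x) is again built from \<open>sqrt\<close>, so smoothness of
  \<open>inverse\<close> off zero closes the induction.\<close>

lemma Ck_on_sqrt: "Ck_on k {0<..} sqrt"
proof (induction k)
  case 0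
  show ?case by (auto intro!: continuous_intros)
next
  case (Suc k)
  have d: "(sqrt has_derivative (\<lambda>v. v * (inverse (sqrt x) / 2))) (at x)" if "x \<in> {0<..}" for x :: real
    using DERIV_real_sqrt[of x] that
    by (simp add: has_field_derivative_def mult.commute[of _ "inverse (sqrt x) / 2"] del: times_divide_eq_right times_divide_eq_left)
  have "Ck_on k {0<..} (\<lambda>x. inverse (sqrt x))"
    by (rule Ck_on_compose[OF _ _ Ck_on_inverse[of "{0<..}" k] Suc.IH]) auto
  then have "Ck_on k {0<..} (\<lambda>x. v / 2 * inverse (sqrt x))" for v :: real
    by (rule Ck_on_linear_compose[OF bounded_linear_mult_right open_greaterThan])
  then have "Ck_on k {0<..} (\<lambda>x. frechet_derivative sqrt (at x) v)" for v :: real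
    by (rule Ck_on_cong[rotated 2]) (simp_all add: frechet_derivative_eqI[OF d])
  then show ?case using d by (auto simp: differentiable_def)
qed

section \<open>Closure properties of \<open>smooth_on\<close>\<close>

lemma smooth_on_subset: "smooth_on S f \<Longrightarrow> T \<subseteq> S \<Longrightarrow> smooth_on T f"
  by (auto simp: smooth_on_def intro: Ck_on_subset)

lemma smooth_on_cong: "open S \<Longrightarrow> (\<And>x. x \<in> S \<Longrightarrow> f x = g x) \<Longrightarrow> smooth_on S f \<Longrightarrow> smooth_on S g"
  unfolding smooth_on_def using Ck_on_cong by blast

lemma smooth_on_const: "smooth_on S (\<lambda>x. c)"
  by (simp add: smooth_on_def Ck_on_const)

lemma smooth_on_bounded_linear: "bounded_linear h \<Longrightarrow> smooth_on S h"
  by (simp add: smooth_on_def Ck_on_bounded_linear)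

lemma smooth_on_linear_compose:
  "bounded_linear h \<Longrightarrow> open S \<Longrightarrow> smooth_on S f \<Longrightarrow> smooth_on S (\<lambda>x. h (f x))"
  by (simp add: smooth_on_def Ck_on_linear_compose)

lemma smooth_on_add: "open S \<Longrightarrow> smooth_on S f \<Longrightarrow> smooth_on S g \<Longrightarrow> smooth_on S (\<lambda>x. f x + g x)"
  by (simp add: smooth_on_def Ck_on_add)

lemma smooth_on_sum:
  "open S \<Longrightarrow> (\<And>i. i \<in> I \<Longrightarrow> smooth_on S (f i)) \<Longrightarrow> smooth_on S (\<lambda>x. \<Sum>i\<in>I. f i x)"
  by (simp add: smooth_on_def Ck_on_sum)

lemma smooth_on_bilinear:
  "bounded_bilinear op2 \<Longrightarrow> open S \<Longrightarrow> smooth_on S f \<Longrightarrow> smooth_on S g \<Longrightarrow> smooth_on S (\<lambda>x. op2 (f x) (g x))"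
  by (simp add: smooth_on_def Ck_on_bilinear)

lemmas smooth_on_mult = smooth_on_bilinear[OF bounded_bilinear_mult]
lemmas smooth_on_scaleR = smooth_on_bilinear[OF bounded_bilinear_scaleR]
lemmas smooth_on_inner = smooth_on_bilinear[OF bounded_bilinear_inner]

lemma smooth_on_compose:
  fixes g :: "'a::real_normed_vector \<Rightarrow> 'b::euclidean_space"
  assumes "smooth_on T f" "smooth_on S g" "open S" "open T" "g ` S \<subseteq> T"
  shows "smooth_on S (\<lambda>x. f (g x))"
  using assms by (simp add: smooth_on_def Ck_on_compose)

lemma smooth_on_Pair:
  assumes "open S" "smooth_on S f" "smooth_on S g"
  shows "smooth_on S (\<lambda>x. (f x, g x))"
proof -
  have "smooth_on S (\<lambda>x. (f x, 0) + (0, g x))"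
    using assms
    by (intro smooth_on_add smooth_on_linear_compose[of "\<lambda>z. (z, 0)"] smooth_on_linear_compose[of "\<lambda>z. (0, z)"]
        bounded_linear_Pair bounded_linear_ident bounded_linear_zero)
  then show ?thesis by simp
qed

lemma smooth_on_vec_nth: "open S \<Longrightarrow> smooth_on S f \<Longrightarrow> smooth_on S (\<lambda>x. f x $ i)"
  by (rule smooth_on_linear_compose[OF bounded_linear_vec_nth])

lemma vec_eq_sum_axis: "x = (\<Sum>i\<in>UNIV. (x $ i) *\<^sub>R (axis i 1 :: real^'n))"
  by (simp add: vec_eq_iff axis_def if_distrib cong: if_cong)

lemma smooth_on_vecI:
  fixes f :: "'a::real_normed_vector \<Rightarrow> real^'n"
  assumes "open S" "\<And>i. smooth_on S (\<lambda>x. f x $ i)"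
  shows "smooth_on S f"
proof -
  have "smooth_on S (\<lambda>x. \<Sum>i\<in>UNIV. (f x $ i) *\<^sub>R (axis i 1 :: real^'n))"
    using assms by (intro smooth_on_sum smooth_on_scaleR smooth_on_const)
  then show ?thesis by (simp flip: vec_eq_sum_axis)
qed

lemma smooth_on_norm:
  fixes f :: "'a::real_normed_vector \<Rightarrow> 'b::real_inner"
  assumes "open S" "smooth_on S f" "\<And>x. x \<in> S \<Longrightarrow> f x \<noteq> 0"
  shows "smooth_on S (\<lambda>x. norm (f x))"
proof -
  have "smooth_on S (\<lambda>x. sqrt (f x \<bullet> f x))"
  proof (rule smooth_on_compose[of "{0<..}" sqrt])
    show "smooth_on S (\<lambda>x. f x \<bullet> f x)" using assms by (intro smooth_on_inner) auto
  qed (use assms in \<open>auto simp: smooth_on_def Ck_on_sqrt\<close>)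
  then show ?thesis by (simp add: norm_eq_sqrt_inner)
qed

lemma smooth_on_imp_differentiable: "smooth_on S f \<Longrightarrow> x \<in> S \<Longrightarrow> f differentiable (at x)"
  unfolding smooth_on_def using Ck_on.simps(2) by blast

lemma smooth_on_imp_has_derivative:
  "smooth_on S f \<Longrightarrow> x \<in> S \<Longrightarrow> (f has_derivative frechet_derivative f (at x)) (at x)"
  using smooth_on_imp_differentiable frechet_derivative_works by blast

lemma smooth_on_frechet_derivative: "smooth_on S f \<Longrightarrow> smooth_on S (\<lambda>x. frechet_derivative f (at x) v)"
  unfolding smooth_on_def using Ck_on.simps(2) by blast

lemma smooth_on_imp_continuous_on: "smooth_on S f \<Longrightarrow> continuous_on S f"
  unfolding smooth_on_def using Ck_on.simps(1) by blast

subsection \<open>Symmetry of second derivatives\<close>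

text \<open>The left side is symmetric in v and w. Using the mean value theorem along v and then
  along w turns it into one mixed derivative; exchanging the roles gives the other.\<close>

lemma second_difference_mean_value:
  fixes f :: "'a::real_normed_vector \<Rightarrow> real"
  assumes f: "smooth_on S f" and S: "ball x r \<subseteq> S" and h: "0 < h" "h * (norm v + norm w) < r"
  shows "\<exists>p\<in>ball x r. f (x + h *\<^sub>R v + h *\<^sub>R w) - f (x + h *\<^sub>R v) - f (x + h *\<^sub>R w) + f x
     = h * h * frechet_derivative (\<lambda>x. frechet_derivative f (at x) v) (at p) w"
proof -
  have inb: "x + s *\<^sub>R v + t *\<^sub>R w \<in> ball x r" if "0 \<le> s" "s \<le> h" "0 \<le> t" "t \<le> h" for s t
  proof -
    have "dist x (x + s *\<^sub>R v + t *\<^sub>R w) = norm (s *\<^sub>R v + t *\<^sub>R w)"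
      by (metis add.assoc add_diff_cancel_left' dist_commute dist_norm)
    also have "\<dots> \<le> s * norm v + t * norm w"
      using norm_triangle_ineq[of "s *\<^sub>R v" "t *\<^sub>R w"] that by simp
    also have "\<dots> \<le> h * norm v + h * norm w"
      using that by (intro add_mono mult_right_mono) auto
    finally show ?thesis using h by (simp add: algebra_simps)
  qed
  have d: "((\<lambda>s. f (z + s *\<^sub>R v)) has_real_derivative frechet_derivative f (at (z + s *\<^sub>R v)) v) (at s)"
    if "z + s *\<^sub>R v \<in> ball x r" for z s
    using has_vector_derivative_along_line[of f z s v] smooth_on_imp_differentiable[OF f] that S
    by (auto simp: has_real_derivative_iff_has_vector_derivative)
  \<comment> \<open>The mean value theorem for the difference of f along two parallel segments, as a
    function of the step s in direction v.\<close>
  have "\<exists>\<xi>. 0 < \<xi> \<and> \<xi> < h \<and>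
     (f (x + h *\<^sub>R w + h *\<^sub>R v) - f (x + h *\<^sub>R v)) - (f (x + h *\<^sub>R w + 0 *\<^sub>R v) - f (x + 0 *\<^sub>R v)) =
     (h - 0) * (frechet_derivative f (at (x + h *\<^sub>R w + \<xi> *\<^sub>R v)) v - frechet_derivative f (at (x + \<xi> *\<^sub>R v)) v)"
  proof (rule MVT2[OF h(1)])
    fix s assume s: "0 \<le> s" "s \<le> h"
    show "((\<lambda>s. f (x + h *\<^sub>R w + s *\<^sub>R v) - f (x + s *\<^sub>R v)) has_real_derivative
       frechet_derivative f (at (x + h *\<^sub>R w + s *\<^sub>R v)) v - frechet_derivative f (at (x + s *\<^sub>R v)) v) (at s)"
      using inb[of s h] inb[of s 0] s h by (intro DERIV_diff d) (auto simp: algebra_simps)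
  qed
  then obtain \<xi> where \<xi>: "0 < \<xi>" "\<xi> < h"
     "f (x + h *\<^sub>R w + h *\<^sub>R v) - f (x + h *\<^sub>R v) - (f (x + h *\<^sub>R w) - f x) =
     h * (frechet_derivative f (at (x + h *\<^sub>R w + \<xi> *\<^sub>R v)) v - frechet_derivative f (at (x + \<xi> *\<^sub>R v)) v)"
    by auto
  let ?g = "\<lambda>x. frechet_derivative f (at x) v"
  have "\<exists>\<eta>. 0 < \<eta> \<and> \<eta> < h \<and> ?g (x + \<xi> *\<^sub>R v + h *\<^sub>R w) - ?g (x + \<xi> *\<^sub>R v + 0 *\<^sub>R w) =
     (h - 0) * frechet_derivative ?g (at (x + \<xi> *\<^sub>R v + \<eta> *\<^sub>R w)) w"
  proof (rule MVT2[OF h(1)])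
    fix t assume t: "0 \<le> t" "t \<le> h"
    have "?g differentiable (at (x + \<xi> *\<^sub>R v + t *\<^sub>R w))"
      using inb[of \<xi> t] t \<xi> S by (intro smooth_on_imp_differentiable[OF smooth_on_frechet_derivative[OF f]]) auto
    from has_vector_derivative_along_line[OF this]
    show "((\<lambda>t. ?g (x + \<xi> *\<^sub>R v + t *\<^sub>R w)) has_real_derivative
        frechet_derivative ?g (at (x + \<xi> *\<^sub>R v + t *\<^sub>R w)) w) (at t)"
      by (simp add: has_real_derivative_iff_has_vector_derivative)
  qed
  then obtain \<eta> where \<eta>: "0 < \<eta>" "\<eta> < h"
     "?g (x + \<xi> *\<^sub>R v + h *\<^sub>R w) - ?g (x + \<xi> *\<^sub>R v) = h * frechet_derivative ?g (at (x + \<xi> *\<^sub>R v + \<eta> *\<^sub>R w)) w"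
    by auto
  have "f (x + h *\<^sub>R v + h *\<^sub>R w) - f (x + h *\<^sub>R v) - f (x + h *\<^sub>R w) + f x
      = h * (?g (x + \<xi> *\<^sub>R v + h *\<^sub>R w) - ?g (x + \<xi> *\<^sub>R v))"
    using \<xi>(3) by (simp add: add.commute add.left_commute)
  also have "\<dots> = h * h * frechet_derivative ?g (at (x + \<xi> *\<^sub>R v + \<eta> *\<^sub>R w)) w"
    by (simp add: \<eta>(3))
  finally show ?thesis using inb[of \<xi> \<eta>] \<xi> \<eta> by (intro bexI[of _ "x + \<xi> *\<^sub>R v + \<eta> *\<^sub>R w"]) auto
qed

lemma second_derivative_symmetric_real:
  fixes f :: "'a::real_normed_vector \<Rightarrow> real"
  assumes S: "open S" "x \<in> S" and f: "smooth_on S f"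
  shows "frechet_derivative (\<lambda>x. frechet_derivative f (at x) v) (at x) w =
         frechet_derivative (\<lambda>x. frechet_derivative f (at x) w) (at x) v" (is "?G v w x = ?G w v x")
proof (rule ccontr)
  assume ne: "?G v w x \<noteq> ?G w v x"
  define e where "e = \<bar>?G v w x - ?G w v x\<bar> / 2"
  have e: "e > 0" using ne by (simp add: e_def)
  have cont: "isCont (?G v w) x" for v w
    using smooth_on_imp_continuous_on[OF smooth_on_frechet_derivative[OF smooth_on_frechet_derivative[OF f]]] S
    by (auto simp: continuous_on_eq_continuous_at)
  obtain r1 where r1: "r1 > 0" "\<And>p. dist p x < r1 \<Longrightarrow> dist (?G v w p) (?G v w x) < e"
    using cont[of v w] e by (auto simp: continuous_at_eps_delta)
  obtain r2 where r2: "r2 > 0" "\<And>p. dist p x < r2 \<Longrightarrow> dist (?G w v p) (?G w v x) < e"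
    using cont[of w v] e by (auto simp: continuous_at_eps_delta)
  obtain r3 where r3: "r3 > 0" "ball x r3 \<subseteq> S" using S by (auto simp: open_contains_ball)
  define r where "r = min r1 (min r2 r3)"
  have r: "r > 0" "ball x r \<subseteq> S" using r1 r2 r3 by (auto simp: r_def)
  \<comment> \<open>The summand 1 keeps the denominator positive when v and w vanish and makes the
    bound on h strict.\<close>
  define h where "h = r / (norm v + norm w + 1)"
  have N: "norm v + norm w + 1 > 0" by (intro add_nonneg_pos) auto
  have h: "h > 0" "h * (norm v + norm w) < r"
    using r(1) N by (auto simp: h_def field_simps)
  obtain p where p: "p \<in> ball x r" "f (x + h *\<^sub>R v + h *\<^sub>R w) - f (x + h *\<^sub>R v) - f (x + h *\<^sub>R w) + f x = h * h * ?G v w p"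
    using second_difference_mean_value[OF f r(2) h] by auto
  have h': "h * (norm w + norm v) < r" using h(2) by (simp add: add.commute)
  obtain p' where p': "p' \<in> ball x r" "f (x + h *\<^sub>R w + h *\<^sub>R v) - f (x + h *\<^sub>R w) - f (x + h *\<^sub>R v) + f x = h * h * ?G w v p'"
    using second_difference_mean_value[OF f r(2) h(1) h'] by auto
  have "h * h * ?G v w p = h * h * ?G w v p'"
    using p(2) p'(2) by (simp add: algebra_simps)
  then have "?G v w p = ?G w v p'" using h(1) by simp
  moreover have "dist (?G v w p) (?G v w x) < e" "dist (?G w v p') (?G w v x) < e"
    using p(1) p'(1) by (auto intro!: r1 r2 simp: r_def dist_commute)
  ultimately show False unfolding e_def dist_real_def by (simp add: abs_if split: if_splits)
qed

lemma second_derivative_symmetric: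
  fixes f :: "'a::real_normed_vector \<Rightarrow> 'b::euclidean_space"
  assumes S: "open S" "x \<in> S" and f: "smooth_on S f"
  shows "frechet_derivative (\<lambda>x. frechet_derivative f (at x) v) (at x) w =
         frechet_derivative (\<lambda>x. frechet_derivative f (at x) w) (at x) v"
proof (rule euclidean_eqI)
  fix i :: 'b
  have 1: "frechet_derivative (\<lambda>x. f x \<bullet> i) (at y) = (\<lambda>v. frechet_derivative f (at y) v \<bullet> i)" if "y \<in> S" for y
    using smooth_on_imp_has_derivative[OF f that]
    by (intro frechet_derivative_eqI) (auto intro!: derivative_eq_intros)
  have 2: "frechet_derivative (\<lambda>x. frechet_derivative (\<lambda>x. f x \<bullet> i) (at x) v) (at x) =
     (\<lambda>w. frechet_derivative (\<lambda>x. frechet_derivative f (at x) v) (at x) w \<bullet> i)" for v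
  proof (rule frechet_derivative_eqI, rule has_derivative_transform_within_open[OF _ S])
    show "((\<lambda>x. frechet_derivative f (at x) v \<bullet> i) has_derivative
       (\<lambda>w. frechet_derivative (\<lambda>x. frechet_derivative f (at x) v) (at x) w \<bullet> i)) (at x)"
      using smooth_on_imp_has_derivative[OF smooth_on_frechet_derivative[OF f] S(2), of v]
      by (auto intro!: derivative_eq_intros)
  qed (simp add: 1)
  have "smooth_on S (\<lambda>x. f x \<bullet> i)"
    by (rule smooth_on_linear_compose[OF bounded_linear_inner_left S(1) f])
  from second_derivative_symmetric_real[OF S this, of v w]
  show "frechet_derivative (\<lambda>x. frechet_derivative f (at x) v) (at x) w \<bullet> i =
         frechet_derivative (\<lambda>x. frechet_derivative f (at x) w) (at x) v \<bullet> i"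
    by (simp add: 2)
qed

subsection \<open>Metrics that are constant along a horizontal distribution\<close>

text \<open>\<open>frechet_derivative\<close> is a choice among all derivatives at z, so it suffices
  that f and g have the same ones.\<close>

lemma frechet_derivative_cong_open:
  assumes "open S" "z \<in> S" "\<And>z. z \<in> S \<Longrightarrow> f z = g z"
  shows "frechet_derivative f (at z) = frechet_derivative g (at z)"
proof -
  have "(f has_derivative f') (at z) \<longleftrightarrow> (g has_derivative f') (at z)" for f'
    using has_derivative_transform_within_open[OF _ assms(1,2), of f f' UNIV g]
      has_derivative_transform_within_open[OF _ assms(1,2), of g f' UNIV f] assms(3) by auto
  then show ?thesis by (simp add: frechet_derivative_def)
qed

section \<open>Coordinate partial derivatives as Frechet derivatives\<close>

lemma open_line_preimage:
  fixes z v :: "'a::real_normed_vector"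
  assumes "open D"
  shows "open {t. z + t *\<^sub>R v \<in> D}"
proof -
  have "continuous_on UNIV (\<lambda>t. z + t *\<^sub>R v)" by (intro continuous_intros)
  from open_vimage[OF assms this] show ?thesis by (simp add: vimage_def)
qed

text \<open>Bridge from the one-variable \<open>deriv\<close> in the definitions to joint Frechet
  derivatives. Agreement of h with H inside the open set D is enough, which allows D to exclude the
  zero vector.\<close>

lemma deriv_along_line:
  fixes H :: "'a::real_normed_vector \<Rightarrow> real"
  assumes D: "open D" "z \<in> D" and h: "\<And>t. z + t *\<^sub>R v \<in> D \<Longrightarrow> h t = H (z + t *\<^sub>R v)"
    and d: "H differentiable (at z)"
  shows "(h has_real_derivative frechet_derivative H (at z) v) (at 0)"
proof -
  have "((\<lambda>t. H (z + t *\<^sub>R v)) has_real_derivative frechet_derivative H (at z) v) (at 0)"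
    using has_vector_derivative_along_line[of H z 0 v] d
    by (simp add: has_real_derivative_iff_has_vector_derivative)
  then show ?thesis
    by (rule has_field_derivative_transform_within_open[OF _ open_line_preimage[OF D(1), of z v]])
      (use D h in auto)
qed

lemma partial_x_eq_frechet_derivative:
  assumes "open D" "(x, y) \<in> D" "\<And>x y. (x, y) \<in> D \<Longrightarrow> h x y = H (x, y)" "H differentiable (at (x, y))"
  shows "partial_x k h x y = frechet_derivative H (at (x, y)) (axis k 1, 0)"
  unfolding partial_x_def
  by (rule DERIV_imp_deriv, rule deriv_along_line[OF assms(1,2) _ assms(4)]) (use assms(3) in auto)

lemma partial_y_eq_frechet_derivative:
  assumes "open D" "(x, y) \<in> D" "\<And>x y. (x, y) \<in> D \<Longrightarrow> h x y = H (x, y)" "H differentiable (at (x, y))"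
  shows "partial_y k h x y = frechet_derivative H (at (x, y)) (0, axis k 1)"
  unfolding partial_y_def
  by (rule DERIV_imp_deriv, rule deriv_along_line[OF assms(1,2) _ assms(4)]) (use assms(3) in auto)

lemma matrix_inv_mult_vec:
  fixes M :: "real^'n^'n"
  assumes "invertible M"
  shows "matrix_inv M *v (M *v w) = w"
proof -
  have "matrix_inv M ** M = mat 1"
    using someI_ex[OF assms[unfolded invertible_def]] by (simp add: matrix_inv_def)
  then show ?thesis by (simp add: matrix_vector_mul_assoc)
qed

text \<open>\<open>\<Gamma> x v w\<close> stands for Christoffel symbols contracted with v and w,
  and \<open>(v, - \<Gamma> x v y)\<close> is the horizontal lift of v at (x, y). The assumption
  \<open>horizontal\<close> says that F^2 is constant along all such lifts.\<close>

locale horizontally_constant =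
  fixes A :: "('a::topological_space, real^'n) chart set" and F :: "'a \<Rightarrow> 'a tvec \<Rightarrow> real"
    and c :: "('a, real^'n) chart" and \<Omega> :: "(real^'n) set"
    and \<Gamma> :: "real^'n \<Rightarrow> real^'n \<Rightarrow> real^'n \<Rightarrow> real^'n"
  assumes open_\<Omega>: "open \<Omega>"
    and smooth_F2: "smooth_on (\<Omega> \<times> - {0}) (\<lambda>(x, y). local_F2 A F c x y)"
    and linear_\<Gamma>: "x \<in> \<Omega> \<Longrightarrow> linear (\<Gamma> x v)"
    and sym_\<Gamma>: "x \<in> \<Omega> \<Longrightarrow> \<Gamma> x v w = \<Gamma> x w v"
    and horizontal: "x \<in> \<Omega> \<Longrightarrow> y \<noteq> 0 \<Longrightarrow>
      frechet_derivative (\<lambda>(x, y). local_F2 A F c x y) (at (x, y)) (v, - \<Gamma> x v y) = 0"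
    and invertible_gmat: "x \<in> \<Omega> \<Longrightarrow> y \<noteq> 0 \<Longrightarrow> invertible (gmat A F c x y)"
begin

abbreviation "D \<equiv> \<Omega> \<times> (- {0 :: real^'n})"
abbreviation "L \<equiv> (\<lambda>(x, y). local_F2 A F c x y)"
abbreviation Dx :: "'n \<Rightarrow> ((real^'n) \<times> (real^'n) \<Rightarrow> real) \<Rightarrow> (real^'n) \<times> (real^'n) \<Rightarrow> real"
  where "Dx k H z \<equiv> frechet_derivative H (at z) (axis k 1, 0)"
abbreviation Dy :: "'n \<Rightarrow> ((real^'n) \<times> (real^'n) \<Rightarrow> real) \<Rightarrow> (real^'n) \<times> (real^'n) \<Rightarrow> real"
  where "Dy k H z \<equiv> frechet_derivative H (at z) (0, axis k 1)"

lemma open_D: "open D"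
  by (intro open_Times open_\<Omega>) auto

lemma smooth_Dx: "smooth_on D H \<Longrightarrow> smooth_on D (Dx k H)"
  and smooth_Dy: "smooth_on D H \<Longrightarrow> smooth_on D (Dy k H)"
  by (rule smooth_on_frechet_derivative; assumption)+

lemma Dy_commute: "smooth_on D H \<Longrightarrow> z \<in> D \<Longrightarrow> Dy i (Dy j H) z = Dy j (Dy i H) z"
  and Dx_Dy: "smooth_on D H \<Longrightarrow> z \<in> D \<Longrightarrow> Dx k (Dy j H) z = Dy j (Dx k H) z"
  by (rule second_derivative_symmetric[OF open_D]; assumption)+

lemma Dy_cong: "z \<in> D \<Longrightarrow> (\<And>z. z \<in> D \<Longrightarrow> H z = K z) \<Longrightarrow> Dy i H z = Dy i K z"
  by (simp add: frechet_derivative_cong_open[OF open_D, of z H K])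

text \<open>\<open>linear_\<Gamma>\<close> speaks of the second slot; symmetry moves the expansion
  along the axes into the first.\<close>

lemma Gamma_scale_sum: "x \<in> \<Omega> \<Longrightarrow> (\<Sum>k\<in>UNIV. y $ k * \<Gamma> x (axis k 1) w $ m) = \<Gamma> x y w $ m"
proof -
  assume x: "x \<in> \<Omega>"
  have "\<Gamma> x y w = \<Gamma> x w (\<Sum>k\<in>UNIV. (y $ k) *\<^sub>R axis k 1)"
    using sym_\<Gamma>[OF x] by (simp flip: vec_eq_sum_axis)
  also have "\<dots> = (\<Sum>k\<in>UNIV. (y $ k) *\<^sub>R \<Gamma> x (axis k 1) w)"
    using sym_\<Gamma>[OF x] by (simp add: linear_sum[OF linear_\<Gamma>[OF x]] linear_cmul[OF linear_\<Gamma>[OF x]])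
  finally show ?thesis by simp
qed

text \<open>A coordinate vector in x is a horizontal lift plus a vertical vector with components
  \<Gamma>, and L does not change along the lift.\<close>

lemma Dx_L:
  assumes "x \<in> \<Omega>" "y \<noteq> 0"
  shows "Dx k L (x, y) = (\<Sum>m\<in>UNIV. \<Gamma> x (axis k 1) y $ m * Dy m L (x, y))"
proof -
  let ?w = "\<Gamma> x (axis k 1) y"
  have lin: "linear (frechet_derivative L (at (x, y)))"
    by (rule linear_frechet_derivative, rule smooth_on_imp_differentiable[OF smooth_F2]) (use assms in auto)
  have "(axis k 1, 0) = (axis k 1, - ?w) + (\<Sum>m\<in>UNIV. (?w $ m) *\<^sub>R ((0 :: real^'n), (axis m 1 :: real^'n)))"
  proof -
    have "(\<Sum>m\<in>UNIV. (?w $ m) *\<^sub>R ((0 :: real^'n), (axis m 1 :: real^'n))) = (0, ?w)"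
      by (simp add: prod_eq_iff fst_sum snd_sum flip: vec_eq_sum_axis)
    then show ?thesis by simp
  qed
  then have "Dx k L (x, y) = frechet_derivative L (at (x, y))
      ((axis k 1, - ?w) + (\<Sum>m\<in>UNIV. (?w $ m) *\<^sub>R (0, axis m 1)))" by metis
  also have "\<dots> = (\<Sum>m\<in>UNIV. ?w $ m * Dy m L (x, y))"
    unfolding linear_add[OF lin] linear_sum[OF lin] linear_cmul[OF lin] horizontal[OF assms]
    by simp
  finally show ?thesis .
qed

text \<open>One y-derivative of the shape that occurs in \<open>Dx_L\<close> and
  \<open>Dx_Dy_L\<close>. The factor \<Gamma> x v y is linear in y, so its derivative is \<Gamma> x
  v at the axis vector; the coefficients a collect the factors free of y.\<close>

lemma Dy_Gamma_combination:
  assumes x: "x \<in> \<Omega>" and y: "y \<noteq> 0" and sm: "\<And>m. smooth_on D (P m)" "\<And>m. smooth_on D (R m)" "smooth_on D K"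
    and K: "\<And>y. y \<noteq> 0 \<Longrightarrow> K (x, y) = (\<Sum>m\<in>UNIV. a m * P m (x, y) + \<Gamma> x v y $ m * R m (x, y))"
  shows "Dy l K (x, y) =
    (\<Sum>m\<in>UNIV. a m * Dy l (P m) (x, y) + \<Gamma> x v (axis l 1) $ m * R m (x, y) + \<Gamma> x v y $ m * Dy l (R m) (x, y))"
proof -
  have der: "((\<lambda>t. H (x, y + t *\<^sub>R axis l 1)) has_real_derivative Dy l H (x, y)) (at 0)" if "smooth_on D H" for H
    by (rule deriv_along_line[OF open_D _ _ smooth_on_imp_differentiable[OF that]]) (use x y in auto)
  have G: "((\<lambda>t. \<Gamma> x v (y + t *\<^sub>R axis l 1) $ m) has_real_derivative \<Gamma> x v (axis l 1) $ m) (at 0)" for m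
    by (auto intro!: derivative_eq_intros simp: linear_add[OF linear_\<Gamma>[OF x]] linear_cmul[OF linear_\<Gamma>[OF x]])
  have "((\<lambda>t. \<Sum>m\<in>UNIV. a m * P m (x, y + t *\<^sub>R axis l 1)
          + \<Gamma> x v (y + t *\<^sub>R axis l 1) $ m * R m (x, y + t *\<^sub>R axis l 1)) has_real_derivative
        (\<Sum>m\<in>UNIV. a m * Dy l (P m) (x, y) + (\<Gamma> x v (axis l 1) $ m * R m (x, y) + Dy l (R m) (x, y) * \<Gamma> x v y $ m))) (at 0)"
    using DERIV_mult[OF G der[OF sm(2)]] by (intro DERIV_sum DERIV_add DERIV_cmult der sm) simp
  then have "((\<lambda>t. K (x, y + t *\<^sub>R axis l 1)) has_real_derivative
        (\<Sum>m\<in>UNIV. a m * Dy l (P m) (x, y) + (\<Gamma> x v (axis l 1) $ m * R m (x, y) + Dy l (R m) (x, y) * \<Gamma> x v y $ m))) (at 0)"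
    by (rule has_field_derivative_transform_within_open[OF _ open_line_preimage[of "- {0}" y "axis l 1"]])
      (use y K in auto)
  from DERIV_unique[OF der[OF sm(3)] this] show ?thesis
    by (simp add: algebra_simps)
qed

lemma Dx_Dy_L:
  assumes x: "x \<in> \<Omega>" and y: "y \<noteq> 0"
  shows "Dx k (Dy l L) (x, y) = (\<Sum>m\<in>UNIV. \<Gamma> x (axis k 1) (axis l 1) $ m * Dy m L (x, y)
    + \<Gamma> x (axis k 1) y $ m * Dy l (Dy m L) (x, y))"
proof -
  \<comment> \<open>The summand with factor 0 fills the place of \<open>a m * P m\<close>.\<close>
  have "Dy l (Dx k L) (x, y) = (\<Sum>m\<in>UNIV. 0 * Dy l L (x, y) + \<Gamma> x (axis k 1) (axis l 1) $ m * Dy m L (x, y)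
    + \<Gamma> x (axis k 1) y $ m * Dy l (Dy m L) (x, y))"
    by (rule Dy_Gamma_combination[OF x y smooth_F2 smooth_Dy[OF smooth_F2] smooth_Dx[OF smooth_F2]])
      (simp add: Dx_L[OF x])
  then show ?thesis using Dx_Dy[OF smooth_F2, where z = "(x, y)" and k = k and j = l] x y by simp
qed

text \<open>The horizontality identity differentiated twice in y. The last sum is written with the
  index m outermost so that it matches the vertical correction in \<open>hderiv\<close>.\<close>

lemma Dx_Dy_Dy_L:
  assumes x: "x \<in> \<Omega>" and y: "y \<noteq> 0"
  shows "Dx k (Dy l (Dy j L)) (x, y) = (\<Sum>m\<in>UNIV. \<Gamma> x (axis k 1) (axis j 1) $ m * Dy l (Dy m L) (x, y)
    + \<Gamma> x (axis k 1) (axis l 1) $ m * Dy j (Dy m L) (x, y) + \<Gamma> x (axis k 1) y $ m * Dy m (Dy l (Dy j L)) (x, y))"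
proof -
  have z: "(x, y) \<in> D" using x y by auto
  have third: "Dy l (Dy j (Dy m L)) (x, y) = Dy m (Dy l (Dy j L)) (x, y)" for m
  proof -
    have "Dy l (Dy j (Dy m L)) (x, y) = Dy l (Dy m (Dy j L)) (x, y)"
      by (rule Dy_cong[OF z Dy_commute[OF smooth_F2]])
    then show ?thesis using Dy_commute[OF smooth_Dy[OF smooth_F2] z, where i = l and j = m] by simp
  qed
  have "Dx k (Dy l (Dy j L)) (x, y) = Dy l (Dx k (Dy j L)) (x, y)"
    by (rule Dx_Dy[OF smooth_Dy[OF smooth_F2] z])
  also have "\<dots> = (\<Sum>m\<in>UNIV. \<Gamma> x (axis k 1) (axis j 1) $ m * Dy l (Dy m L) (x, y)
    + \<Gamma> x (axis k 1) (axis l 1) $ m * Dy j (Dy m L) (x, y) + \<Gamma> x (axis k 1) y $ m * Dy l (Dy j (Dy m L)) (x, y))"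
    by (rule Dy_Gamma_combination[OF x y smooth_Dy[OF smooth_F2] smooth_Dy[OF smooth_Dy[OF smooth_F2]]
          smooth_Dx[OF smooth_Dy[OF smooth_F2]]])
      (rule Dx_Dy_L[OF x])
  finally show ?thesis by (simp only: third)
qed

section \<open>Fundamental tensor, spray and Chern coefficients under horizontal constancy\<close>

lemma partial_y_L: "z \<in> D \<Longrightarrow> partial_y l (local_F2 A F c) (fst z) (snd z) = Dy l L z"
  using partial_y_eq_frechet_derivative[OF open_D, of "fst z" "snd z" "local_F2 A F c" L l]
    smooth_on_imp_differentiable[OF smooth_F2] by auto

lemma gmat_eq: "z \<in> D \<Longrightarrow> gmat A F c (fst z) (snd z) $ i $ j = Dy i (Dy j L) z / 2"
  using partial_y_eq_frechet_derivative[OF open_D, of "fst z" "snd z" "partial_y j (local_F2 A F c)" "Dy j L" i]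
    partial_y_L smooth_on_imp_differentiable[OF smooth_Dy[OF smooth_F2]] by (force simp: gmat_def)

text \<open>Contracting \<open>Dx_Dy_L\<close> with y yields a first-order term, which the
  subtracted \<open>Dx_L\<close> cancels, and a second-order term equal to the matrix g applied to 2
  \<Gamma> y y. The factor 1/4 of the spray leaves \<Gamma> y y / 2.\<close>

lemma spray_eq:
  assumes x: "x \<in> \<Omega>" and y: "y \<noteq> 0"
  shows "spray A F c i x y = \<Gamma> x y y $ i / 2"
proof -
  let ?g = "gmat A F c x y"
  have z: "(x, y) \<in> D" using x y by auto
  have gm: "Dy l (Dy m L) (x, y) = 2 * ?g $ l $ m" for l m
    using gmat_eq[OF z, of l m] by simp
  have 1: "partial_x k (partial_y l (local_F2 A F c)) x y = Dx k (Dy l L) (x, y)" for k l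
    by (rule partial_x_eq_frechet_derivative[OF open_D z])
      (use partial_y_L smooth_on_imp_differentiable[OF smooth_Dy[OF smooth_F2] z] in \<open>force+\<close>)
  have 2: "partial_x l (local_F2 A F c) x y = Dx l L (x, y)" for l
    by (rule partial_x_eq_frechet_derivative[OF open_D z])
      (use smooth_on_imp_differentiable[OF smooth_F2 z] in auto)
  have "(\<Sum>k\<in>UNIV. partial_x k (partial_y l (local_F2 A F c)) x y * y $ k) - partial_x l (local_F2 A F c) x y
     = (?g *v (2 *\<^sub>R \<Gamma> x y y)) $ l" for l
  proof -
    have "(\<Sum>k\<in>UNIV. Dx k (Dy l L) (x, y) * y $ k)
      = (\<Sum>k\<in>UNIV. \<Sum>m\<in>UNIV. y $ k * \<Gamma> x (axis k 1) (axis l 1) $ m * Dy m L (x, y)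
         + y $ k * \<Gamma> x (axis k 1) y $ m * Dy l (Dy m L) (x, y))"
      by (simp add: Dx_Dy_L[OF x y] sum_distrib_left sum_distrib_right algebra_simps)
    also have "\<dots> = (\<Sum>m\<in>UNIV. (\<Sum>k\<in>UNIV. y $ k * \<Gamma> x (axis k 1) (axis l 1) $ m) * Dy m L (x, y)
         + (\<Sum>k\<in>UNIV. y $ k * \<Gamma> x (axis k 1) y $ m) * Dy l (Dy m L) (x, y))"
      by (subst sum.swap) (simp add: sum_distrib_right sum.distrib)
    also have "\<dots> = (\<Sum>m\<in>UNIV. \<Gamma> x (axis l 1) y $ m * Dy m L (x, y) + \<Gamma> x y y $ m * Dy l (Dy m L) (x, y))"
      by (simp add: Gamma_scale_sum[OF x] sym_\<Gamma>[OF x, of "axis l 1" y])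
    finally show ?thesis
      by (simp add: gm 1 2 Dx_L[OF x y] sum.distrib matrix_vector_mult_def algebra_simps)
  qed
  then have "spray A F c i x y = 1/4 * (matrix_inv ?g *v (?g *v (2 *\<^sub>R \<Gamma> x y y))) $ i"
    by (simp add: spray_def matrix_vector_mult_def[of "matrix_inv _"])
  then show ?thesis by (simp add: matrix_inv_mult_vec[OF invertible_gmat[OF x y]])
qed

text \<open>The spray is half a quadratic form in y, so its y-derivative is the polarised form; the
  proof expands it as a polynomial in t.\<close>

lemma nonlinear_conn_eq:
  assumes x: "x \<in> \<Omega>" and y: "y \<noteq> 0"
  shows "nonlinear_conn A F c i j x y = \<Gamma> x (axis j 1) y $ i"
proof -
  have "((\<lambda>t. (\<Gamma> x y y $ i + t * (2 * \<Gamma> x (axis j 1) y $ i) + t * t * \<Gamma> x (axis j 1) (axis j 1) $ i) / 2)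
     has_real_derivative \<Gamma> x (axis j 1) y $ i) (at 0)"
    by (auto intro!: derivative_eq_intros)
  moreover have "(\<Gamma> x y y $ i + t * (2 * \<Gamma> x (axis j 1) y $ i) + t * t * \<Gamma> x (axis j 1) (axis j 1) $ i) / 2 =
     \<Gamma> x (y + t *\<^sub>R axis j 1) (y + t *\<^sub>R axis j 1) $ i / 2" for t
  proof -
    have l1: "\<Gamma> x a (b + t *\<^sub>R d) = \<Gamma> x a b + t *\<^sub>R \<Gamma> x a d" for a b d
      by (simp add: linear_add[OF linear_\<Gamma>[OF x]] linear_cmul[OF linear_\<Gamma>[OF x]])
    have l2: "\<Gamma> x (b + t *\<^sub>R d) a = \<Gamma> x b a + t *\<^sub>R \<Gamma> x d a" for a b d
      using l1[of a b d] sym_\<Gamma>[OF x] by simp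
    show ?thesis using sym_\<Gamma>[OF x, of y "axis j 1"] by (simp add: l1 l2 algebra_simps)
  qed
  ultimately have "((\<lambda>t. \<Gamma> x (y + t *\<^sub>R axis j 1) (y + t *\<^sub>R axis j 1) $ i / 2)
     has_real_derivative \<Gamma> x (axis j 1) y $ i) (at 0)" by simp
  then have "((\<lambda>t. spray A F c i x (y + t *\<^sub>R axis j 1)) has_real_derivative \<Gamma> x (axis j 1) y $ i) (at 0)"
    by (rule has_field_derivative_transform_within_open[OF _ open_line_preimage[of "- {0}" y "axis j 1"]])
      (use y spray_eq[OF x] in auto)
  then show ?thesis unfolding nonlinear_conn_def partial_y_def by (rule DERIV_imp_deriv)
qed

lemma hderiv_eq:
  assumes x: "x \<in> \<Omega>" and y: "y \<noteq> 0"
    and h: "\<And>x y. (x, y) \<in> D \<Longrightarrow> h x y = H (x, y)" "H differentiable (at (x, y))"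
  shows "hderiv A F c k h x y = Dx k H (x, y) - (\<Sum>m\<in>UNIV. \<Gamma> x (axis k 1) y $ m * Dy m H (x, y))"
proof -
  have z: "(x, y) \<in> D" using x y by auto
  show ?thesis
    using partial_x_eq_frechet_derivative[OF open_D z h] partial_y_eq_frechet_derivative[OF open_D z h]
    by (simp add: hderiv_def nonlinear_conn_eq[OF x y])
qed

text \<open>The third y-derivatives of F^2 in \<open>Dx_Dy_Dy_L\<close> are exactly what the
  vertical part of \<open>hderiv\<close> subtracts. The Cartan tensor thereby disappears and only
  metric compatibility of \<Gamma> is left.\<close>

lemma hderiv_gmat:
  assumes x: "x \<in> \<Omega>" and y: "y \<noteq> 0"
  shows "hderiv A F c k (\<lambda>x y. gmat A F c x y $ l $ j) x y =
    (\<Sum>m\<in>UNIV. \<Gamma> x (axis k 1) (axis j 1) $ m * gmat A F c x y $ l $ m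
      + \<Gamma> x (axis k 1) (axis l 1) $ m * gmat A F c x y $ j $ m)"
proof -
  have z: "(x, y) \<in> D" using x y by auto
  have d: "Dy l (Dy j L) differentiable (at (x, y))"
    by (rule smooth_on_imp_differentiable[OF smooth_Dy[OF smooth_Dy[OF smooth_F2]] z])
  have gm: "Dy i (Dy j L) (x, y) = 2 * gmat A F c x y $ i $ j" for i j
    using gmat_eq[OF z, of i j] by simp
  have half: "frechet_derivative (\<lambda>z. Dy l (Dy j L) z / 2) (at (x, y)) =
     (\<lambda>v. frechet_derivative (Dy l (Dy j L)) (at (x, y)) v / 2)"
    using d by (intro frechet_derivative_eqI) (auto intro!: derivative_eq_intros simp: frechet_derivative_works)
  have "hderiv A F c k (\<lambda>x y. gmat A F c x y $ l $ j) x y =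
     Dx k (\<lambda>z. Dy l (Dy j L) z / 2) (x, y) - (\<Sum>m\<in>UNIV. \<Gamma> x (axis k 1) y $ m * Dy m (\<lambda>z. Dy l (Dy j L) z / 2) (x, y))"
    by (rule hderiv_eq[OF x y]) (use gmat_eq d in \<open>force intro: derivative_intros\<close>)+
  then show ?thesis
    by (simp add: gm half Dx_Dy_Dy_L[OF x y] sum.distrib sum_divide_distrib add_divide_distrib)
qed

text \<open>The Christoffel computation: of the six terms supplied by \<open>hderiv_gmat\<close>,
  four cancel in pairs by symmetry of \<Gamma> and two coincide.\<close>

theorem chern_eq:
  assumes x: "x \<in> \<Omega>" and y: "y \<noteq> 0"
  shows "chern A F c i j k x y = \<Gamma> x (axis k 1) (axis j 1) $ i"
proof -
  let ?g = "gmat A F c x y"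
  have "hderiv A F c k (\<lambda>x y. gmat A F c x y $ l $ j) x y + hderiv A F c j (\<lambda>x y. gmat A F c x y $ l $ k) x y
      - hderiv A F c l (\<lambda>x y. gmat A F c x y $ j $ k) x y = (?g *v (2 *\<^sub>R \<Gamma> x (axis k 1) (axis j 1))) $ l" for l
    using sym_\<Gamma>[OF x, of "axis j 1" "axis k 1"] sym_\<Gamma>[OF x, of "axis l 1" "axis k 1"]
      sym_\<Gamma>[OF x, of "axis l 1" "axis j 1"]
    by (simp add: hderiv_gmat[OF x y] sum.distrib matrix_vector_mult_def algebra_simps flip: sum_distrib_left)
  then have "chern A F c i j k x y = 1/2 * (matrix_inv ?g *v (?g *v (2 *\<^sub>R \<Gamma> x (axis k 1) (axis j 1)))) $ i"
    by (simp add: chern_def matrix_vector_mult_def[of "matrix_inv _"])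
  then show ?thesis by (simp add: matrix_inv_mult_vec[OF invertible_gmat[OF x y]])
qed

end

subsection \<open>Tangent vectors in charts\<close>

locale smooth_atlas =
  fixes A :: "('a::{t2_space,second_countable_topology}, real^'n) chart set"
  assumes manifold: "smooth_manifold A"
begin

lemma chart_at: obtains c where "c \<in> A" "p \<in> cdom c"
proof -
  have "p \<in> (\<Union>c\<in>A. cdom c)" using manifold by (simp add: smooth_manifold_def)
  then show ?thesis using that by blast
qed

context
  fixes c assumes c: "c \<in> A"
begin

lemma open_cdom: "open (cdom c)" and open_cimg: "open (cimg c)"
  and homeomorphism_chart: "homeomorphism (cdom c) (cimg c) (cmap c) (cinv c)"
  using manifold c by (auto simp: smooth_manifold_def)

lemma cinv_cmap: "p \<in> cdom c \<Longrightarrow> cinv c (cmap c p) = p"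
  using homeomorphism_chart by (simp add: homeomorphism_def)

lemma cmap_cinv: "x \<in> cimg c \<Longrightarrow> cmap c (cinv c x) = x"
  by (rule f_inv_into_f)

lemma cinv_in_cdom: "x \<in> cimg c \<Longrightarrow> cinv c x \<in> cdom c"
  by (rule inv_into_into)

lemma continuous_on_cmap: "continuous_on (cdom c) (cmap c)"
  and continuous_on_cinv: "continuous_on (cimg c) (cinv c)"
  using homeomorphism_chart by (simp_all add: homeomorphism_def)

lemma cmap_image_Int: "cmap c ` (T \<inter> cdom c) = cimg c \<inter> cinv c -` T"
  using cinv_cmap by (auto simp: cmap_cinv image_iff intro!: bexI cinv_in_cdom) 

lemma open_cmap_image: "open T \<Longrightarrow> open (cmap c ` (T \<inter> cdom c))"
  unfolding cmap_image_Int by (rule continuous_open_preimage[OF continuous_on_cinv open_cimg])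

lemma open_cinv_image: "open S \<Longrightarrow> open (cdom c \<inter> cmap c -` S)"
  by (rule continuous_open_preimage[OF continuous_on_cmap open_cdom])

end

lemma smooth_transition:
  "c \<in> A \<Longrightarrow> d \<in> A \<Longrightarrow> smooth_on (cmap c ` (cdom c \<inter> cdom d)) (cmap d \<circ> cinv c)"
  using manifold by (auto simp: smooth_manifold_def)

text \<open>\<open>smooth_near\<close> quantifies over all charts; the transition maps reduce it to
  a single one.\<close>

lemma smooth_nearI:
  assumes c: "c \<in> A" and S: "open S" "S \<subseteq> cimg c" "smooth_on S (f \<circ> cinv c)" and p: "p \<in> cdom c" "cmap c p \<in> S"
  shows "smooth_near A p f"
  unfolding smooth_near_def
proof (intro exI conjI ballI)
  let ?T = "cdom c \<inter> cmap c -` S"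
  show "open ?T" by (rule open_cinv_image[OF c S(1)])
  show "p \<in> ?T" using p by auto
  fix d assume d: "d \<in> A"
  have o: "open (cmap d ` (?T \<inter> cdom d))" by (rule open_cmap_image[OF d \<open>open ?T\<close>])
  have "smooth_on (cmap d ` (?T \<inter> cdom d)) (\<lambda>x. (f \<circ> cinv c) ((cmap c \<circ> cinv d) x))"
    by (rule smooth_on_compose[OF S(3) smooth_on_subset[OF smooth_transition[OF d c]] o S(1)])
      (auto simp: cinv_cmap[OF d])
  then show "smooth_on (cmap d ` (?T \<inter> cdom d)) (f \<circ> cinv d)"
    by (rule smooth_on_cong[OF o, rotated]) (auto simp: cinv_cmap[OF d] cinv_cmap[OF c])
qed

lemma smooth_nearE:
  assumes "smooth_near A p f" "c \<in> A" "p \<in> cdom c"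
  obtains S where "open S" "cmap c p \<in> S" "S \<subseteq> cimg c" "smooth_on S (f \<circ> cinv c)"
proof -
  from assms obtain T where "open T" "p \<in> T" "smooth_on (cmap c ` (T \<inter> cdom c)) (f \<circ> cinv c)"
    by (auto simp: smooth_near_def)
  then show ?thesis
    using that[of "cmap c ` (T \<inter> cdom c)"] open_cmap_image[OF assms(2)] assms(3) by auto
qed

lemma smooth_near_differentiable:
  assumes "smooth_near A p f" "c \<in> A" "p \<in> cdom c"
  shows "(f \<circ> cinv c) differentiable (at (cmap c p))"
  using smooth_nearE[OF assms] smooth_on_imp_differentiable by metis

lemma coord_comp_cinv:
  assumes "c \<in> A" "x \<in> cimg c"
  shows "frechet_derivative ((\<lambda>q. cmap c q $ i) \<circ> cinv c) (at x) = (\<lambda>\<eta>. \<eta> $ i)"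
proof -
  have "frechet_derivative ((\<lambda>q. cmap c q $ i) \<circ> cinv c) (at x) = frechet_derivative (\<lambda>x. x $ i) (at x)"
    by (rule frechet_derivative_cong_open[OF open_cimg[OF assms(1)] assms(2)]) (simp add: cmap_cinv[OF assms(1)])
  also have "\<dots> = (\<lambda>\<eta>. \<eta> $ i)"
    by (rule frechet_derivative_eqI, rule bounded_linear_imp_has_derivative[OF bounded_linear_vec_nth])
  finally show ?thesis .
qed

lemma smooth_near_coord:
  assumes "c \<in> A" "p \<in> cdom c"
  shows "smooth_near A p (\<lambda>q. cmap c q $ i)"
proof (rule smooth_nearI[OF assms(1) open_cimg[OF assms(1)] _ _ assms(2)])
  show "smooth_on (cimg c) ((\<lambda>q. cmap c q $ i) \<circ> cinv c)"
    by (rule smooth_on_cong[OF open_cimg[OF assms(1)] _ smooth_on_bounded_linear[OF bounded_linear_vec_nth[of i]]])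
      (simp add: cmap_cinv[OF assms(1)])
qed (use assms in auto)

text \<open>Coordinate functions are smooth near p, so they never fall under the default value 0 of
  \<open>dvec\<close>.\<close>

lemma components_dvec: "c \<in> A \<Longrightarrow> p \<in> cdom c \<Longrightarrow> components c (dvec A c p \<eta>) = \<eta>"
  by (simp add: vec_eq_iff components_def dvec_def smooth_near_coord coord_comp_cinv[OF _ imageI])

lemma dvec_linear:
  assumes "c \<in> A" "p \<in> cdom c"
  shows "(\<lambda>f. r * dvec A c p \<eta> f + s * dvec A c p \<zeta> f) = dvec A c p (r *\<^sub>R \<eta> + s *\<^sub>R \<zeta>)"
proof
  fix f
  show "r * dvec A c p \<eta> f + s * dvec A c p \<zeta> f = dvec A c p (r *\<^sub>R \<eta> + s *\<^sub>R \<zeta>) f"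
    using linear_frechet_derivative[OF smooth_near_differentiable[OF _ assms]]
    by (simp add: dvec_def linear_add linear_cmul)
qed

lemma dvec_scale: "c \<in> A \<Longrightarrow> p \<in> cdom c \<Longrightarrow> (\<lambda>f. r * dvec A c p \<eta> f) = dvec A c p (r *\<^sub>R \<eta>)"
  using dvec_linear[of c p r \<eta> 0 \<eta>] by simp

lemma dvec_0: "c \<in> A \<Longrightarrow> p \<in> cdom c \<Longrightarrow> dvec A c p 0 = (\<lambda>f. 0)"
  using dvec_scale[of c p 0 0] by simp

text \<open>The chain rule for the transition map; on functions that are not smooth near p both
  sides are 0 by convention. It makes the vectors of any one chart exhaust the tangent
  space.\<close>

lemma dvec_change_chart:
  assumes c: "c \<in> A" "p \<in> cdom c" and d: "d \<in> A" "p \<in> cdom d"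
  shows "dvec A c p \<eta> = dvec A d p (frechet_derivative (cmap d \<circ> cinv c) (at (cmap c p)) \<eta>)"
proof
  fix f
  show "dvec A c p \<eta> f = dvec A d p (frechet_derivative (cmap d \<circ> cinv c) (at (cmap c p)) \<eta>) f"
  proof (cases "smooth_near A p f")
    case True
    let ?\<tau> = "cmap d \<circ> cinv c"
    have o: "open (cmap c ` (cdom d \<inter> cdom c))" by (rule open_cmap_image[OF c(1) open_cdom[OF d(1)]])
    have i: "cmap c p \<in> cmap c ` (cdom d \<inter> cdom c)" using c d by auto
    have \<tau>: "(?\<tau> has_derivative frechet_derivative ?\<tau> (at (cmap c p))) (at (cmap c p))"
      using smooth_on_imp_has_derivative[OF smooth_transition[OF c(1) d(1)], of "cmap c p"] i by (simp add: Int_commute)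
    have "((f \<circ> cinv d) has_derivative frechet_derivative (f \<circ> cinv d) (at (cmap d p))) (at (?\<tau> (cmap c p)))"
      using smooth_near_differentiable[OF True d] by (simp add: cinv_cmap[OF c] frechet_derivative_works)
    from diff_chain_at[OF \<tau> this]
    have "((f \<circ> cinv d) \<circ> ?\<tau> has_derivative (frechet_derivative (f \<circ> cinv d) (at (cmap d p)) \<circ> frechet_derivative ?\<tau> (at (cmap c p)))) (at (cmap c p))" .
    then have "frechet_derivative ((f \<circ> cinv d) \<circ> ?\<tau>) (at (cmap c p)) =
       frechet_derivative (f \<circ> cinv d) (at (cmap d p)) \<circ> frechet_derivative ?\<tau> (at (cmap c p))"
      by (rule frechet_derivative_eqI)
    moreover have "frechet_derivative (f \<circ> cinv c) (at (cmap c p)) = frechet_derivative ((f \<circ> cinv d) \<circ> ?\<tau>) (at (cmap c p))"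
      by (rule frechet_derivative_cong_open[OF o i]) (auto simp: cinv_cmap[OF c(1)] cinv_cmap[OF d(1)])
    ultimately show ?thesis using True by (simp add: dvec_def)
  qed (simp add: dvec_def)
qed

lemma tangent_space_chart:
  assumes "c \<in> A" "p \<in> cdom c"
  shows "tangent_space A p = range (dvec A c p)"
  unfolding tangent_space_def using assms dvec_change_chart[OF _ _ assms] by blast

lemma dvec_components:
  assumes "c \<in> A" "p \<in> cdom c" "v \<in> tangent_space A p"
  shows "dvec A c p (components c v) = v"
  using assms by (auto simp: tangent_space_chart components_dvec)

lemma vector_field_dvec:
  assumes "vector_field A X" "c \<in> A" "p \<in> cdom c"
  shows "X p = dvec A c p (local_field c X (cmap c p))"
  using assms dvec_components[of c p "X p"] by (simp add: local_field_def cinv_cmap vector_field_def)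

lemma smooth_local_field: "vector_field A X \<Longrightarrow> c \<in> A \<Longrightarrow> smooth_on (cimg c) (local_field c X)"
  by (simp add: vector_field_def)

text \<open>The inner function has to be shown smooth near the point first, since otherwise V would
  return its default 0 instead of a directional derivative.\<close>

lemma vector_field_coord:
  assumes V: "vector_field A V" and U: "vector_field A U" and c: "c \<in> A" "x \<in> cimg c"
  shows "V (cinv c x) (\<lambda>q. U q (\<lambda>q. cmap c q $ i)) =
     frechet_derivative (local_field c U) (at x) (local_field c V x) $ i"
proof -
  let ?f = "\<lambda>q. U q (\<lambda>q. cmap c q $ i)"
  have e: "?f \<circ> cinv c = (\<lambda>x. local_field c U x $ i)"
    by (simp add: fun_eq_iff local_field_def components_def)
  have p: "cinv c x \<in> cdom c" using c by (rule cinv_in_cdom)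
  have s: "smooth_on (cimg c) (\<lambda>x. local_field c U x $ i)"
    by (rule smooth_on_vec_nth[OF open_cimg[OF c(1)] smooth_local_field[OF U c(1)]])
  have "smooth_near A (cinv c x) ?f"
    by (rule smooth_nearI[OF c(1) open_cimg[OF c(1)] order_refl _ p]) (use s c e in \<open>auto simp: cmap_cinv\<close>)
  then have "V (cinv c x) ?f = frechet_derivative (\<lambda>x. local_field c U x $ i) (at x) (local_field c V x)"
    using c by (subst vector_field_dvec[OF V c(1) p]) (simp add: dvec_def e cmap_cinv)
  moreover have "frechet_derivative (\<lambda>x. local_field c U x $ i) (at x) = (\<lambda>v. frechet_derivative (local_field c U) (at x) v $ i)"
    using smooth_on_imp_has_derivative[OF smooth_local_field[OF U c(1)] c(2)]
    by (intro frechet_derivative_eqI) (rule bounded_linear.has_derivative[OF bounded_linear_vec_nth])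
  ultimately show ?thesis by simp
qed

lemma local_field_lie_bracket:
  assumes "vector_field A V" "vector_field A U" "c \<in> A" "x \<in> cimg c"
  shows "local_field c (lie_bracket A V U) x =
     frechet_derivative (local_field c U) (at x) (local_field c V x)
     - frechet_derivative (local_field c V) (at x) (local_field c U x)"
proof (rule vec_eq_iff[THEN iffD2], intro allI)
  fix i
  have "local_field c (lie_bracket A V U) x $ i = lie_bracket A V U (cinv c x) (\<lambda>q. cmap c q $ i)"
    by (simp add: local_field_def components_def)
  also have "\<dots> = V (cinv c x) (\<lambda>q. U q (\<lambda>q. cmap c q $ i)) - U (cinv c x) (\<lambda>q. V q (\<lambda>q. cmap c q $ i))"
    using smooth_near_coord[OF assms(3) cinv_in_cdom[OF assms(3,4)]] by (simp add: lie_bracket_def)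
  finally show "local_field c (lie_bracket A V U) x $ i = (frechet_derivative (local_field c U) (at x) (local_field c V x)
     - frechet_derivative (local_field c V) (at x) (local_field c U x)) $ i"
    using vector_field_coord[OF assms(1,2,3,4)] vector_field_coord[OF assms(2,1,3,4)] by simp
qed

end

section \<open>Left translations of a Lie group in charts\<close>

locale smooth_lie_group = smooth_atlas A
  for G :: "('a::{t2_space,second_countable_topology}, 'm) monoid_scheme" and A :: "('a, real^'n) chart set" +
  assumes lie_group: "lie_group G A"
begin

lemma group: "group G" and carrier_UNIV: "carrier G = UNIV"
  using lie_group by (auto simp: lie_group_def)

lemma continuous_on_left_translation: "continuous_on S (\<lambda>z. a \<otimes>\<^bsub>G\<^esub> z)"
proof -
  have "continuous_on UNIV (\<lambda>(x, y). x \<otimes>\<^bsub>G\<^esub> y)"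
    using lie_group by (auto simp: lie_group_def smooth_map_def)
  moreover have "continuous_on S (\<lambda>z. (a, z))"
    by (intro continuous_on_Pair continuous_on_const continuous_on_id)
  ultimately have "continuous_on S (\<lambda>z. case (a, z) of (x, y) \<Rightarrow> x \<otimes>\<^bsub>G\<^esub> y)"
    by (rule continuous_on_compose2) simp
  then show ?thesis by simp
qed

text \<open>Smoothness is given for the joint multiplication in product charts. A chart b around a
  is added and the first coordinate is frozen at \<open>cmap b a\<close>.\<close>

lemma smooth_left_translation_chart:
  assumes c: "c \<in> A" and d: "d \<in> A"
  shows "smooth_on (cimg c \<inter> {x. a \<otimes>\<^bsub>G\<^esub> cinv c x \<in> cdom d}) (\<lambda>x. cmap d (a \<otimes>\<^bsub>G\<^esub> cinv c x))"
    and "open (cimg c \<inter> {x. a \<otimes>\<^bsub>G\<^esub> cinv c x \<in> cdom d})"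
proof -
  obtain b where b: "b \<in> A" "a \<in> cdom b" by (rule chart_at)
  let ?m = "\<lambda>(x, y). x \<otimes>\<^bsub>G\<^esub> y"
  let ?e = "(cdom b \<times> cdom c, map_prod (cmap b) (cmap c))"
  have e: "?e \<in> prod_atlas A A" using b(1) c unfolding prod_atlas_def by blast
  let ?S = "cmap ?e ` (cdom ?e \<inter> ?m -` cdom d)"
  have sm: "smooth_on ?S (cmap d \<circ> ?m \<circ> cinv ?e)"
    using lie_group e d by (auto simp: lie_group_def smooth_map_def)
  \<comment> \<open>The inverse of a product chart is an \<open>inv_into\<close> on the product
    domain; injectivity of both factors identifies it with the pair of inverses.\<close>
  have inv: "cinv ?e (x, y) = (cinv b x, cinv c y)" if "x \<in> cimg b" "y \<in> cimg c" for x y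
  proof -
    have "inj_on (cmap b) (cdom b)" "inj_on (cmap c) (cdom c)"
      by (rule inj_on_inverseI, rule cinv_cmap[OF b(1)], assumption) (rule inj_on_inverseI, rule cinv_cmap[OF c], assumption)
    then have i: "inj_on (cmap ?e) (cdom ?e)"
      unfolding fst_conv snd_conv by (rule map_prod_inj_on)
    have e: "(cinv b x, cinv c y) \<in> cdom ?e" "cmap ?e (cinv b x, cinv c y) = (x, y)"
      using cinv_in_cdom[OF b(1) that(1)] cinv_in_cdom[OF c that(2)]
        cmap_cinv[OF b(1) that(1)] cmap_cinv[OF c that(2)] by simp_all
    show ?thesis using inv_into_f_f[OF i e(1)] by (simp only: e(2))
  qed
  have S: "?S = (cimg b \<times> cimg c) \<inter> (\<lambda>z. cinv b (fst z) \<otimes>\<^bsub>G\<^esub> cinv c (snd z)) -` cdom d"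
  proof (rule subset_antisym; rule subsetI)
    fix z assume "z \<in> ?S"
    then show "z \<in> (cimg b \<times> cimg c) \<inter> (\<lambda>z. cinv b (fst z) \<otimes>\<^bsub>G\<^esub> cinv c (snd z)) -` cdom d"
      by (auto simp: cinv_cmap[OF b(1)] cinv_cmap[OF c])
  next
    fix z assume z: "z \<in> (cimg b \<times> cimg c) \<inter> (\<lambda>z. cinv b (fst z) \<otimes>\<^bsub>G\<^esub> cinv c (snd z)) -` cdom d"
    then have "(cinv b (fst z), cinv c (snd z)) \<in> cdom ?e \<inter> ?m -` cdom d"
      by (auto intro!: inv_into_into)
    moreover have "z = cmap ?e (cinv b (fst z), cinv c (snd z))"
      using z by (auto simp: f_inv_into_f)
    ultimately show "z \<in> ?S" by blast
  qed
  have mc: "continuous_on UNIV ?m" using lie_group by (auto simp: lie_group_def smooth_map_def)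
  have "continuous_on (cimg b \<times> cimg c) (\<lambda>z. ?m (cinv b (fst z), cinv c (snd z)))"
    by (rule continuous_on_compose2[OF mc])
      (auto intro!: continuous_intros continuous_on_compose2[OF continuous_on_cinv[OF b(1)]]
        continuous_on_compose2[OF continuous_on_cinv[OF c]])
  then have oS: "open ?S" unfolding S
    by (intro continuous_open_preimage open_Times open_cimg b c open_cdom d) auto
  let ?T = "cimg c \<inter> {x. a \<otimes>\<^bsub>G\<^esub> cinv c x \<in> cdom d}"
  have "continuous_on (cimg c) (\<lambda>x. a \<otimes>\<^bsub>G\<^esub> cinv c x)"
    by (rule continuous_on_compose2[OF continuous_on_left_translation[of UNIV] continuous_on_cinv[OF c]]) auto
  from continuous_open_preimage[OF this open_cimg[OF c] open_cdom[OF d]]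
  show oT: "open ?T" by (simp add: vimage_def)
  have TS: "(cmap b a, x) \<in> ?S" if "x \<in> ?T" for x
    unfolding S using that b by (auto simp: cinv_cmap[OF b(1)])
  have pr: "smooth_on ?T (\<lambda>x. (cmap b a, x))"
    by (intro smooth_on_Pair oT smooth_on_const smooth_on_bounded_linear bounded_linear_ident)
  have "smooth_on ?T (\<lambda>x. (cmap d \<circ> ?m \<circ> cinv ?e) (cmap b a, x))"
    by (rule smooth_on_compose[OF sm pr oT oS]) (use TS in auto)
  then show "smooth_on ?T (\<lambda>x. cmap d (a \<otimes>\<^bsub>G\<^esub> cinv c x))"
    by (rule smooth_on_cong[OF oT, rotated]) (use b inv[of "cmap b a"] in \<open>auto simp: cinv_cmap[OF b(1)]\<close>)
qed

text \<open>Needed to test a translated curve: f along the translate is the translated f along the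
  original curve, and that function must be admissible there.\<close>

lemma smooth_near_left_translation:
  assumes "smooth_near A (a \<otimes>\<^bsub>G\<^esub> z) f"
  shows "smooth_near A z (\<lambda>x. f (a \<otimes>\<^bsub>G\<^esub> x))"
proof -
  obtain c where c: "c \<in> A" "z \<in> cdom c" by (rule chart_at)
  obtain d where d: "d \<in> A" "a \<otimes>\<^bsub>G\<^esub> z \<in> cdom d" by (rule chart_at)
  obtain S where S: "open S" "cmap d (a \<otimes>\<^bsub>G\<^esub> z) \<in> S" "S \<subseteq> cimg d" "smooth_on S (f \<circ> cinv d)"
    by (rule smooth_nearE[OF assms d])
  let ?h = "\<lambda>x. cmap d (a \<otimes>\<^bsub>G\<^esub> cinv c x)"
  let ?T = "cimg c \<inter> {x. a \<otimes>\<^bsub>G\<^esub> cinv c x \<in> cdom d}"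
  note sm = smooth_left_translation_chart[OF c(1) d(1), of a]
  have o: "open (?T \<inter> ?h -` S)"
    by (rule continuous_open_preimage[OF smooth_on_imp_continuous_on[OF sm(1)] sm(2) S(1)])
  have "smooth_on (?T \<inter> ?h -` S) (\<lambda>x. (f \<circ> cinv d) (?h x))"
    by (rule smooth_on_compose[OF S(4) smooth_on_subset[OF sm(1)] o S(1)]) auto
  then have sf: "smooth_on (?T \<inter> ?h -` S) ((\<lambda>x. f (a \<otimes>\<^bsub>G\<^esub> x)) \<circ> cinv c)"
    by (rule smooth_on_cong[OF o, rotated]) (auto simp: cinv_cmap[OF d(1)])
  show ?thesis
    by (rule smooth_nearI[OF c(1) o _ sf c(2)]) (use c d S in \<open>auto simp: cinv_cmap[OF c(1)]\<close>)
qed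

end

subsection \<open>Randers norms\<close>

definition rnorm :: "'v::euclidean_space \<Rightarrow> 'v \<Rightarrow> real" where
  "rnorm b u = norm u + b \<bullet> u"

definition rnorm_sq_deriv :: "'v::euclidean_space \<Rightarrow> 'v \<Rightarrow> 'v \<Rightarrow> real" where
  "rnorm_sq_deriv b u w = 2 * rnorm b u * ((u \<bullet> w) / norm u + b \<bullet> w)"

text \<open>Half the Hessian of the squared norm, arranged to show its sign: N/|u| times the
  Euclidean product of the parts orthogonal to u, plus the product of the first derivatives of N
  along v and w.\<close>

definition rtensor :: "'v::euclidean_space \<Rightarrow> 'v \<Rightarrow> 'v \<Rightarrow> 'v \<Rightarrow> real" where
  "rtensor b u v w = rnorm b u / norm u * (v \<bullet> w - (u \<bullet> v) * (u \<bullet> w) / (norm u)\<^sup>2)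
     + ((u \<bullet> v) / norm u + b \<bullet> v) * ((u \<bullet> w) / norm u + b \<bullet> w)"

lemma norm_has_real_derivative_along_line:
  fixes u v :: "'v::real_inner"
  assumes "u \<noteq> 0"
  shows "((\<lambda>t. norm (u + t *\<^sub>R v)) has_real_derivative (u \<bullet> v) / norm u) (at 0)"
proof -
  let ?g = "\<lambda>t. u \<bullet> u + 2 * t * (u \<bullet> v) + t * t * (v \<bullet> v)"
  have 1: "(?g has_real_derivative 2 * (u \<bullet> v)) (at 0)"
    by (auto intro!: derivative_eq_intros)
  have 2: "(sqrt has_real_derivative inverse (sqrt (u \<bullet> u)) / 2) (at (?g 0))"
    using DERIV_real_sqrt[of "u \<bullet> u"] assms by simp
  have 3: "((\<lambda>t. sqrt (?g t)) has_real_derivative inverse (sqrt (u \<bullet> u)) / 2 * (2 * (u \<bullet> v))) (at 0)"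
    by (rule DERIV_chain2[where f = sqrt and g = ?g, OF 2 1])
  have 4: "norm (u + t *\<^sub>R v) = sqrt (?g t)" for t
    unfolding norm_eq_sqrt_inner by (simp add: inner_add_left inner_add_right inner_commute[of v u] distrib_left)
  have 5: "inverse (sqrt (u \<bullet> u)) / 2 * (2 * (u \<bullet> v)) = (u \<bullet> v) / norm u"
    unfolding norm_eq_sqrt_inner[symmetric] by (simp add: divide_simps)
  show ?thesis using 3 by (simp only: 4 5)
qed

lemma rnorm_has_real_derivative_along_line:
  assumes "u \<noteq> 0"
  shows "((\<lambda>t. rnorm b (u + t *\<^sub>R v)) has_real_derivative (u \<bullet> v) / norm u + b \<bullet> v) (at 0)"
  unfolding rnorm_def
  by (rule DERIV_add[OF norm_has_real_derivative_along_line[OF assms]])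
    (auto intro!: derivative_eq_intros simp: inner_add_right)

lemma rnorm_sq_has_real_derivative_along_line:
  assumes "u \<noteq> 0"
  shows "((\<lambda>t. (rnorm b (u + t *\<^sub>R w))\<^sup>2) has_real_derivative rnorm_sq_deriv b u w) (at 0)"
  using DERIV_power[OF rnorm_has_real_derivative_along_line[OF assms, of b w], of 2]
  by (simp add: rnorm_sq_deriv_def algebra_simps)

lemma rnorm_sq_deriv_has_real_derivative_along_line:
  assumes u: "u \<noteq> 0"
  shows "((\<lambda>t. rnorm_sq_deriv b (u + t *\<^sub>R v) w) has_real_derivative 2 * rtensor b u v w) (at 0)"
proof -
  have 1: "((\<lambda>t. (u + t *\<^sub>R v) \<bullet> w) has_real_derivative v \<bullet> w) (at 0)"
    by (auto intro!: derivative_eq_intros simp: inner_add_left)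
  have 2: "((\<lambda>t. ((u + t *\<^sub>R v) \<bullet> w) / norm (u + t *\<^sub>R v) + b \<bullet> w) has_real_derivative
     ((v \<bullet> w) * norm u - (u \<bullet> w) * ((u \<bullet> v) / norm u)) / (norm u * norm u)) (at 0)"
    using DERIV_add[OF DERIV_divide[OF 1 norm_has_real_derivative_along_line[OF u, of v]] DERIV_const[of "b \<bullet> w"]] u by simp
  have "((\<lambda>t. 2 * (rnorm b (u + t *\<^sub>R v) * (((u + t *\<^sub>R v) \<bullet> w) / norm (u + t *\<^sub>R v) + b \<bullet> w))) has_real_derivative
     2 * (((u \<bullet> v) / norm u + b \<bullet> v) * ((u \<bullet> w) / norm u + b \<bullet> w)
      + ((v \<bullet> w) * norm u - (u \<bullet> w) * ((u \<bullet> v) / norm u)) / (norm u * norm u) * rnorm b u)) (at 0)"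
    using DERIV_cmult[OF DERIV_mult[OF rnorm_has_real_derivative_along_line[OF u, of b v] 2], of 2] by simp
  moreover
  have "((v \<bullet> w) * norm u - (u \<bullet> w) * ((u \<bullet> v) / norm u)) / (norm u * norm u) * rnorm b u
     = rnorm b u / norm u * (v \<bullet> w - (u \<bullet> v) * (u \<bullet> w) / (norm u)\<^sup>2)"
    using u by (simp add: field_simps power2_eq_square)
  then have "((u \<bullet> v) / norm u + b \<bullet> v) * ((u \<bullet> w) / norm u + b \<bullet> w)
      + ((v \<bullet> w) * norm u - (u \<bullet> w) * ((u \<bullet> v) / norm u)) / (norm u * norm u) * rnorm b u = rtensor b u v w"
    by (simp only: rtensor_def add.commute)
  ultimately show ?thesis by (simp only: rnorm_sq_deriv_def mult.assoc)
qed

lemma rnorm_pos: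
  assumes "norm b < 1" "u \<noteq> 0"
  shows "rnorm b u > 0"
proof -
  have "\<bar>b \<bullet> u\<bar> \<le> norm b * norm u" by (rule Cauchy_Schwarz_ineq2)
  also have "\<dots> < 1 * norm u" using assms by (intro mult_strict_right_mono) auto
  finally show ?thesis by (simp add: rnorm_def)
qed

text \<open>Split w into its projection on u and an orthogonal part z. A nonzero z makes the first
  term positive; if z = 0, the derivative of N along w = r u is r N, which is nonzero.\<close>

lemma rtensor_pos:
  assumes b: "norm b < 1" and u: "u \<noteq> 0" and w: "w \<noteq> 0"
  shows "rtensor b u w w > 0"
proof -
  define r where "r = (u \<bullet> w) / (norm u)\<^sup>2"
  define z where "z = w - r *\<^sub>R u"
  have nu: "norm u > 0" "(norm u)\<^sup>2 > 0" using u by auto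
  have z: "w \<bullet> w - (u \<bullet> w) * (u \<bullet> w) / (norm u)\<^sup>2 = z \<bullet> z"
  proof -
    have "z \<bullet> z = w \<bullet> w - 2 * r * (u \<bullet> w) + r * r * (u \<bullet> u)"
      by (simp add: z_def inner_diff_left inner_diff_right inner_commute[of w u] right_diff_distrib)
    then show ?thesis
      using nu by (simp add: r_def dot_square_norm field_simps power2_eq_square)
  qed
  have N: "rnorm b u / norm u > 0" using rnorm_pos[OF b u] nu by simp
  show ?thesis
  proof (cases "z = 0")
    case True
    then have w': "w = r *\<^sub>R u" by (simp add: z_def)
    with w have "r \<noteq> 0" by auto
    moreover have "(u \<bullet> w) / norm u + b \<bullet> w = r * rnorm b u"
      using nu by (simp add: w' rnorm_def algebra_simps dot_square_norm power2_eq_square)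
    ultimately have "(u \<bullet> w) / norm u + b \<bullet> w \<noteq> 0" using rnorm_pos[OF b u] by simp
    then show ?thesis
      unfolding rtensor_def z using N True by (simp flip: power2_eq_square)
  next
    case False
    then have "rnorm b u / norm u * (z \<bullet> z) > 0" using N by (intro mult_pos_pos) auto
    then show ?thesis unfolding rtensor_def z by (intro add_pos_nonneg) auto
  qed
qed

lemma bilinear_rtensor: "bilinear (rtensor b u)"
  unfolding bilinear_def rtensor_def
  by (auto intro!: linearI simp: inner_add_left inner_add_right add_divide_distrib diff_divide_distrib algebra_simps)

text \<open>To first order such a w changes neither |u| nor the product of b and u. Skewness and
  parallelism of b will supply the two hypotheses.\<close>

lemma rnorm_eq_zero_rotation:
  assumes "u \<bullet> w = 0" "b \<bullet> w = 0"
  shows "rnorm_sq_deriv b u w = 0"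
  by (simp add: rnorm_sq_deriv_def assms)

lemma smooth_on_rnorm: "smooth_on (- {0}) (rnorm b)"
  unfolding rnorm_def
  by (intro smooth_on_add smooth_on_norm smooth_on_bounded_linear bounded_linear_inner_right bounded_linear_ident) auto

lemma smooth_on_rnorm_sq: "smooth_on (- {0}) (\<lambda>u. (rnorm b u)\<^sup>2)"
  unfolding power2_eq_square by (intro smooth_on_mult smooth_on_rnorm) auto

lemma frechet_derivative_rnorm_sq:
  assumes "u \<noteq> 0"
  shows "frechet_derivative (\<lambda>u. (rnorm b u)\<^sup>2) (at u) w = rnorm_sq_deriv b u w"
proof -
  have "((\<lambda>t. (rnorm b (u + t *\<^sub>R w))\<^sup>2) has_real_derivative
      frechet_derivative (\<lambda>u. (rnorm b u)\<^sup>2) (at u) w) (at 0)"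
    by (rule deriv_along_line[of "- {0}"])
      (use assms smooth_on_imp_differentiable[OF smooth_on_rnorm_sq] in auto)
  from DERIV_unique[OF this rnorm_sq_has_real_derivative_along_line[OF assms]] show ?thesis .
qed

subsection \<open>Smooth families of linear maps\<close>

text \<open>In finite dimension smoothness for each fixed vector gives joint smoothness: expand the
  vector argument along the axes.\<close>

lemma smooth_on_linear_family:
  fixes T :: "'a::euclidean_space \<Rightarrow> real^'n \<Rightarrow> 'b::real_normed_vector"
  assumes S: "open S" and T: "\<And>v. smooth_on S (\<lambda>x. T x v)" and l: "\<And>x. x \<in> S \<Longrightarrow> linear (T x)"
  shows "smooth_on (S \<times> UNIV) (\<lambda>z. T (fst z) (snd z))"
proof -
  have o: "open (S \<times> (UNIV :: (real^'n) set))" using S by (intro open_Times) auto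
  have f: "smooth_on (S \<times> (UNIV :: (real^'n) set)) fst"
    by (rule smooth_on_bounded_linear[OF bounded_linear_fst])
  have t: "smooth_on (S \<times> (UNIV :: (real^'n) set)) (\<lambda>z. T (fst z) v)" for v
    by (rule smooth_on_compose[OF T f o S]) auto
  have "smooth_on (S \<times> (UNIV :: (real^'n) set)) (\<lambda>z. \<Sum>j\<in>UNIV. (snd z $ j) *\<^sub>R T (fst z) (axis j 1))"
    by (intro smooth_on_sum[OF o] smooth_on_scaleR[OF o] smooth_on_vec_nth[OF o]
        smooth_on_bounded_linear[OF bounded_linear_snd] t)
  then show ?thesis
  proof (rule smooth_on_cong[OF o, rotated])
    fix z :: "'a \<times> (real^'n)" assume "z \<in> S \<times> UNIV"
    then have li: "linear (T (fst z))" using l by auto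
    have "T (fst z) (snd z) = T (fst z) (\<Sum>j\<in>UNIV. (snd z $ j) *\<^sub>R axis j 1)"
      by (simp flip: vec_eq_sum_axis)
    then show "(\<Sum>j\<in>UNIV. (snd z $ j) *\<^sub>R T (fst z) (axis j 1)) = T (fst z) (snd z)"
      by (simp add: linear_sum[OF li] linear_cmul[OF li])
  qed
qed

text \<open>The two partial derivatives are read off along lines in x and in y; linearity of the
  joint derivative adds them.\<close>

lemma frechet_derivative_linear_family:
  fixes T :: "'a::euclidean_space \<Rightarrow> real^'n \<Rightarrow> 'b::real_normed_vector"
  assumes S: "open S" and T: "\<And>v. smooth_on S (\<lambda>x. T x v)" and l: "\<And>x. x \<in> S \<Longrightarrow> linear (T x)" and x: "x \<in> S"
  shows "frechet_derivative (\<lambda>z. T (fst z) (snd z)) (at (x, y)) (v, w) =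
     frechet_derivative (\<lambda>x. T x y) (at x) v + T x w"
proof -
  let ?f = "\<lambda>z. T (fst z) (snd z)"
  have d: "?f differentiable (at (x, y))"
    by (rule smooth_on_imp_differentiable[OF smooth_on_linear_family[OF S T l]]) (use x in auto)
  have "((\<lambda>t. T (x + t *\<^sub>R v) y) has_vector_derivative frechet_derivative ?f (at (x, y)) (v, 0)) (at 0)"
    using has_vector_derivative_along_line[of ?f "(x, y)" 0 "(v, 0)"] d by simp
  moreover have "((\<lambda>t. T (x + t *\<^sub>R v) y) has_vector_derivative frechet_derivative (\<lambda>x. T x y) (at x) v) (at 0)"
    using has_vector_derivative_along_line[of "\<lambda>x. T x y" x 0 v] smooth_on_imp_differentiable[OF T x] by simp
  ultimately have 1: "frechet_derivative ?f (at (x, y)) (v, 0) = frechet_derivative (\<lambda>x. T x y) (at x) v"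
    by (rule vector_derivative_unique_at)
  have "((\<lambda>t. T x (y + t *\<^sub>R w)) has_vector_derivative frechet_derivative ?f (at (x, y)) (0, w)) (at 0)"
    using has_vector_derivative_along_line[of ?f "(x, y)" 0 "(0, w)"] d by simp
  moreover have "((\<lambda>t. T x (y + t *\<^sub>R w)) has_vector_derivative T x w) (at 0)"
    unfolding linear_add[OF l[OF x]] linear_cmul[OF l[OF x]]
    by (auto intro!: derivative_eq_intros)
  ultimately have 2: "frechet_derivative ?f (at (x, y)) (0, w) = T x w"
    by (rule vector_derivative_unique_at)
  have "frechet_derivative ?f (at (x, y)) (v, w) = frechet_derivative ?f (at (x, y)) ((v, 0) + (0, w))" by simp
  also have "\<dots> = frechet_derivative ?f (at (x, y)) (v, 0) + frechet_derivative ?f (at (x, y)) (0, w)"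
    by (rule linear_add[OF linear_frechet_derivative[OF d]])
  finally show ?thesis by (simp only: 1 2)
qed

lemma linear_frechet_derivative_family:
  fixes T :: "'a::real_normed_vector \<Rightarrow> 'c::real_normed_vector \<Rightarrow> 'b::real_normed_vector"
  assumes S: "open S" and T: "\<And>v. smooth_on S (\<lambda>x. T x v)" and l: "\<And>x. x \<in> S \<Longrightarrow> linear (T x)" and x: "x \<in> S"
  shows "linear (\<lambda>s. frechet_derivative (\<lambda>x. T x s) (at x) v)"
proof (rule linearI)
  fix s t r
  have d: "((\<lambda>x. T x s) has_derivative frechet_derivative (\<lambda>x. T x s) (at x)) (at x)" for s
    by (rule smooth_on_imp_has_derivative[OF T x])
  have "frechet_derivative (\<lambda>x. T x (s + t)) (at x) = frechet_derivative (\<lambda>x. T x s + T x t) (at x)"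
    by (rule frechet_derivative_cong_open[OF S x]) (simp add: linear_add[OF l])
  also have "\<dots> = (\<lambda>v. frechet_derivative (\<lambda>x. T x s) (at x) v + frechet_derivative (\<lambda>x. T x t) (at x) v)"
    by (rule frechet_derivative_eqI[OF has_derivative_add[OF d d]])
  finally show "frechet_derivative (\<lambda>x. T x (s + t)) (at x) v =
     frechet_derivative (\<lambda>x. T x s) (at x) v + frechet_derivative (\<lambda>x. T x t) (at x) v" by simp
  have "frechet_derivative (\<lambda>x. T x (r *\<^sub>R s)) (at x) = frechet_derivative (\<lambda>x. r *\<^sub>R T x s) (at x)"
    by (rule frechet_derivative_cong_open[OF S x]) (simp add: linear_cmul[OF l])
  also have "\<dots> = (\<lambda>v. r *\<^sub>R frechet_derivative (\<lambda>x. T x s) (at x) v)"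
    by (rule frechet_derivative_eqI[OF has_derivative_scaleR_right[OF d]])
  finally show "frechet_derivative (\<lambda>x. T x (r *\<^sub>R s)) (at x) v = r *\<^sub>R frechet_derivative (\<lambda>x. T x s) (at x) v" by simp
qed

lemma has_derivative_linear_family_apply:
  fixes T :: "'a::euclidean_space \<Rightarrow> real^'n \<Rightarrow> 'b::real_normed_vector"
  assumes S: "open S" and T: "\<And>v. smooth_on S (\<lambda>x. T x v)" and l: "\<And>x. x \<in> S \<Longrightarrow> linear (T x)"
    and x: "x \<in> S" and s: "s differentiable (at x)"
  shows "((\<lambda>x. T x (s x)) has_derivative
    (\<lambda>v. frechet_derivative (\<lambda>y. T y (s x)) (at x) v + T x (frechet_derivative s (at x) v))) (at x)"
proof -
  let ?f = "\<lambda>z. T (fst z) (snd z)"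
  have "?f differentiable (at (x, s x))"
    by (rule smooth_on_imp_differentiable[OF smooth_on_linear_family[OF S T l]]) (use x in auto)
  then have f: "(?f has_derivative frechet_derivative ?f (at (x, s x))) (at (x, s x))"
    by (simp add: frechet_derivative_works)
  have "((\<lambda>x. (x, s x)) has_derivative (\<lambda>v. (v, frechet_derivative s (at x) v))) (at x)"
    using s by (intro has_derivative_Pair has_derivative_ident) (simp add: frechet_derivative_works)
  from has_derivative_compose[OF this f] show ?thesis
    by (simp add: frechet_derivative_linear_family[OF S T l x])
qed

lemma smooth_on_linear_family_apply:
  fixes T :: "'a::euclidean_space \<Rightarrow> real^'n \<Rightarrow> 'b::real_normed_vector"
  assumes S: "open S" and T: "\<And>v. smooth_on S (\<lambda>x. T x v)" and l: "\<And>x. x \<in> S \<Longrightarrow> linear (T x)"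
    and s: "smooth_on S s"
  shows "smooth_on S (\<lambda>x. T x (s x))"
proof -
  have o: "open (S \<times> (UNIV :: (real^'n) set))" using S by (intro open_Times) auto
  have p: "smooth_on S (\<lambda>x. (x, s x))"
    by (intro smooth_on_Pair S s smooth_on_bounded_linear bounded_linear_ident)
  have "smooth_on S (\<lambda>x. (\<lambda>z. T (fst z) (snd z)) (x, s x))"
    by (rule smooth_on_compose[OF smooth_on_linear_family[OF S T l] p S o]) auto
  then show ?thesis by simp
qed

subsection \<open>Orthonormal left invariant frames with a parallel covector\<close>

text \<open>\<open>\<omega> p s\<close> is the covariant derivative of the left invariant field with
  coefficients s along the one with coefficients p. Skewness is metric compatibility,
  \<open>torsion_free\<close> ties \<omega> to the brackets, and \<open>parallel\<close> makes the
  field with coefficients b parallel.\<close>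

locale invariant_frame = smooth_lie_group G A
  for G :: "('a::{t2_space,second_countable_topology}, 'm) monoid_scheme" and A :: "('a, real^'n) chart set" +
  fixes e :: "'n \<Rightarrow> 'a vfield" and g :: "'a \<Rightarrow> 'a tvec \<Rightarrow> 'a tvec \<Rightarrow> real"
    and \<omega> :: "real^'n \<Rightarrow> real^'n \<Rightarrow> real^'n" and b :: "real^'n"
  assumes frame_invariant: "e i \<in> lie_algebra G A"
    and metric: "riemannian_metric A g" and metric_invariant: "left_invariant_metric G A g"
    and orthonormal_at_one: "g \<one>\<^bsub>G\<^esub> (e i \<one>\<^bsub>G\<^esub>) (e j \<one>\<^bsub>G\<^esub>) = (if i = j then 1 else 0)"
    and bilinear_\<omega>: "bilinear \<omega>"
    and torsion_free: "lie_bracket A (e i) (e j) =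
       (\<lambda>x f. \<Sum>k\<in>UNIV. (\<omega> (axis i 1) (axis j 1) - \<omega> (axis j 1) (axis i 1)) $ k * e k x f)"
    and skew_\<omega>: "s \<bullet> \<omega> p s = 0"
    and parallel: "b \<bullet> \<omega> p s = 0"
    and norm_b: "norm b < 1"
begin

definition F :: "'a \<Rightarrow> 'a tvec \<Rightarrow> real" where
  "F = randers g (\<lambda>x f. \<Sum>k\<in>UNIV. b $ k * e k x f)"

lemma frame_field: "vector_field A (e i)"
  using frame_invariant by (simp add: lie_algebra_def)

lemma frame_tangent: "e i p \<in> tangent_space A p"
  using frame_field by (simp add: vector_field_def)

lemma metric_linear:
  "u \<in> tangent_space A p \<Longrightarrow> v \<in> tangent_space A p \<Longrightarrow> w \<in> tangent_space A p \<Longrightarrow>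
    g p (\<lambda>f. r * u f + s * v f) w = r * g p u w + s * g p v w"
  and metric_sym: "u \<in> tangent_space A p \<Longrightarrow> v \<in> tangent_space A p \<Longrightarrow> g p u v = g p v u"
  using metric unfolding riemannian_metric_def by blast+

lemma frame_translate: "e i (a \<otimes>\<^bsub>G\<^esub> x) = tangent_map (\<lambda>z. a \<otimes>\<^bsub>G\<^esub> z) (e i x)"
  using frame_invariant by (simp add: lie_algebra_def)

text \<open>Translation by the inverse of p carries frame and metric to the identity at the same
  time.\<close>

lemma orthonormal_frame: "g p (e i p) (e j p) = (if i = j then 1 else 0)"
proof -
  have "inv\<^bsub>G\<^esub> p \<otimes>\<^bsub>G\<^esub> p = \<one>\<^bsub>G\<^esub>"
    using group.l_inv[OF group] by (simp add: carrier_UNIV)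
  then have "tangent_map (\<lambda>z. inv\<^bsub>G\<^esub> p \<otimes>\<^bsub>G\<^esub> z) (e i p) = e i \<one>\<^bsub>G\<^esub>" for i
    using frame_translate[of i "inv\<^bsub>G\<^esub> p" p] by simp
  moreover have "g p (e i p) (e j p) =
      g \<one>\<^bsub>G\<^esub> (tangent_map (\<lambda>z. inv\<^bsub>G\<^esub> p \<otimes>\<^bsub>G\<^esub> z) (e i p)) (tangent_map (\<lambda>z. inv\<^bsub>G\<^esub> p \<otimes>\<^bsub>G\<^esub> z) (e j p))"
    using metric_invariant frame_tangent unfolding left_invariant_metric_def by blast
  ultimately show ?thesis by (simp add: orthonormal_at_one)
qed

lemma \<omega>_simps:
  "\<omega> (p + p') s = \<omega> p s + \<omega> p' s" "\<omega> p (s + s') = \<omega> p s + \<omega> p s'"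
  "\<omega> (r *\<^sub>R p) s = r *\<^sub>R \<omega> p s" "\<omega> p (r *\<^sub>R s) = r *\<^sub>R \<omega> p s"
  "\<omega> p (- s) = - \<omega> p s" "\<omega> (- p) s = - \<omega> p s"
  using bilinear_\<omega> by (simp_all add: bilinear_ladd bilinear_radd bilinear_lmul bilinear_rmul bilinear_lneg bilinear_rneg)

end

section \<open>Frame and coframe in a chart\<close>

locale invariant_frame_chart = invariant_frame G A e g \<omega> b
  for G :: "('a::{t2_space,second_countable_topology}, 'm) monoid_scheme" and A :: "('a, real^'n) chart set"
    and e g \<omega> b +
  fixes c :: "('a, real^'n) chart"
  assumes c: "c \<in> A"
begin

text \<open>Inner products with the orthonormal frame replace the inversion of a matrix, so
  linearity and smoothness come directly from the metric.\<close>

definition \<theta> :: "real^'n \<Rightarrow> real^'n \<Rightarrow> real^'n" where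
  "\<theta> x v = (\<chi> i. g (cinv c x) (e i (cinv c x)) (dvec A c (cinv c x) v))"

definition fr :: "real^'n \<Rightarrow> real^'n \<Rightarrow> real^'n" where
  "fr x u = (\<Sum>i\<in>UNIV. (u $ i) *\<^sub>R local_field c (e i) x)"

abbreviation "\<Omega> \<equiv> cimg c"

lemmas open_\<Omega> = open_cimg[OF c]

lemma dvec_tangent: "x \<in> \<Omega> \<Longrightarrow> dvec A c (cinv c x) v \<in> tangent_space A (cinv c x)"
  using tangent_space_chart[OF c cinv_in_cdom[OF c]] by blast

lemma frame_dvec: "x \<in> \<Omega> \<Longrightarrow> e i (cinv c x) = dvec A c (cinv c x) (local_field c (e i) x)"
  using vector_field_dvec[OF frame_field c cinv_in_cdom[OF c]] by (simp add: cmap_cinv[OF c])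

lemma linear_metric_dvec:
  assumes "x \<in> \<Omega>" "w \<in> tangent_space A (cinv c x)"
  shows "linear (\<lambda>v. g (cinv c x) (dvec A c (cinv c x) v) w)"
proof (rule linearI)
  note p = cinv_in_cdom[OF c assms(1)]
  note l = metric_linear[OF dvec_tangent[OF assms(1)] dvec_tangent[OF assms(1)] assms(2), unfolded dvec_linear[OF c p]]
  fix u v r
  show "g (cinv c x) (dvec A c (cinv c x) (u + v)) w = g (cinv c x) (dvec A c (cinv c x) u) w + g (cinv c x) (dvec A c (cinv c x) v) w"
    using l[of 1 u 1 v] by simp
  show "g (cinv c x) (dvec A c (cinv c x) (r *\<^sub>R u)) w = r *\<^sub>R g (cinv c x) (dvec A c (cinv c x) u) w"
    using l[of r u 0 u] by simp
qed

lemma metric_frame_combination: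
  assumes "x \<in> \<Omega>" "w \<in> tangent_space A (cinv c x)"
  shows "g (cinv c x) (dvec A c (cinv c x) (fr x u)) w = (\<Sum>i\<in>UNIV. u $ i * g (cinv c x) (e i (cinv c x)) w)"
  by (simp add: fr_def linear_sum[OF linear_metric_dvec[OF assms]] linear_cmul[OF linear_metric_dvec[OF assms]]
      frame_dvec[OF assms(1)])

lemma \<theta>_fr: "x \<in> \<Omega> \<Longrightarrow> \<theta> x (fr x u) = u"
  by (simp add: vec_eq_iff \<theta>_def metric_sym[OF frame_tangent dvec_tangent]
      metric_frame_combination[OF _ frame_tangent] orthonormal_frame if_distrib cong: if_cong)

lemma linear_fr: "linear (fr x)"
  by (rule linearI) (simp_all add: fr_def algebra_simps sum.distrib scaleR_sum_right)

text \<open>\<open>\<theta>_fr\<close> makes \<open>fr x\<close> injective, hence onto by dimension,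
  so its left inverse is also a right inverse.\<close>

lemma fr_\<theta>: "x \<in> \<Omega> \<Longrightarrow> fr x (\<theta> x v) = v"
proof -
  assume x: "x \<in> \<Omega>"
  have "inj (fr x)" by (rule inj_on_inverseI[of _ "\<theta> x"]) (simp add: \<theta>_fr[OF x])
  then have "surj (fr x)" by (rule linear_inj_imp_surj[OF linear_fr])
  then obtain u where "v = fr x u" by blast
  then show ?thesis by (simp add: \<theta>_fr[OF x])
qed

lemma linear_\<theta>: "x \<in> \<Omega> \<Longrightarrow> linear (\<theta> x)"
  by (intro linearI) (simp_all add: vec_eq_iff \<theta>_def metric_sym[OF frame_tangent dvec_tangent]
      linear_add[OF linear_metric_dvec[OF _ frame_tangent]] linear_cmul[OF linear_metric_dvec[OF _ frame_tangent]])

lemma \<theta>_eq_0_iff: "x \<in> \<Omega> \<Longrightarrow> \<theta> x v = 0 \<longleftrightarrow> v = 0"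
  by (metis fr_\<theta> linear_0 linear_\<theta> linear_fr)

lemma metric_eq_\<theta>:
  assumes x: "x \<in> \<Omega>"
  shows "g (cinv c x) (dvec A c (cinv c x) v) (dvec A c (cinv c x) w) = \<theta> x v \<bullet> \<theta> x w"
proof -
  have "g (cinv c x) (dvec A c (cinv c x) (fr x (\<theta> x v))) (dvec A c (cinv c x) w) =
      (\<Sum>i\<in>UNIV. \<theta> x v $ i * \<theta> x w $ i)"
    by (simp add: metric_frame_combination[OF x dvec_tangent[OF x]] \<theta>_def[of x w])
  then show ?thesis by (simp add: fr_\<theta>[OF x] inner_vec_def)
qed

lemma randers_field_dvec: "x \<in> \<Omega> \<Longrightarrow> (\<lambda>f. \<Sum>k\<in>UNIV. u $ k * e k (cinv c x) f) = dvec A c (cinv c x) (fr x u)"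
proof -
  assume x: "x \<in> \<Omega>"
  have "dvec A c (cinv c x) (\<Sum>k\<in>I. (u $ k) *\<^sub>R local_field c (e k) x) f = (\<Sum>k\<in>I. u $ k * e k (cinv c x) f)"
    if "finite I" for I f
    using that
  proof (induction I)
    case empty
    then show ?case using dvec_0[OF c cinv_in_cdom[OF c x]] by simp
  next
    case (insert i I)
    then show ?case
      using fun_cong[OF dvec_linear[OF c cinv_in_cdom[OF c x], of "u $ i" "local_field c (e i) x" 1
            "\<Sum>k\<in>I. (u $ k) *\<^sub>R local_field c (e k) x"], of f]
      by (simp add: frame_dvec[OF x])
  qed
  then show ?thesis by (simp add: fun_eq_iff fr_def)
qed

lemma F_dvec: "x \<in> \<Omega> \<Longrightarrow> F (cinv c x) (dvec A c (cinv c x) v) = rnorm b (\<theta> x v)"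
  by (simp add: F_def randers_def randers_field_dvec metric_eq_\<theta> \<theta>_fr rnorm_def norm_eq_sqrt_inner
      del: real_sqrt_eq_iff)

text \<open>The metric is known to be smooth on coordinate vectors only, so both the frame field and
  v are expanded along the axes.\<close>

lemma smooth_\<theta>: "smooth_on \<Omega> (\<lambda>x. \<theta> x v)"
proof (rule smooth_on_vecI[OF open_\<Omega>])
  fix i
  let ?G = "\<lambda>x k l. g (cinv c x) (dvec A c (cinv c x) (axis k 1)) (dvec A c (cinv c x) (axis l 1))"
  have "smooth_on \<Omega> (\<lambda>x. \<Sum>l\<in>UNIV. v $ l * (\<Sum>k\<in>UNIV. local_field c (e i) x $ k * ?G x k l))"
    using metric c
    by (intro smooth_on_sum[OF open_\<Omega>] smooth_on_mult[OF open_\<Omega>] smooth_on_const smooth_on_vec_nth[OF open_\<Omega>]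
        smooth_local_field[OF frame_field c]) (simp_all add: riemannian_metric_def)
  then show "smooth_on \<Omega> (\<lambda>x. \<theta> x v $ i)"
  proof (rule smooth_on_cong[OF open_\<Omega>, rotated])
    fix x assume x: "x \<in> \<Omega>"
    let ?p = "cinv c x"
    have 1: "g ?p (dvec A c ?p u) w = (\<Sum>k\<in>UNIV. u $ k * g ?p (dvec A c ?p (axis k 1)) w)"
      if "w \<in> tangent_space A ?p" for u w
    proof -
      note l = linear_metric_dvec[OF x that]
      have "g ?p (dvec A c ?p u) w = g ?p (dvec A c ?p (\<Sum>k\<in>UNIV. (u $ k) *\<^sub>R axis k 1)) w"
        by (simp flip: vec_eq_sum_axis)
      then show ?thesis by (simp add: linear_sum[OF l] linear_cmul[OF l])
    qed
    have "\<theta> x v $ i = g ?p (dvec A c ?p v) (e i ?p)"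
      by (simp add: \<theta>_def metric_sym[OF frame_tangent dvec_tangent[OF x]])
    also have "\<dots> = (\<Sum>l\<in>UNIV. v $ l * g ?p (dvec A c ?p (axis l 1)) (e i ?p))"
      by (rule 1[OF frame_tangent])
    also have "\<dots> = (\<Sum>l\<in>UNIV. v $ l * g ?p (e i ?p) (dvec A c ?p (axis l 1)))"
      by (simp add: metric_sym[OF dvec_tangent[OF x] frame_tangent])
    also have "\<dots> = (\<Sum>l\<in>UNIV. v $ l * (\<Sum>k\<in>UNIV. local_field c (e i) x $ k * ?G x k l))"
      by (intro sum.cong refl arg_cong2[where f = "(*)"], subst frame_dvec[OF x], rule 1[OF dvec_tangent[OF x]])
    finally show "(\<Sum>l\<in>UNIV. v $ l * (\<Sum>k\<in>UNIV. local_field c (e i) x $ k * ?G x k l)) = \<theta> x v $ i" by simp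
  qed
qed

lemma smooth_fr: "smooth_on \<Omega> (\<lambda>x. fr x u)"
  unfolding fr_def
  by (intro smooth_on_sum[OF open_\<Omega>] smooth_on_scaleR[OF open_\<Omega>] smooth_on_const smooth_local_field[OF frame_field c])

section \<open>Structure equation and Levi-Civita connection in chart coordinates\<close>

definition d\<theta> :: "real^'n \<Rightarrow> real^'n \<Rightarrow> real^'n \<Rightarrow> real^'n" where
  "d\<theta> x v s = frechet_derivative (\<lambda>x. \<theta> x s) (at x) v"

lemma linear_d\<theta>_left: "x \<in> \<Omega> \<Longrightarrow> linear (\<lambda>v. d\<theta> x v s)"
  unfolding d\<theta>_def by (rule linear_frechet_derivative[OF smooth_on_imp_differentiable[OF smooth_\<theta>]])

lemma linear_d\<theta>_right: "x \<in> \<Omega> \<Longrightarrow> linear (d\<theta> x v)"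
  unfolding d\<theta>_def by (rule linear_frechet_derivative_family[OF open_\<Omega> smooth_\<theta> linear_\<theta>])

lemma frechet_derivative_\<theta>:
  "x \<in> \<Omega> \<Longrightarrow> frechet_derivative (\<lambda>z. \<theta> (fst z) (snd z)) (at (x, y)) (v, w) = d\<theta> x v y + \<theta> x w"
  unfolding d\<theta>_def by (rule frechet_derivative_linear_family[OF open_\<Omega> smooth_\<theta> linear_\<theta>])

lemma has_derivative_\<theta>_field:
  assumes x: "x \<in> \<Omega>" and s: "s differentiable (at x)"
  shows "((\<lambda>x. \<theta> x (s x)) has_derivative (\<lambda>v. d\<theta> x v (s x) + \<theta> x (frechet_derivative s (at x) v))) (at x)"
  unfolding d\<theta>_def by (rule has_derivative_linear_family_apply[OF open_\<Omega> smooth_\<theta> linear_\<theta> x s])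

text \<open>The left side is the exterior derivative of the coframe. It is bilinear, so it is enough
  to evaluate it on frame fields, where it is minus the coframe of their bracket.\<close>

lemma maurer_cartan:
  assumes x: "x \<in> \<Omega>"
  shows "d\<theta> x v s - d\<theta> x s v = \<omega> (\<theta> x s) (\<theta> x v) - \<omega> (\<theta> x v) (\<theta> x s)"
proof -
  let ?E = "\<lambda>i. local_field c (e i)"
  have E: "fr y (axis i 1) = ?E i y" for i y
    by (simp add: fr_def axis_def if_distrib[of "\<lambda>r. r *\<^sub>R _"] cong: if_cong)
  \<comment> \<open>The coframe is constant on a frame field; differentiating this constant relates
    the derivatives of coframe and frame.\<close>
  have dE: "d\<theta> x v (?E i x) = - \<theta> x (frechet_derivative (?E i) (at x) v)" for i v
  proof -
    have "((\<lambda>x. \<theta> x (?E i x)) has_derivative (\<lambda>v. d\<theta> x v (?E i x) + \<theta> x (frechet_derivative (?E i) (at x) v))) (at x)"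
      by (rule has_derivative_\<theta>_field[OF x smooth_on_imp_differentiable[OF smooth_local_field[OF frame_field c] x]])
    moreover have "((\<lambda>x. \<theta> x (?E i x)) has_derivative (\<lambda>v. 0)) (at x)"
      by (rule has_derivative_transform_within_open[OF has_derivative_const open_\<Omega> x, of "axis i 1"])
        (simp add: \<theta>_fr flip: E)
    ultimately have "(\<lambda>v. d\<theta> x v (?E i x) + \<theta> x (frechet_derivative (?E i) (at x) v)) = (\<lambda>v. 0)"
      by (rule has_derivative_unique)
    then show ?thesis by (metis (no_types) add_eq_0_iff2)
  qed
  have br: "frechet_derivative (?E j) (at x) (?E i x) - frechet_derivative (?E i) (at x) (?E j x) =
      fr x (\<omega> (axis i 1) (axis j 1) - \<omega> (axis j 1) (axis i 1))" for i j
  proof -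
    let ?p = "cinv c x"
    have "local_field c (lie_bracket A (e i) (e j)) x =
       components c (dvec A c ?p (fr x (\<omega> (axis i 1) (axis j 1) - \<omega> (axis j 1) (axis i 1))))"
      unfolding local_field_def torsion_free randers_field_dvec[OF x] ..
    then show ?thesis
      by (simp add: components_dvec[OF c cinv_in_cdom[OF c x]] local_field_lie_bracket[OF frame_field frame_field c x])
  qed
  have "(\<lambda>u w. d\<theta> x (fr x u) (fr x w) - d\<theta> x (fr x w) (fr x u)) = (\<lambda>u w. \<omega> w u - \<omega> u w)"
  proof (rule bilinear_eq_stdbasis)
    show "bilinear (\<lambda>u w. d\<theta> x (fr x u) (fr x w) - d\<theta> x (fr x w) (fr x u))"
      unfolding bilinear_def
      by (auto intro!: linearI simp: linear_add[OF linear_fr] linear_cmul[OF linear_fr]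
          linear_add[OF linear_d\<theta>_left[OF x]] linear_cmul[OF linear_d\<theta>_left[OF x]]
          linear_add[OF linear_d\<theta>_right[OF x]] linear_cmul[OF linear_d\<theta>_right[OF x]] scaleR_diff_right)
    show "bilinear (\<lambda>u w. \<omega> w u - \<omega> u w)"
      unfolding bilinear_def by (auto intro!: linearI simp: \<omega>_simps scaleR_diff_right)
    fix i j :: "real^'n" assume "i \<in> Basis" "j \<in> Basis"
    then obtain k l where kl: "i = axis k 1" "j = axis l 1" by (auto simp: Basis_vec_def)
    have "d\<theta> x (fr x i) (fr x j) - d\<theta> x (fr x j) (fr x i) =
       - \<theta> x (frechet_derivative (?E l) (at x) (?E k x) - frechet_derivative (?E k) (at x) (?E l x))"
      by (simp add: kl E dE linear_diff[OF linear_\<theta>[OF x]])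
    then show "d\<theta> x (fr x i) (fr x j) - d\<theta> x (fr x j) (fr x i) = \<omega> j i - \<omega> i j"
      by (simp add: br \<theta>_fr[OF x] kl)
  qed
  then have "d\<theta> x (fr x u) (fr x w) - d\<theta> x (fr x w) (fr x u) = \<omega> w u - \<omega> u w" for u w
    by metis
  from this[of "\<theta> x v" "\<theta> x s"] show ?thesis by (simp add: fr_\<theta>[OF x])
qed

text \<open>The change from frame to chart: \<theta> maps the sum of the flat derivative of s along
  v and \<Gamma> x v s to the derivative of \<theta> s along v plus \<omega> (\<theta> v) (\<theta>
  s).\<close>

definition \<Gamma> :: "real^'n \<Rightarrow> real^'n \<Rightarrow> real^'n \<Rightarrow> real^'n" where
  "\<Gamma> x v s = fr x (d\<theta> x v s + \<omega> (\<theta> x v) (\<theta> x s))"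

lemma \<theta>_\<Gamma>: "x \<in> \<Omega> \<Longrightarrow> \<theta> x (\<Gamma> x v s) = d\<theta> x v s + \<omega> (\<theta> x v) (\<theta> x s)"
  by (simp add: \<Gamma>_def \<theta>_fr)

text \<open>The antisymmetric parts of d\<theta> and \<omega> cancel by the Maurer-Cartan equation;
  this is torsion-freeness in coordinates.\<close>

lemma sym_\<Gamma>: "x \<in> \<Omega> \<Longrightarrow> \<Gamma> x v s = \<Gamma> x s v"
proof -
  assume x: "x \<in> \<Omega>"
  have "d\<theta> x v s + \<omega> (\<theta> x v) (\<theta> x s) = d\<theta> x s v + \<omega> (\<theta> x s) (\<theta> x v)"
    using maurer_cartan[OF x, of v s] by (simp add: algebra_simps)
  then show ?thesis by (simp only: \<Gamma>_def)
qed

lemma linear_\<Gamma>: "x \<in> \<Omega> \<Longrightarrow> linear (\<Gamma> x v)"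
  by (rule linearI)
    (simp_all add: \<Gamma>_def linear_add[OF linear_d\<theta>_right] linear_cmul[OF linear_d\<theta>_right] linear_add[OF linear_\<theta>]
      linear_cmul[OF linear_\<theta>] \<omega>_simps linear_add[OF linear_fr] linear_cmul[OF linear_fr] scaleR_add_right)

section \<open>The Finsler function and its fundamental tensor in the frame\<close>

lemma smooth_\<theta>_pair: "smooth_on (\<Omega> \<times> - {0}) (\<lambda>z. \<theta> (fst z) (snd z))"
  by (rule smooth_on_subset[OF smooth_on_linear_family[OF open_\<Omega> smooth_\<theta> linear_\<theta>]]) auto

lemma open_slit: "open (\<Omega> \<times> - {0 :: real^'n})"
  by (intro open_Times open_\<Omega>) auto

lemma local_F_eq: "x \<in> \<Omega> \<Longrightarrow> local_F A F c x y = rnorm b (\<theta> x y)"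
  by (simp add: local_F_def F_dvec)

lemma smooth_local_F: "smooth_on (\<Omega> \<times> - {0}) (\<lambda>(x, y). local_F A F c x y)"
proof -
  have "smooth_on (\<Omega> \<times> - {0}) (\<lambda>z. rnorm b (\<theta> (fst z) (snd z)))"
    by (rule smooth_on_compose[OF smooth_on_rnorm smooth_\<theta>_pair open_slit]) (auto simp: \<theta>_eq_0_iff)
  then show ?thesis
    by (rule smooth_on_cong[OF open_slit, rotated]) (auto simp: local_F_eq)
qed

lemma smooth_local_F2: "smooth_on (\<Omega> \<times> - {0}) (\<lambda>(x, y). local_F2 A F c x y)"
  using smooth_on_mult[OF open_slit smooth_local_F smooth_local_F]
  by (simp add: local_F2_def power2_eq_square case_prod_beta')

text \<open>Along the lift of v the frame components of y move by - \<omega> (\<theta> v) (\<theta>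
  y). This is orthogonal to \<theta> y and to b, so the Randers norm is stationary.\<close>

lemma horizontal:
  assumes x: "x \<in> \<Omega>" and y: "y \<noteq> 0"
  shows "frechet_derivative (\<lambda>(x, y). local_F2 A F c x y) (at (x, y)) (v, - \<Gamma> x v y) = 0"
proof -
  let ?T = "\<lambda>z. \<theta> (fst z) (snd z)" and ?M = "\<lambda>u. (rnorm b u)\<^sup>2"
  have z: "(x, y) \<in> \<Omega> \<times> - {0}" using x y by simp
  have t0: "\<theta> x y \<noteq> 0" using \<theta>_eq_0_iff[OF x] y by simp
  have M: "(?M has_derivative frechet_derivative ?M (at (\<theta> x y))) (at (\<theta> x y))"
    by (rule smooth_on_imp_has_derivative[OF smooth_on_rnorm_sq]) (use t0 in simp)
  have T: "(?T has_derivative frechet_derivative ?T (at (x, y))) (at (x, y))"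
    by (rule smooth_on_imp_has_derivative[OF smooth_\<theta>_pair z])
  have "((\<lambda>z. ?M (?T z)) has_derivative (\<lambda>h. frechet_derivative ?M (at (\<theta> x y)) (frechet_derivative ?T (at (x, y)) h))) (at (x, y))"
    by (rule has_derivative_compose[OF T]) (use M in simp)
  then have "frechet_derivative (\<lambda>z. ?M (?T z)) (at (x, y)) (v, - \<Gamma> x v y) = rnorm_sq_deriv b (\<theta> x y) (- \<omega> (\<theta> x v) (\<theta> x y))"
    by (simp add: frechet_derivative_eqI frechet_derivative_rnorm_sq[OF t0] frechet_derivative_\<theta>[OF x]
        linear_neg[OF linear_\<theta>[OF x]] \<theta>_\<Gamma>[OF x])
  moreover have "frechet_derivative (\<lambda>(x, y). local_F2 A F c x y) (at (x, y)) = frechet_derivative (\<lambda>z. ?M (?T z)) (at (x, y))"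
    by (rule frechet_derivative_cong_open[OF open_slit z]) (auto simp: local_F2_def local_F_eq)
  ultimately show ?thesis
    by (simp add: rnorm_eq_zero_rotation skew_\<omega> parallel)
qed

lemma gmat_eq_rtensor:
  assumes x: "x \<in> \<Omega>" and y: "y \<noteq> 0"
  shows "gmat A F c x y $ i $ j = rtensor b (\<theta> x y) (\<theta> x (axis i 1)) (\<theta> x (axis j 1))"
proof -
  have \<theta>_line: "\<theta> x (y + t *\<^sub>R v) = \<theta> x y + t *\<^sub>R \<theta> x v" for y t v
    by (simp add: linear_add[OF linear_\<theta>[OF x]] linear_cmul[OF linear_\<theta>[OF x]])
  have 1: "partial_y j (local_F2 A F c) x y = rnorm_sq_deriv b (\<theta> x y) (\<theta> x (axis j 1))" if "y \<noteq> 0" for y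
    unfolding partial_y_def local_F2_def local_F_eq[OF x] \<theta>_line
    by (rule DERIV_imp_deriv, rule rnorm_sq_has_real_derivative_along_line) (use that \<theta>_eq_0_iff[OF x] in simp)
  have "((\<lambda>t. partial_y j (local_F2 A F c) x (y + t *\<^sub>R axis i 1)) has_real_derivative
      2 * rtensor b (\<theta> x y) (\<theta> x (axis i 1)) (\<theta> x (axis j 1))) (at 0)"
  proof (rule has_field_derivative_transform_within_open[OF _ open_line_preimage[of "- {0}" y "axis i 1"]])
    show "((\<lambda>t. rnorm_sq_deriv b (\<theta> x y + t *\<^sub>R \<theta> x (axis i 1)) (\<theta> x (axis j 1))) has_real_derivative
        2 * rtensor b (\<theta> x y) (\<theta> x (axis i 1)) (\<theta> x (axis j 1))) (at 0)"
      by (rule rnorm_sq_deriv_has_real_derivative_along_line) (use y \<theta>_eq_0_iff[OF x] in simp)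
  qed (use y 1 in \<open>auto simp: \<theta>_line\<close>)
  from DERIV_imp_deriv[OF this] show ?thesis
    by (simp add: gmat_def partial_y_def[of i])
qed

lemma gmat_quadratic_form:
  assumes x: "x \<in> \<Omega>" and y: "y \<noteq> 0"
  shows "v \<bullet> (gmat A F c x y *v w) = rtensor b (\<theta> x y) (\<theta> x v) (\<theta> x w)"
proof -
  note bi = bilinear_rtensor[of b "\<theta> x y"]
  have e: "\<theta> x v = (\<Sum>i\<in>UNIV. (v $ i) *\<^sub>R \<theta> x (axis i 1))" for v
    unfolding linear_cmul[OF linear_\<theta>[OF x], symmetric] linear_sum[OF linear_\<theta>[OF x], symmetric]
    by (simp flip: vec_eq_sum_axis)
  have "rtensor b (\<theta> x y) (\<theta> x v) (\<theta> x w) = (\<Sum>i\<in>UNIV. \<Sum>j\<in>UNIV. v $ i * (w $ j * gmat A F c x y $ i $ j))"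
    by (subst e[of v], subst e[of w])
      (simp add: bilinear_sum[OF bi] bilinear_lmul[OF bi] bilinear_rmul[OF bi] gmat_eq_rtensor[OF x y]
        sum.cartesian_product case_prod_beta mult.left_commute)
  then show ?thesis
    by (simp add: inner_vec_def matrix_vector_mult_def sum_distrib_left mult.commute mult.left_commute)
qed

lemma gmat_pos: "x \<in> \<Omega> \<Longrightarrow> y \<noteq> 0 \<Longrightarrow> v \<noteq> 0 \<Longrightarrow> 0 < v \<bullet> (gmat A F c x y *v v)"
  by (simp add: gmat_quadratic_form rtensor_pos norm_b \<theta>_eq_0_iff)

lemma invertible_gmat: "x \<in> \<Omega> \<Longrightarrow> y \<noteq> 0 \<Longrightarrow> invertible (gmat A F c x y)"
  unfolding invertible_left_inverse matrix_left_invertible_ker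
  using gmat_pos by (metis inner_zero_right less_irrefl)

sublocale horizontally_constant A F c "cimg c" \<Gamma>
proof unfold_locales
  show "open \<Omega>" by (rule open_\<Omega>)
qed (rule smooth_local_F2 linear_add[OF linear_\<Gamma>] linear_cmul[OF linear_\<Gamma>] sym_\<Gamma> horizontal invertible_gmat; assumption)+

end

section \<open>Finsler and Berwald properties on the whole group\<close>

context invariant_frame
begin

lemma F_chart:
  assumes "c \<in> A" "p \<in> cdom c"
  shows "F p (dvec A c p v) = rnorm b (invariant_frame_chart.\<theta> A e g c (cmap c p) v)"
proof -
  interpret invariant_frame_chart G A e g \<omega> b c by unfold_locales (rule assms)
  show ?thesis using F_dvec[of "cmap c p" v] assms by (simp add: cinv_cmap)
qed

theorem finsler: "finsler_metric A F"
  unfolding finsler_metric_def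
proof (intro conjI allI ballI impI)
  fix p y assume y: "y \<in> tangent_space A p"
  obtain c where cp: "c \<in> A" "p \<in> cdom c" by (rule chart_at)
  interpret invariant_frame_chart G A e g \<omega> b c by unfold_locales (rule cp)
  have x: "cmap c p \<in> \<Omega>" using cp(2) by (rule imageI)
  obtain v where v: "y = dvec A c p v" using y tangent_space_chart[OF cp] by auto
  \<comment> \<open>\<open>rnorm_pos\<close> concerns nonzero vectors; the zero vector is a separate
    case with value 0.\<close>
  show "0 \<le> F p y"
    unfolding v F_chart[OF cp] using rnorm_pos[OF norm_b, of "\<theta> (cmap c p) v"]
    by (cases "\<theta> (cmap c p) v = 0") (auto simp: rnorm_def)
  fix r :: real assume "0 < r"
  then show "F p (\<lambda>f. r * y f) = r * F p y"
    by (simp add: v dvec_scale[OF cp] F_chart[OF cp] linear_cmul[OF linear_\<theta>[OF x]] rnorm_def distrib_left)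
next
  fix c assume c: "c \<in> A"
  interpret invariant_frame_chart G A e g \<omega> b c by unfold_locales (rule c)
  show "smooth_on (cimg c \<times> - {0}) (\<lambda>(x, y). local_F A F c x y)" by (rule smooth_local_F)
  fix x y v :: "real^'n" assume "x \<in> cimg c" "y \<noteq> 0" "v \<noteq> 0"
  then show "0 < v \<bullet> (gmat A F c x y *v v)" by (rule gmat_pos)
qed

theorem berwald: "berwald_type A F"
  unfolding berwald_type_def
proof (intro conjI finsler ballI allI impI)
  fix c x and y y' :: "real^'n" and i j k assume c: "c \<in> A" and x: "x \<in> cimg c" and y: "y \<noteq> 0" "y' \<noteq> 0"
  interpret invariant_frame_chart G A e g \<omega> b c by unfold_locales (rule c)
  show "chern A F c i j k x y = chern A F c i j k x y'"
    by (simp add: chern_eq[OF x] y)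
qed

end

subsection \<open>Curvature\<close>

text \<open>R(v,u)u for fields with constant frame coefficients v and u: the flat derivatives
  vanish, and torsion-freeness writes the bracket as \<omega> v u - \<omega> u v.\<close>

definition curv :: "(real^'n \<Rightarrow> real^'n \<Rightarrow> real^'n) \<Rightarrow> real^'n \<Rightarrow> real^'n \<Rightarrow> real^'n" where
  "curv \<omega> v u = \<omega> v (\<omega> u u) - \<omega> u (\<omega> v u) - \<omega> (\<omega> v u - \<omega> u v) u"

context horizontally_constant
begin

text \<open>For a section independent of the direction the vertical part of \<open>hderiv\<close>
  vanishes. Agreement with S is asked for nonzero y because the inner derivative of an iterated
  \<open>chern_nabla\<close> is only controlled there.\<close>

lemma chern_nabla_eq:
  assumes x: "x \<in> \<Omega>" and y: "y \<noteq> 0" and s: "\<And>x y. x \<in> \<Omega> \<Longrightarrow> y \<noteq> 0 \<Longrightarrow> s x y = S x"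
    and S: "S differentiable (at x)"
  shows "chern_nabla A F c V s x y = frechet_derivative S (at x) (V x) + \<Gamma> x (V x) (S x)"
proof -
  have z: "(x, y) \<in> D" using x y by simp
  have dS: "(S has_derivative frechet_derivative S (at x)) (at x)"
    using S by (simp add: frechet_derivative_works)
  have d: "((\<lambda>z. S (fst z) $ i) has_derivative (\<lambda>h. frechet_derivative S (at x) (fst h) $ i)) (at (x, y))" for i
    by (intro bounded_linear.has_derivative[OF bounded_linear_vec_nth]
        has_derivative_compose[OF bounded_linear_imp_has_derivative[OF bounded_linear_fst]])
      (use dS in simp)
  have h: "hderiv A F c k (\<lambda>x y. s x y $ i) x y = frechet_derivative S (at x) (axis k 1) $ i" for i k
  proof -
    have "hderiv A F c k (\<lambda>x y. s x y $ i) x y = Dx k (\<lambda>z. S (fst z) $ i) (x, y)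
       - (\<Sum>m\<in>UNIV. \<Gamma> x (axis k 1) y $ m * Dy m (\<lambda>z. S (fst z) $ i) (x, y))"
      by (rule hderiv_eq[OF x y]) (use d s in \<open>auto simp: differentiable_def\<close>)
    moreover have "frechet_derivative S (at x) 0 = 0"
      by (rule linear_0[OF linear_frechet_derivative[OF S]])
    ultimately show ?thesis by (simp add: frechet_derivative_eqI[OF d])
  qed
  have ch: "(\<Sum>j\<in>UNIV. chern A F c i j k x y * s x y $ j) = \<Gamma> x (axis k 1) (S x) $ i" for i k
    using Gamma_scale_sum[OF x, of "S x" "axis k 1" i] sym_\<Gamma>[OF x, of _ "axis k 1"]
    by (simp add: chern_eq[OF x y] s[OF x y] mult.commute)
  have lin: "V = (\<Sum>k\<in>UNIV. (V $ k) *\<^sub>R axis k 1)" for V :: "real^'n" by (rule vec_eq_sum_axis)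
  have 1: "frechet_derivative S (at x) (V x) $ i = (\<Sum>k\<in>UNIV. V x $ k * frechet_derivative S (at x) (axis k 1) $ i)" for i
    using linear_frechet_derivative[OF S] by (subst lin[of "V x"]) (simp add: linear_sum linear_cmul)
  show ?thesis
    by (simp add: vec_eq_iff chern_nabla_def h ch 1 distrib_left sum.distrib Gamma_scale_sum[OF x])
qed

end

context invariant_frame_chart
begin

definition nabla_hat :: "(real^'n \<Rightarrow> real^'n) \<Rightarrow> (real^'n \<Rightarrow> real^'n) \<Rightarrow> real^'n \<Rightarrow> real^'n" where
  "nabla_hat V S x = frechet_derivative S (at x) (V x) + \<omega> (\<theta> x (V x)) (S x)"

lemma bounded_bilinear_\<omega>: "bounded_bilinear \<omega>"
  using bilinear_\<omega> by (simp add: bilinear_conv_bounded_bilinear)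

lemma smooth_\<theta>_field: "smooth_on \<Omega> s \<Longrightarrow> smooth_on \<Omega> (\<lambda>x. \<theta> x (s x))"
  by (rule smooth_on_linear_family_apply[OF open_\<Omega> smooth_\<theta> linear_\<theta>])

lemma smooth_fr_field: "smooth_on \<Omega> s \<Longrightarrow> smooth_on \<Omega> (\<lambda>x. fr x (s x))"
  by (rule smooth_on_linear_family_apply[OF open_\<Omega> smooth_fr linear_fr])

lemma smooth_nabla_hat:
  assumes V: "smooth_on \<Omega> V" and S: "smooth_on \<Omega> S"
  shows "smooth_on \<Omega> (nabla_hat V S)"
proof -
  have "smooth_on \<Omega> (\<lambda>x. frechet_derivative S (at x) (V x))"
    by (rule smooth_on_linear_family_apply[OF open_\<Omega> smooth_on_frechet_derivative[OF S] _ V])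
      (rule linear_frechet_derivative[OF smooth_on_imp_differentiable[OF S]])
  moreover have "smooth_on \<Omega> (\<lambda>x. \<omega> (\<theta> x (V x)) (S x))"
    by (rule smooth_on_bilinear[OF bounded_bilinear_\<omega> open_\<Omega> smooth_\<theta>_field[OF V] S])
  ultimately show ?thesis unfolding nabla_hat_def by (rule smooth_on_add[OF open_\<Omega>])
qed

text \<open>In the moving frame the Chern connection is the flat derivative plus the constant form \<open>\<omega>\<close>.\<close>

lemma chern_nabla_frame:
  assumes x: "x \<in> \<Omega>" and y: "y \<noteq> 0" and s: "\<And>x y. x \<in> \<Omega> \<Longrightarrow> y \<noteq> 0 \<Longrightarrow> s x y = fr x (S x)"
    and S: "smooth_on \<Omega> S"
  shows "chern_nabla A F c V s x y = fr x (nabla_hat V S x)"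
proof -
  let ?T = "\<lambda>x. fr x (S x)"
  have d: "?T differentiable (at x)"
    by (rule smooth_on_imp_differentiable[OF smooth_fr_field[OF S] x])
  have "frechet_derivative S (at x) = frechet_derivative (\<lambda>x. \<theta> x (?T x)) (at x)"
    by (rule frechet_derivative_cong_open[OF open_\<Omega> x]) (simp add: \<theta>_fr)
  also have "\<dots> = (\<lambda>v. d\<theta> x v (?T x) + \<theta> x (frechet_derivative ?T (at x) v))"
    by (rule frechet_derivative_eqI[OF has_derivative_\<theta>_field[OF x d]])
  finally have "\<theta> x (frechet_derivative ?T (at x) (V x) + \<Gamma> x (V x) (?T x)) = nabla_hat V S x"
    by (simp add: nabla_hat_def linear_add[OF linear_\<theta>[OF x]] \<theta>_\<Gamma>[OF x] \<theta>_fr[OF x])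
  then have "frechet_derivative ?T (at x) (V x) + \<Gamma> x (V x) (?T x) = fr x (nabla_hat V S x)"
    by (metis fr_\<theta>[OF x])
  then show ?thesis by (subst chern_nabla_eq[OF x y s d]) auto
qed

text \<open>Product rule at a moving direction. The second derivative of S is kept as a separate
  term, so that symmetry can cancel it in the curvature.\<close>

lemma frechet_derivative_nabla_hat:
  assumes x: "x \<in> \<Omega>" and V: "smooth_on \<Omega> V" and S: "smooth_on \<Omega> S"
  shows "frechet_derivative (nabla_hat V S) (at x) h =
    frechet_derivative (\<lambda>y. frechet_derivative S (at y) (V x)) (at x) h
    + frechet_derivative S (at x) (frechet_derivative V (at x) h)
    + (\<omega> (\<theta> x (V x)) (frechet_derivative S (at x) h)
       + \<omega> (frechet_derivative (\<lambda>x. \<theta> x (V x)) (at x) h) (S x))"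
proof -
  have 1: "((\<lambda>x. frechet_derivative S (at x) (V x)) has_derivative
     (\<lambda>h. frechet_derivative (\<lambda>y. frechet_derivative S (at y) (V x)) (at x) h
       + frechet_derivative S (at x) (frechet_derivative V (at x) h))) (at x)"
    by (rule has_derivative_linear_family_apply[OF open_\<Omega> smooth_on_frechet_derivative[OF S] _ x
          smooth_on_imp_differentiable[OF V x]])
      (rule linear_frechet_derivative[OF smooth_on_imp_differentiable[OF S]])
  have 2: "((\<lambda>x. \<omega> (\<theta> x (V x)) (S x)) has_derivative
     (\<lambda>h. \<omega> (\<theta> x (V x)) (frechet_derivative S (at x) h)
       + \<omega> (frechet_derivative (\<lambda>x. \<theta> x (V x)) (at x) h) (S x))) (at x)"
    by (intro bounded_bilinear.FDERIV[OF bounded_bilinear_\<omega>] smooth_on_imp_has_derivative[OF _ x] smooth_\<theta>_field V S)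
  show ?thesis unfolding nabla_hat_def
    by (simp add: frechet_derivative_eqI[OF has_derivative_add[OF 1 2]])
qed

text \<open>Tensoriality by computation: second derivatives cancel by symmetry, first derivatives
  against the bracket term, and only the algebraic part survives.\<close>

theorem chern_curvature_eq:
  assumes V: "vector_field A V" and U: "vector_field A U" and p: "p \<in> cdom c"
    and nz: "local_field c U (cmap c p) \<noteq> 0"
  shows "chern_curvature A F c p V U = dvec A c p (fr (cmap c p)
     (curv \<omega> (\<theta> (cmap c p) (local_field c V (cmap c p))) (\<theta> (cmap c p) (local_field c U (cmap c p)))))"
proof -
  define x where "x = cmap c p"
  define u v where "u = local_field c U" and "v = local_field c V"
  define w where "w = local_field c (lie_bracket A V U)"
  define uh vh where "uh = (\<lambda>x. \<theta> x (u x))" and "vh = (\<lambda>x. \<theta> x (v x))"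
  have x: "x \<in> \<Omega>" using p by (simp add: x_def)
  have y: "u x \<noteq> 0" using nz by (simp add: u_def x_def)
  have su: "smooth_on \<Omega> u" and sv: "smooth_on \<Omega> v"
    using smooth_local_field[OF _ c] U V by (simp_all add: u_def v_def)
  have suh: "smooth_on \<Omega> uh" and svh: "smooth_on \<Omega> vh"
    unfolding uh_def vh_def by (rule smooth_\<theta>_field su sv)+
  have u: "u z = fr z (uh z)" if "z \<in> \<Omega>" for z using that by (simp add: uh_def fr_\<theta>)
  have c1: "chern_nabla A F c t (\<lambda>x y. u x) z y = fr z (nabla_hat t uh z)" if "z \<in> \<Omega>" "y \<noteq> 0" for t z y
    by (rule chern_nabla_frame[OF that _ suh]) (rule u)
  have c2: "chern_nabla A F c t (chern_nabla A F c t' (\<lambda>x y. u x)) x (u x) = fr x (nabla_hat t (nabla_hat t' uh) x)"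
    if "smooth_on \<Omega> t'" for t t'
    by (rule chern_nabla_frame[OF x y _ smooth_nabla_hat[OF that suh]]) (rule c1)
  have du: "frechet_derivative uh (at x) h = d\<theta> x h (u x) + \<theta> x (frechet_derivative u (at x) h)"
    and dv: "frechet_derivative vh (at x) h = d\<theta> x h (v x) + \<theta> x (frechet_derivative v (at x) h)" for h
    unfolding uh_def vh_def
    by (simp_all add: frechet_derivative_eqI[OF has_derivative_\<theta>_field[OF x smooth_on_imp_differentiable[OF _ x]]] su sv)
  have w: "w x = frechet_derivative u (at x) (v x) - frechet_derivative v (at x) (u x)"
    unfolding w_def u_def v_def by (rule local_field_lie_bracket[OF V U c x])
  \<comment> \<open>The frame components of the bracket are the naive difference of derivatives plus
    the algebraic bracket of the values, which comes from the Maurer-Cartan equation and supplies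
    the last term of \<open>curv\<close>.\<close>
  have \<theta>w: "\<theta> x (w x) = frechet_derivative uh (at x) (v x) - frechet_derivative vh (at x) (u x)
     - (\<omega> (uh x) (vh x) - \<omega> (vh x) (uh x))"
    using maurer_cartan[OF x, of "v x" "u x"]
    unfolding w linear_diff[OF linear_\<theta>[OF x]] du dv by (simp add: uh_def vh_def algebra_simps)
  have lin: "linear (frechet_derivative uh (at x))"
    by (rule linear_frechet_derivative[OF smooth_on_imp_differentiable[OF suh x]])
  have duw: "frechet_derivative uh (at x) (w x) = frechet_derivative uh (at x) (frechet_derivative u (at x) (v x))
      - frechet_derivative uh (at x) (frechet_derivative v (at x) (u x))"
    by (simp add: w linear_diff[OF lin])
  have "nabla_hat v (nabla_hat u uh) x - nabla_hat u (nabla_hat v uh) x - nabla_hat w uh x = curv \<omega> (vh x) (uh x)"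
    unfolding nabla_hat_def[of _ "nabla_hat _ _"] frechet_derivative_nabla_hat[OF x su suh]
      frechet_derivative_nabla_hat[OF x sv suh] nabla_hat_def[of w]
      second_derivative_symmetric[OF open_\<Omega> x suh, of "v x" "u x"] \<theta>w duw
    by (simp add: nabla_hat_def curv_def \<omega>_simps bilinear_rsub[OF bilinear_\<omega>]
        bilinear_lsub[OF bilinear_\<omega>] flip: uh_def vh_def) (simp add: uh_def vh_def)
  then have "chern_nabla A F c v (chern_nabla A F c u (\<lambda>x y. u x)) x (u x)
     - chern_nabla A F c u (chern_nabla A F c v (\<lambda>x y. u x)) x (u x)
     - chern_nabla A F c w (\<lambda>x y. u x) x (u x) = fr x (curv \<omega> (vh x) (uh x))"
    by (simp add: c2 su sv c1[OF x y] flip: linear_diff[OF linear_fr])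
  then show ?thesis
    unfolding chern_curvature_def Let_def by (simp add: u_def v_def w_def x_def uh_def vh_def)
qed

section \<open>Fundamental tensor and flag curvature in the frame\<close>

lemma fundamental_tensor_eq:
  assumes p: "p \<in> cdom c" and u: "u \<noteq> 0"
  shows "fundamental_tensor F p (dvec A c p u) (dvec A c p v) (dvec A c p w) =
    rtensor b (\<theta> (cmap c p) u) (\<theta> (cmap c p) v) (\<theta> (cmap c p) w)"
proof -
  let ?x = "cmap c p"
  have x: "?x \<in> \<Omega>" using p by simp
  note \<theta>_lin = linear_add[OF linear_\<theta>[OF x]] linear_cmul[OF linear_\<theta>[OF x]]
  have u0: "\<theta> ?x u \<noteq> 0" using u \<theta>_eq_0_iff[OF x] by simp
  have e: "F p (\<lambda>f. dvec A c p u f + s * dvec A c p v f + t * dvec A c p w f) =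
      rnorm b (\<theta> ?x u + s *\<^sub>R \<theta> ?x v + t *\<^sub>R \<theta> ?x w)" for s t
  proof -
    have "(\<lambda>f. dvec A c p u f + s * dvec A c p v f + t * dvec A c p w f) = dvec A c p (u + s *\<^sub>R v + t *\<^sub>R w)"
      using dvec_linear[OF c p, of 1 u s v] dvec_linear[OF c p, of 1 "u + s *\<^sub>R v" t w] by (simp add: fun_eq_iff)
    then show ?thesis using F_dvec[OF x] by (simp add: cinv_cmap[OF c p] \<theta>_lin)
  qed
  have "((\<lambda>s. deriv (\<lambda>t. (rnorm b (\<theta> ?x u + s *\<^sub>R \<theta> ?x v + t *\<^sub>R \<theta> ?x w))\<^sup>2) 0) has_real_derivative
      2 * rtensor b (\<theta> ?x u) (\<theta> ?x v) (\<theta> ?x w)) (at 0)"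
  proof (rule has_field_derivative_transform_within_open[OF
        rnorm_sq_deriv_has_real_derivative_along_line[OF u0] open_line_preimage[of "- {0}" "\<theta> ?x u" "\<theta> ?x v"]])
    fix s assume "s \<in> {t. \<theta> ?x u + t *\<^sub>R \<theta> ?x v \<in> - {0}}"
    then show "rnorm_sq_deriv b (\<theta> ?x u + s *\<^sub>R \<theta> ?x v) (\<theta> ?x w) =
       deriv (\<lambda>t. (rnorm b (\<theta> ?x u + s *\<^sub>R \<theta> ?x v + t *\<^sub>R \<theta> ?x w))\<^sup>2) 0"
      by (intro DERIV_imp_deriv[symmetric] rnorm_sq_has_real_derivative_along_line) simp
  qed (use u0 in auto)
  from DERIV_imp_deriv[OF this] show ?thesis by (simp add: fundamental_tensor_def e)
qed

lemma skew_polarized: "\<omega> p s \<bullet> t = - (s \<bullet> \<omega> p t)"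
  using skew_\<omega>[of "s + t" p] by (simp add: \<omega>_simps inner_add_left inner_add_right skew_\<omega> inner_commute)

text \<open>The map v |-> \<open>\<omega> p v\<close> is skew for each p, so on u the two iterated
  terms have equal products with u and the bracket term has none. Every term is a value of \<omega>,
  hence orthogonal to b.\<close>

lemma curv_orthogonal: "u \<bullet> curv \<omega> v u = 0" "b \<bullet> curv \<omega> v u = 0"
proof -
  have "u \<bullet> curv \<omega> v u = - (\<omega> v u \<bullet> \<omega> u u) + \<omega> u u \<bullet> \<omega> v u"
    using skew_polarized[of v u "\<omega> u u"] skew_polarized[of u u "\<omega> v u"]
    by (simp add: curv_def inner_diff_right skew_\<omega>)
  then show "u \<bullet> curv \<omega> v u = 0" by (simp add: inner_commute)
  show "b \<bullet> curv \<omega> v u = 0" by (simp add: curv_def inner_diff_right parallel)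
qed

text \<open>Write N for the Randers norm of u. Orthogonality of the curvature to u and b reduces the
  numerator to N/|u| times the Riemannian one; the denominator is N^3/|u|^3 times the Gram
  determinant.\<close>

theorem flag_curvature_eq:
  assumes V: "vector_field A V" and U: "vector_field A U" and p: "p \<in> cdom c"
    and u: "u = \<theta> (cmap c p) (local_field c U (cmap c p))" and v: "v = \<theta> (cmap c p) (local_field c V (cmap c p))"
    and nz: "u \<noteq> 0"
  shows "flag_curvature A F c p U V =
    (norm u)\<^sup>2 * (curv \<omega> v u \<bullet> v) / ((rnorm b u)\<^sup>2 * ((norm u)\<^sup>2 * (norm v)\<^sup>2 - (u \<bullet> v)\<^sup>2))"
proof -
  let ?x = "cmap c p"
  have x: "?x \<in> \<Omega>" using p by simp
  have l0: "local_field c U ?x \<noteq> 0" using nz u \<theta>_eq_0_iff[OF x] by auto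
  have N: "rnorm b u > 0" by (rule rnorm_pos[OF norm_b nz])
  have n: "norm u > 0" using nz by simp
  have num: "fundamental_tensor F p (U p) (chern_curvature A F c p V U) (V p) = rnorm b u / norm u * (curv \<omega> v u \<bullet> v)"
    unfolding chern_curvature_eq[OF V U p l0] vector_field_dvec[OF U c p] vector_field_dvec[OF V c p]
      fundamental_tensor_eq[OF p l0] \<theta>_fr[OF x] u[symmetric] v[symmetric]
    by (simp add: rtensor_def curv_orthogonal)
  \<comment> \<open>The derivative of N at u along v; its square drops out of the
    denominator.\<close>
  define \<beta> where "\<beta> = (u \<bullet> v) / norm u + b \<bullet> v"
  have uu: "(u \<bullet> u) / norm u = norm u" "u \<bullet> u - (u \<bullet> u) * (u \<bullet> u) / (norm u)\<^sup>2 = 0"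
      "u \<bullet> v - (u \<bullet> u) * (u \<bullet> v) / (norm u)\<^sup>2 = 0"
    using n by (simp_all add: dot_square_norm power2_eq_square)
  have 1: "fundamental_tensor F p (U p) (U p) (U p) = (rnorm b u)\<^sup>2"
    unfolding vector_field_dvec[OF U c p] fundamental_tensor_eq[OF p l0] u[symmetric] rtensor_def uu
    by (simp add: rnorm_def power2_eq_square)
  have 2: "fundamental_tensor F p (U p) (U p) (V p) = rnorm b u * \<beta>"
    unfolding vector_field_dvec[OF U c p] vector_field_dvec[OF V c p] fundamental_tensor_eq[OF p l0]
      u[symmetric] v[symmetric] rtensor_def uu
    by (simp add: rnorm_def \<beta>_def)
  have 3: "fundamental_tensor F p (U p) (V p) (V p) =
      rnorm b u / norm u * ((norm v)\<^sup>2 - (u \<bullet> v)\<^sup>2 / (norm u)\<^sup>2) + \<beta>\<^sup>2"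
    unfolding vector_field_dvec[OF U c p] vector_field_dvec[OF V c p] fundamental_tensor_eq[OF p l0]
      u[symmetric] v[symmetric] rtensor_def
    by (simp add: \<beta>_def power2_eq_square dot_square_norm)
  have "(rnorm b u)\<^sup>2 * (rnorm b u / norm u * ((norm v)\<^sup>2 - (u \<bullet> v)\<^sup>2 / (norm u)\<^sup>2) + \<beta>\<^sup>2) - (rnorm b u * \<beta>)\<^sup>2
     = (rnorm b u / norm u) * ((rnorm b u)\<^sup>2 * ((norm u)\<^sup>2 * (norm v)\<^sup>2 - (u \<bullet> v)\<^sup>2) / (norm u)\<^sup>2)"
    using n by (simp add: field_simps power2_eq_square)
  then show ?thesis
    using n N by (simp add: flag_curvature_def num 1 2 3)
qed

lemma local_field_frame_combination:
  "x \<in> \<Omega> \<Longrightarrow> local_field c (\<lambda>p f. \<Sum>k\<in>UNIV. u $ k * e k p f) x = fr x u"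
  by (simp add: local_field_def randers_field_dvec components_dvec[OF c cinv_in_cdom[OF c]])

end

context invariant_frame
begin

lemma vector_field_frame_combination: "vector_field A (\<lambda>p f. \<Sum>k\<in>UNIV. u $ k * e k p f)"
  unfolding vector_field_def
proof (intro conjI allI ballI)
  fix p
  obtain c where cp: "c \<in> A" "p \<in> cdom c" by (rule chart_at)
  have x: "cmap c p \<in> cimg c" using cp(2) by (rule imageI)
  interpret invariant_frame_chart G A e g \<omega> b c by unfold_locales (rule cp)
  show "(\<lambda>f. \<Sum>k\<in>UNIV. u $ k * e k p f) \<in> tangent_space A p"
    using randers_field_dvec[OF x, of u] tangent_space_chart[OF cp] by (simp add: cinv_cmap[OF cp])
next
  fix c assume cA: "c \<in> A"
  interpret invariant_frame_chart G A e g \<omega> b c by unfold_locales (rule cA)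
  show "smooth_on (cimg c) (local_field c (\<lambda>p f. \<Sum>k\<in>UNIV. u $ k * e k p f))"
    by (rule smooth_on_cong[OF open_\<Omega> _ smooth_fr[of u]]) (simp add: local_field_frame_combination)
qed

lemma flag_curvature_frame_combination:
  fixes u v :: "real^'n"
  assumes "c \<in> A" "p \<in> cdom c" and uv: "norm u = 1" "norm v = 1" "u \<bullet> v = 0"
  shows "flag_curvature A F c p (\<lambda>p f. \<Sum>k\<in>UNIV. u $ k * e k p f) (\<lambda>p f. \<Sum>k\<in>UNIV. v $ k * e k p f) =
    curv \<omega> v u \<bullet> v / (1 + b \<bullet> u)\<^sup>2"
proof -
  have x: "cmap c p \<in> cimg c" using assms(2) by (rule imageI)
  interpret invariant_frame_chart G A e g \<omega> b c by unfold_locales (rule assms(1))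
  have "flag_curvature A F c p (\<lambda>p f. \<Sum>k\<in>UNIV. u $ k * e k p f) (\<lambda>p f. \<Sum>k\<in>UNIV. v $ k * e k p f) =
    (norm u)\<^sup>2 * (curv \<omega> v u \<bullet> v) / ((rnorm b u)\<^sup>2 * ((norm u)\<^sup>2 * (norm v)\<^sup>2 - (u \<bullet> v)\<^sup>2))"
    by (rule flag_curvature_eq[OF vector_field_frame_combination vector_field_frame_combination assms(2)])
      (use uv in \<open>auto simp: local_field_frame_combination[OF x] \<theta>_fr[OF x]\<close>)
  then show ?thesis using uv by (simp add: rnorm_def)
qed

lemma nonpositive_curvature:
  assumes K: "\<And>u v. curv \<omega> v u \<bullet> v \<le> 0"
  shows "nonpositive_flag_curvature A F"
  unfolding nonpositive_flag_curvature_def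
proof (intro allI ballI impI, elim conjE)
  fix p c U V
  assume cA: "c \<in> A" and p: "p \<in> cdom c" and U: "vector_field A U" and V: "vector_field A V"
    and ind: "\<forall>r s. (\<lambda>f. r * U p f + s * V p f) = (\<lambda>f. 0) \<longrightarrow> r = 0 \<and> s = 0"
  have x: "cmap c p \<in> cimg c" using p by (rule imageI)
  interpret invariant_frame_chart G A e g \<omega> b c by unfold_locales (rule cA)
  define u v where "u = \<theta> (cmap c p) (local_field c U (cmap c p))" and "v = \<theta> (cmap c p) (local_field c V (cmap c p))"
  have "u \<noteq> 0"
  proof
    assume "u = 0"
    then have "U p = (\<lambda>f. 0)"
      by (simp add: u_def \<theta>_eq_0_iff[OF x] vector_field_dvec[OF U cA p] dvec_0[OF cA p])
    then show False using ind[rule_format, of 1 0] by simp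
  qed
  from flag_curvature_eq[OF V U p u_def v_def this]
  have "flag_curvature A F c p U V =
    (norm u)\<^sup>2 * (curv \<omega> v u \<bullet> v) / ((rnorm b u)\<^sup>2 * ((norm u)\<^sup>2 * (norm v)\<^sup>2 - (u \<bullet> v)\<^sup>2))" .
  also have "\<dots> \<le> 0"
  \<comment> \<open>Cauchy-Schwarz gives the sign of the Gram determinant.\<close>
  proof (rule divide_nonpos_nonneg)
    show "(norm u)\<^sup>2 * (curv \<omega> v u \<bullet> v) \<le> 0" using K[of v u] by (intro mult_nonneg_nonpos) auto
    show "0 \<le> (rnorm b u)\<^sup>2 * ((norm u)\<^sup>2 * (norm v)\<^sup>2 - (u \<bullet> v)\<^sup>2)"
      using Cauchy_Schwarz_ineq[of u v] by (simp add: dot_square_norm)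
  qed
  finally show "flag_curvature A F c p U V \<le> 0" .
qed

end

subsection \<open>Ordinary differential equations\<close>

lemma norm_diff_le_of_vector_derivative:
  fixes G :: "real \<Rightarrow> 'a::real_normed_vector"
  assumes G: "\<And>t. t \<in> {a..b} \<Longrightarrow> (G has_vector_derivative g t) (at t within {a..b})"
    and B: "\<And>t. t \<in> {a..b} \<Longrightarrow> norm (g t) \<le> B" and t: "t \<in> {a..b}" "s \<in> {a..b}"
  shows "norm (G t - G s) \<le> B * \<bar>t - s\<bar>"
proof -
  have "norm (G t - G s) \<le> B * norm (t - s)"
  proof (rule differentiable_bound[of "{a..b}" G "\<lambda>t h. h *\<^sub>R g t" B t s])
    fix t assume t: "t \<in> {a..b}"
    show "(G has_derivative (\<lambda>h. h *\<^sub>R g t)) (at t within {a..b})"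
      using G[OF t] by (simp add: has_vector_derivative_def)
    have "norm (h *\<^sub>R g t) \<le> B * norm h" for h
      using mult_left_mono[OF B[OF t], of "\<bar>h\<bar>"] by (simp add: mult.commute)
    then show "onorm (\<lambda>h. h *\<^sub>R g t) \<le> B" by (rule onorm_le)
  qed (use t in auto)
  then show ?thesis by simp
qed

text \<open>Composing the vector field with the projection onto the ball makes it globally Lipschitz, so
  that the Picard operator is a contraction of all bounded continuous curves.\<close>

lemma picard_lindelof_ball:
  fixes f :: "'a::euclidean_space \<Rightarrow> 'a"
  assumes lip: "\<And>z w. z \<in> cball z0 R \<Longrightarrow> w \<in> cball z0 R \<Longrightarrow> norm (f z - f w) \<le> L * norm (z - w)"
    and M: "\<And>z. z \<in> cball z0 R \<Longrightarrow> norm (f z) \<le> M"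
    and R: "0 \<le> R" and \<epsilon>: "0 < \<epsilon>" "\<epsilon> * M \<le> R" "\<epsilon> * L < 1" and L: "0 \<le> L"
  shows "\<exists>z. z 0 = z0 \<and> (\<forall>t\<in>{-\<epsilon><..<\<epsilon>}. z t \<in> cball z0 R \<and> (z has_vector_derivative f (z t)) (at t))"
proof -
  let ?C = "cball z0 R" and ?I = "{-\<epsilon>..\<epsilon>}"
  define \<pi> where "\<pi> = closest_point ?C"
  have \<pi>C: "\<pi> z \<in> ?C" for z unfolding \<pi>_def by (rule closest_point_in_set) (use R in auto)
  have \<pi>lip: "norm (\<pi> z - \<pi> w) \<le> norm (z - w)" for z w
    using closest_point_lipschitz[of ?C z w] R by (simp add: \<pi>_def dist_norm)
  have fc: "continuous_on ?C f"
  proof (rule continuous_onI)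
    fix x e assume x: "x \<in> ?C" and e: "(0::real) < e"
    show "\<exists>d>0. \<forall>y\<in>?C. dist y x < d \<longrightarrow> dist (f y) (f x) \<le> e"
    proof (intro exI[of _ "e / (L + 1)"] conjI ballI impI)
      show "0 < e / (L + 1)" using e L by simp
      fix y assume y: "y \<in> ?C" and d: "dist y x < e / (L + 1)"
      have "norm (f y - f x) \<le> L * norm (y - x)" by (rule lip[OF y x])
      also have "\<dots> \<le> (L + 1) * norm (y - x)" by (intro mult_right_mono) auto
      also have "\<dots> \<le> e" using d L by (simp add: dist_norm field_simps)
      finally show "dist (f y) (f x) \<le> e" by (simp add: dist_norm)
    qed
  qed
  define h where "h w s = f (\<pi> (apply_bcontfun w s))" for w :: "real \<Rightarrow>\<^sub>C 'a" and s
  have hc: "continuous_on ?I (h w)" for w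
    unfolding h_def \<pi>_def
    by (rule continuous_on_compose2[OF fc continuous_on_compose2[OF continuous_on_closest_point[of ?C UNIV]]])
      (use R \<pi>C in \<open>auto simp: \<pi>_def\<close>)
  \<comment> \<open>Integrating from the left end and subtracting the value at 0 gives one formula
    for both signs of t.\<close>
  define Op where "Op w t = z0 + (integral {-\<epsilon>..t} (h w) - integral {-\<epsilon>..0} (h w))" for w t
  have Op': "(Op w has_vector_derivative h w t) (at t within ?I)" if "t \<in> ?I" for w t
    unfolding Op_def using integral_has_vector_derivative[OF hc that, of w]
    by (auto intro!: derivative_eq_intros)
  \<comment> \<open>\<open>clamp\<close> extends the curve constantly beyond the interval, so that
    the operator maps bounded continuous functions on the line to themselves.\<close>
  have "\<exists>P. \<forall>x. apply_bcontfun P x = Op w (clamp (-\<epsilon>) \<epsilon> x)" for w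
  proof -
    have "continuous_on (cbox (-\<epsilon>) \<epsilon>) (Op w)"
      unfolding cbox_interval by (rule continuous_on_vector_derivative[OF Op'])
    then show ?thesis by (rule continuous_on_cbox_bcontfunE) blast
  qed
  then obtain P where P: "\<And>w x. apply_bcontfun (P w) x = Op w (clamp (-\<epsilon>) \<epsilon> x)" by metis
  have cl: "clamp (-\<epsilon>) \<epsilon> x \<in> ?I" for x using clamp_in_interval[of "-\<epsilon>" \<epsilon> x] \<epsilon> by simp
  have "\<forall>w w'. dist (P w) (P w') \<le> (\<epsilon> * L) * dist w w'"
  proof (intro allI dist_bound)
    fix w w' x
    define c where "c = clamp (-\<epsilon>) \<epsilon> x"
    have c: "c \<in> ?I" unfolding c_def by (rule cl)
    have "norm ((Op w c - Op w' c) - (Op w 0 - Op w' 0)) \<le> (L * dist w w') * \<bar>c - 0\<bar>"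
    proof (rule norm_diff_le_of_vector_derivative[of "-\<epsilon>" \<epsilon> "\<lambda>t. Op w t - Op w' t" "\<lambda>t. h w t - h w' t"])
      show "norm (h w t - h w' t) \<le> L * dist w w'" for t
      proof -
        have "norm (h w t - h w' t) \<le> L * norm (\<pi> (apply_bcontfun w t) - \<pi> (apply_bcontfun w' t))"
          unfolding h_def by (rule lip[OF \<pi>C \<pi>C])
        also have "\<dots> \<le> L * norm (apply_bcontfun w t - apply_bcontfun w' t)"
          by (rule mult_left_mono[OF \<pi>lip L])
        also have "\<dots> \<le> L * dist w w'"
          using dist_bounded[of w t w'] L by (intro mult_left_mono) (auto simp: dist_norm)
        finally show ?thesis .
      qed
    qed (use \<epsilon> c Op' in \<open>auto intro!: has_vector_derivative_diff\<close>)
    also have "\<dots> \<le> (L * dist w w') * \<epsilon>" using c L by (intro mult_left_mono) auto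
    finally show "dist (apply_bcontfun (P w) x) (apply_bcontfun (P w') x) \<le> (\<epsilon> * L) * dist w w'"
      by (simp add: P dist_norm Op_def flip: c_def) (simp add: mult_ac)
  qed
  then obtain w where w: "P w = w"
    using banach_fix_type[of "\<epsilon> * L" P] \<epsilon> L by auto
  define z where "z = apply_bcontfun w"
  have zI: "z t = Op w t" if "t \<in> ?I" for t
    using P[of w t] that by (simp add: z_def w clamp_cancel_cbox)
  have z0: "z 0 = z0" using zI[of 0] \<epsilon> by (simp add: Op_def)
  have C: "z t \<in> ?C" if t: "t \<in> ?I" for t
  proof -
    have "norm (Op w t - Op w 0) \<le> M * \<bar>t - 0\<bar>"
      by (rule norm_diff_le_of_vector_derivative[of "-\<epsilon>" \<epsilon> "Op w" "h w"])
        (use Op' M \<pi>C t \<epsilon> in \<open>auto simp: h_def\<close>)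
    also have "\<dots> \<le> M * \<epsilon>" using t M[of z0] R by (intro mult_left_mono) (auto intro: order_trans[OF norm_ge_zero])
    finally show ?thesis using zI[OF t] zI[of 0] \<epsilon> z0 by (simp add: dist_norm norm_minus_commute mult.commute)
  qed
  show ?thesis
  proof (intro exI conjI ballI)
    show "z 0 = z0" by (rule z0)
    fix t assume t: "t \<in> {-\<epsilon><..<\<epsilon>}"
    then have tI: "t \<in> ?I" by auto
    show "z t \<in> ?C" by (rule C[OF tI])
    \<comment> \<open>The fixed point stays in the ball, where the projection is the identity, so it
      solves the original equation.\<close>
    have "(Op w has_vector_derivative f (z t)) (at t)"
      using Op'[OF tI, of w] at_within_Icc_at[of "-\<epsilon>" t \<epsilon>] t closest_point_self[OF C[OF tI]]
      by (simp add: h_def \<pi>_def flip: z_def)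
    then show "(z has_vector_derivative f (z t)) (at t)"
      by (rule has_vector_derivative_transform_within_open[OF _ open_greaterThanLessThan t]) (use zI in auto)
  qed
qed

text \<open>Continuity of derivatives is known one direction at a time; adding the bounds over
  \<open>Basis\<close> controls the operator norm.\<close>

lemma smooth_on_compact_bounds:
  fixes f :: "'a::euclidean_space \<Rightarrow> 'b::real_normed_vector"
  assumes f: "smooth_on S f" and K: "compact K" "K \<subseteq> S"
  obtains L M where "0 \<le> L" "0 \<le> M" "\<And>z. z \<in> K \<Longrightarrow> norm (f z) \<le> M"
    "\<And>z. z \<in> K \<Longrightarrow> onorm (frechet_derivative f (at z)) \<le> L"
proof -
  have bnd: "\<exists>B\<ge>0. \<forall>z\<in>K. norm (k z) \<le> B" if "continuous_on S k" for k :: "'a \<Rightarrow> 'b"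
  proof -
    have "bounded (k ` K)"
      by (intro compact_imp_bounded compact_continuous_image continuous_on_subset[OF that] K)
    then obtain B where "\<forall>z\<in>K. norm (k z) \<le> B" by (auto simp: bounded_iff)
    then show ?thesis by (intro exI[of _ "max 0 B"]) (auto intro: order_trans)
  qed
  obtain M where M: "0 \<le> M" "\<And>z. z \<in> K \<Longrightarrow> norm (f z) \<le> M"
    using bnd[OF smooth_on_imp_continuous_on[OF f]] by auto
  have "\<forall>i. \<exists>B\<ge>0. \<forall>z\<in>K. norm (frechet_derivative f (at z) i) \<le> B"
    using bnd[OF smooth_on_imp_continuous_on[OF smooth_on_frechet_derivative[OF f]]] by blast
  then obtain B where B: "\<And>i. 0 \<le> B i" "\<And>i z. z \<in> K \<Longrightarrow> norm (frechet_derivative f (at z) i) \<le> B i"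
    by metis
  have "onorm (frechet_derivative f (at z)) \<le> (\<Sum>i\<in>Basis. B i)" if z: "z \<in> K" for z
  proof (rule onorm_le)
    fix h
    have l: "linear (frechet_derivative f (at z))"
      by (rule linear_frechet_derivative[OF smooth_on_imp_differentiable[OF f]]) (use z K in auto)
    have "frechet_derivative f (at z) h = frechet_derivative f (at z) (\<Sum>i\<in>Basis. (h \<bullet> i) *\<^sub>R i)"
      by (simp add: euclidean_representation)
    also have "\<dots> = (\<Sum>i\<in>Basis. (h \<bullet> i) *\<^sub>R frechet_derivative f (at z) i)"
      by (simp only: linear_sum[OF l] linear_cmul[OF l])
    also have "norm \<dots> \<le> (\<Sum>i\<in>Basis. norm h * B i)"
    proof (rule sum_norm_le)
      fix i :: 'a assume "i \<in> Basis"
      then show "norm ((h \<bullet> i) *\<^sub>R frechet_derivative f (at z) i) \<le> norm h * B i"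
        using B z Basis_le_norm by (auto intro!: mult_mono)
    qed
    finally show "norm (frechet_derivative f (at z) h) \<le> (\<Sum>i\<in>Basis. B i) * norm h"
      by (simp add: sum_distrib_left mult.commute)
  qed
  then show ?thesis using that[of "\<Sum>i\<in>Basis. B i" M] M B(1) by (auto intro: sum_nonneg)
qed

lemma smooth_on_lipschitz_cball:
  fixes f :: "'a::euclidean_space \<Rightarrow> 'b::real_normed_vector"
  assumes f: "smooth_on S f" and S: "cball z0 R \<subseteq> S"
    and L: "\<And>z. z \<in> cball z0 R \<Longrightarrow> onorm (frechet_derivative f (at z)) \<le> L"
    and z: "z \<in> cball z0 R" "w \<in> cball z0 R"
  shows "norm (f z - f w) \<le> L * norm (z - w)"
  by (rule differentiable_bound[OF convex_cball has_derivative_at_withinI[OF smooth_on_imp_has_derivative[OF f]] L z])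
    (use S in auto)

text \<open>A closed R-neighbourhood of K is a compact subset of S. One bound and one Lipschitz
  constant there serve the R-balls around all points of K, so the time depends on K alone.\<close>

lemma local_solution_uniform:
  fixes f :: "'a::euclidean_space \<Rightarrow> 'a"
  assumes f: "smooth_on S f" and S: "open S" and K: "compact K" "K \<subseteq> S" "K \<noteq> {}"
  shows "\<exists>\<epsilon>>0. \<forall>z0\<in>K. \<exists>z. z 0 = z0 \<and> (\<forall>t\<in>{-\<epsilon><..<\<epsilon>}. z t \<in> S \<and> (z has_vector_derivative f (z t)) (at t))"
proof -
  obtain R where R: "R > 0" "{x. infdist x K \<le> R} \<subseteq> S"
    by (rule compact_in_open_separated[OF K(3,1) S K(2)])
  let ?K = "{x. infdist x K \<le> R}"
  obtain L M where LM: "0 \<le> L" "0 \<le> M" "\<And>z. z \<in> ?K \<Longrightarrow> norm (f z) \<le> M"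
      "\<And>z. z \<in> ?K \<Longrightarrow> onorm (frechet_derivative f (at z)) \<le> L"
    by (rule smooth_on_compact_bounds[OF f compact_infdist_le[OF K(3,1) R(1)] R(2)]) blast
  \<comment> \<open>The first bound keeps solutions in the R-ball, the second makes the Picard
    operator a contraction; the summands 1 guard against M = 0 and L = 0.\<close>
  define \<epsilon> where "\<epsilon> = min (R / (M + 1)) (1 / (2 * (L + 1)))"
  have \<epsilon>: "0 < \<epsilon>" using R LM by (simp add: \<epsilon>_def)
  have "\<epsilon> * M \<le> R / (M + 1) * M" using LM by (intro mult_right_mono) (auto simp: \<epsilon>_def)
  also have "\<dots> \<le> R" using LM R by (simp add: field_simps)
  finally have \<epsilon>M: "\<epsilon> * M \<le> R" .
  have "\<epsilon> * L \<le> 1 / (2 * (L + 1)) * L" using LM by (intro mult_right_mono) (auto simp: \<epsilon>_def)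
  also have "\<dots> < 1" using LM by (simp add: field_simps)
  finally have \<epsilon>L: "\<epsilon> * L < 1" .
  show ?thesis
  proof (intro exI[of _ \<epsilon>] conjI \<epsilon> ballI)
    fix z0 assume z0: "z0 \<in> K"
    have ball: "cball z0 R \<subseteq> ?K"
      using z0 by (auto intro: infdist_le2 simp: dist_commute)
    have "\<exists>z. z 0 = z0 \<and> (\<forall>t\<in>{-\<epsilon><..<\<epsilon>}. z t \<in> cball z0 R \<and> (z has_vector_derivative f (z t)) (at t))"
    proof (rule picard_lindelof_ball[of z0 R f L M \<epsilon>])
      show "norm (f z - f w) \<le> L * norm (z - w)" if "z \<in> cball z0 R" "w \<in> cball z0 R" for z w
        by (rule smooth_on_lipschitz_cball[OF f _ _ that]) (use ball R LM(4) in auto)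
    qed (use ball LM R \<epsilon> \<epsilon>M \<epsilon>L in auto)
    then show "\<exists>z. z 0 = z0 \<and> (\<forall>t\<in>{-\<epsilon><..<\<epsilon>}. z t \<in> S \<and> (z has_vector_derivative f (z t)) (at t))"
      using ball R(2) by blast
  qed
qed

text \<open>Gronwall by monotonicity: the squared distance d satisfies |d'| <= 2 L d, so d times
  exp(-2 L t) does not increase and d times exp(2 L t) does not decrease. The first handles times
  after t0, the second times before.\<close>

lemma lipschitz_solutions_agree:
  fixes z w :: "real \<Rightarrow> 'a::real_inner"
  assumes J: "is_interval J"
    and z: "\<And>t. t \<in> J \<Longrightarrow> (z has_vector_derivative f (z t)) (at t)"
    and w: "\<And>t. t \<in> J \<Longrightarrow> (w has_vector_derivative f (w t)) (at t)"
    and lip: "\<And>t. t \<in> J \<Longrightarrow> norm (f (z t) - f (w t)) \<le> L * norm (z t - w t)"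
    and t0: "t0 \<in> J" "z t0 = w t0" and t: "t \<in> J"
  shows "z t = w t"
proof -
  define d where "d t = (z t - w t) \<bullet> (z t - w t)" for t
  define d' where "d' t = 2 * ((z t - w t) \<bullet> (f (z t) - f (w t)))" for t
  have der: "(d has_real_derivative d' s) (at s)" if "s \<in> J" for s
  proof -
    have "((\<lambda>t. z t - w t) has_vector_derivative f (z s) - f (w s)) (at s)"
      by (rule has_vector_derivative_diff[OF z[OF that] w[OF that]])
    then have 1: "((\<lambda>t. z t - w t) has_derivative (\<lambda>h. h *\<^sub>R (f (z s) - f (w s)))) (at s)"
      by (simp add: has_vector_derivative_def)
    have 2: "(\<lambda>h. (z s - w s) \<bullet> (h *\<^sub>R (f (z s) - f (w s))) + (h *\<^sub>R (f (z s) - f (w s))) \<bullet> (z s - w s)) = (*) (d' s)"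
      by (simp add: fun_eq_iff d'_def inner_commute[of "f (z s) - f (w s)"])
    show ?thesis
      using has_derivative_inner[OF 1 1] unfolding 2 by (simp add: d_def[abs_def] has_field_derivative_def)
  qed
  have bd: "\<bar>d' s\<bar> \<le> 2 * L * d s" if "s \<in> J" for s
  proof -
    have "\<bar>(z s - w s) \<bullet> (f (z s) - f (w s))\<bar> \<le> norm (z s - w s) * norm (f (z s) - f (w s))"
      by (rule Cauchy_Schwarz_ineq2)
    also have "\<dots> \<le> norm (z s - w s) * (L * norm (z s - w s))"
      by (rule mult_left_mono[OF lip[OF that]]) simp
    finally show ?thesis by (simp add: d'_def d_def abs_mult dot_square_norm power2_eq_square mult_ac)
  qed
  have seg: "s \<in> J" if "min t t0 \<le> s" "s \<le> max t t0" for s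
    using J t t0(1) that unfolding is_interval_1 by (metis max_def min_def)
  have "d t \<le> 0"
  proof (cases "t0 \<le> t")
    case True
    have "d t0 * exp (- (2 * L) * t0) \<ge> d t * exp (- (2 * L) * t)"
    proof (rule DERIV_nonpos_imp_nonincreasing[OF True])
      fix s assume "t0 \<le> s" "s \<le> t"
      then have s: "s \<in> J" using seg True by auto
      have "((\<lambda>t. d t * exp (- (2 * L) * t)) has_real_derivative (d' s - 2 * L * d s) * exp (- (2 * L) * s)) (at s)"
        by (auto intro!: derivative_eq_intros der s simp: algebra_simps)
      moreover have "(d' s - 2 * L * d s) * exp (- (2 * L) * s) \<le> 0"
        using bd[OF s] by (intro mult_nonpos_nonneg) auto
      ultimately show "\<exists>y. ((\<lambda>t. d t * exp (- (2 * L) * t)) has_real_derivative y) (at s) \<and> y \<le> 0" by blast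
    qed
    then show ?thesis using t0(2) by (simp add: d_def mult_le_0_iff)
  next
    case False
    then have le: "t \<le> t0" by simp
    have "d t * exp (2 * L * t) \<le> d t0 * exp (2 * L * t0)"
    proof (rule DERIV_nonneg_imp_nondecreasing[OF le])
      fix s assume "t \<le> s" "s \<le> t0"
      then have s: "s \<in> J" using seg le by auto
      have "((\<lambda>t. d t * exp (2 * L * t)) has_real_derivative (d' s + 2 * L * d s) * exp (2 * L * s)) (at s)"
        by (auto intro!: derivative_eq_intros der s simp: algebra_simps)
      moreover have "(d' s + 2 * L * d s) * exp (2 * L * s) \<ge> 0"
        using bd[OF s] by (intro mult_nonneg_nonneg) auto
      ultimately show "\<exists>y. ((\<lambda>t. d t * exp (2 * L * t)) has_real_derivative y) (at s) \<and> y \<ge> 0" by blast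
    qed
    then show ?thesis using t0(2) by (simp add: d_def mult_le_0_iff)
  qed
  then show ?thesis
    by (simp add: d_def dot_square_norm)
qed

text \<open>By continuity both solutions stay for a short time in one ball on which f is
  Lipschitz.\<close>

lemma eventually_solutions_agree:
  fixes z w :: "real \<Rightarrow> 'a::euclidean_space"
  assumes f: "smooth_on S f" and S: "open S" "z t0 \<in> S" and I: "open I" "t0 \<in> I"
    and z: "\<And>t. t \<in> I \<Longrightarrow> (z has_vector_derivative f (z t)) (at t)"
    and w: "\<And>t. t \<in> I \<Longrightarrow> (w has_vector_derivative f (w t)) (at t)"
    and eq: "z t0 = w t0"
  shows "\<exists>\<delta>>0. ball t0 \<delta> \<subseteq> I \<and> (\<forall>t\<in>ball t0 \<delta>. z t = w t)"
proof -
  obtain R where R: "R > 0" "cball (z t0) R \<subseteq> S"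
    using S by (auto simp: open_contains_cball)
  obtain L M where L: "\<And>x. x \<in> cball (z t0) R \<Longrightarrow> onorm (frechet_derivative f (at x)) \<le> L"
    by (rule smooth_on_compact_bounds[OF f compact_cball R(2)]) blast
  have c: "isCont z t0" "isCont w t0"
    using has_vector_derivative_continuous[OF z[OF I(2)]] has_vector_derivative_continuous[OF w[OF I(2)]] by auto
  obtain \<delta>1 where \<delta>1: "\<delta>1 > 0" "\<And>t. dist t t0 < \<delta>1 \<Longrightarrow> dist (z t) (z t0) < R"
    using c(1) R(1) by (auto simp: continuous_at_eps_delta)
  obtain \<delta>2 where \<delta>2: "\<delta>2 > 0" "\<And>t. dist t t0 < \<delta>2 \<Longrightarrow> dist (w t) (w t0) < R"
    using c(2) R(1) by (auto simp: continuous_at_eps_delta)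
  obtain \<delta>3 where \<delta>3: "\<delta>3 > 0" "ball t0 \<delta>3 \<subseteq> I" using I by (auto simp: open_contains_ball)
  define \<delta> where "\<delta> = min \<delta>1 (min \<delta>2 \<delta>3)"
  have \<delta>: "\<delta> > 0" "ball t0 \<delta> \<subseteq> I" using \<delta>1 \<delta>2 \<delta>3 by (auto simp: \<delta>_def)
  have "z t = w t" if "t \<in> ball t0 \<delta>" for t
  proof (rule lipschitz_solutions_agree[of "ball t0 \<delta>" z f w L t0 t])
    show "norm (f (z t) - f (w t)) \<le> L * norm (z t - w t)" if "t \<in> ball t0 \<delta>" for t
    proof (rule smooth_on_lipschitz_cball[OF f R(2) L])
      show "z t \<in> cball (z t0) R" "w t \<in> cball (z t0) R"
        using \<delta>1(2)[of t] \<delta>2(2)[of t] that eq by (auto simp: \<delta>_def dist_commute)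
    qed
  qed (use \<delta> that z w eq in \<open>auto intro: is_interval_ball_real\<close>)
  then show ?thesis using \<delta> by blast
qed

subsection \<open>Geodesics\<close>

lemma has_vector_derivative_vecI:
  fixes x :: "real \<Rightarrow> real^'n"
  assumes "\<And>i. ((\<lambda>s. x s $ i) has_real_derivative d $ i) (at t)"
  shows "(x has_vector_derivative d) (at t)"
proof -
  have "((\<lambda>s. \<Sum>i\<in>UNIV. (x s $ i) *\<^sub>R (axis i 1 :: real^'n)) has_vector_derivative
      (\<Sum>i\<in>UNIV. (d $ i) *\<^sub>R (axis i 1 :: real^'n))) (at t)"
    using has_vector_derivative_scaleR[OF assms has_vector_derivative_const]
    by (intro has_vector_derivative_sum) simp
  then show ?thesis by (simp flip: vec_eq_sum_axis)
qed

lemma has_vector_derivative_linear_family: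
  fixes T :: "'a::euclidean_space \<Rightarrow> real^'n \<Rightarrow> 'b::real_normed_vector"
  assumes S: "open S" and T: "\<And>v. smooth_on S (\<lambda>x. T x v)" and l: "\<And>x. x \<in> S \<Longrightarrow> linear (T x)" and t: "x t \<in> S"
    and x: "(x has_vector_derivative x') (at t)" and h: "(h has_vector_derivative h') (at t)"
  shows "((\<lambda>s. T (x s) (h s)) has_vector_derivative
    frechet_derivative (\<lambda>y. T y (h t)) (at (x t)) x' + T (x t) h') (at t)"
proof -
  let ?f = "\<lambda>z. T (fst z) (snd z)"
  have d: "?f differentiable (at (x t, h t))"
    by (rule smooth_on_imp_differentiable[OF smooth_on_linear_family[OF S T l]]) (use t in auto)
  have p: "((\<lambda>s. (x s, h s)) has_derivative (\<lambda>r. r *\<^sub>R (x', h'))) (at t)"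
    using has_vector_derivative_Pair[OF x h] by (simp add: has_vector_derivative_def)
  have "((\<lambda>s. ?f (x s, h s)) has_derivative (\<lambda>r. frechet_derivative ?f (at (x t, h t)) (r *\<^sub>R (x', h')))) (at t)"
    by (rule has_derivative_compose[OF p]) (use d in \<open>simp only: frechet_derivative_works\<close>)
  then show ?thesis
    unfolding linear_cmul[OF linear_frechet_derivative[OF d]] has_vector_derivative_def
    using frechet_derivative_linear_family[of S T "x t" "h t" x' h', OF S T l t] by simp
qed

section \<open>Velocities of curves in charts\<close>

lemma (in smooth_atlas) curve_chart_neighbourhood:
  assumes "open I" "t \<in> I" "continuous_on I \<gamma>" "c \<in> A" "\<gamma> t \<in> cdom c"
  shows "\<exists>J. open J \<and> t \<in> J \<and> J \<subseteq> I \<and> (\<forall>s\<in>J. \<gamma> s \<in> cdom c)"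
  using continuous_open_preimage[OF assms(3,1) open_cdom[OF assms(4)]] assms
  by (intro exI[of _ "I \<inter> \<gamma> -` cdom c"]) auto

lemma (in smooth_atlas) curve_derivative_dvec:
  assumes I: "open I" "t \<in> I" "continuous_on I \<gamma>" and c: "c \<in> A" "\<gamma> t \<in> cdom c"
    and x: "((\<lambda>s. cmap c (\<gamma> s)) has_vector_derivative \<eta>) (at t)" and f: "smooth_near A (\<gamma> t) f"
  shows "((\<lambda>s. f (\<gamma> s)) has_real_derivative dvec A c (\<gamma> t) \<eta> f) (at t)"
proof -
  let ?D = "frechet_derivative (f \<circ> cinv c) (at (cmap c (\<gamma> t)))"
  obtain J where J: "open J" "t \<in> J" "\<And>s. s \<in> J \<Longrightarrow> \<gamma> s \<in> cdom c"
    using curve_chart_neighbourhood[OF I c] by blast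
  have d: "(f \<circ> cinv c) differentiable (at (cmap c (\<gamma> t)))"
    by (rule smooth_near_differentiable[OF f c])
  have x': "((\<lambda>s. cmap c (\<gamma> s)) has_derivative (\<lambda>h. h *\<^sub>R \<eta>)) (at t)"
    using x by (simp add: has_vector_derivative_def)
  have "((\<lambda>s. (f \<circ> cinv c) (cmap c (\<gamma> s))) has_derivative (\<lambda>h. ?D (h *\<^sub>R \<eta>))) (at t)"
    by (rule has_derivative_compose[OF x']) (use d in \<open>simp only: frechet_derivative_works\<close>)
  then have "((\<lambda>s. (f \<circ> cinv c) (cmap c (\<gamma> s))) has_real_derivative ?D \<eta>) (at t)"
    by (simp add: has_field_derivative_def linear_cmul[OF linear_frechet_derivative[OF d]] mult_commute_abs)
  then have "((\<lambda>s. f (\<gamma> s)) has_real_derivative ?D \<eta>) (at t)"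
    by (rule has_field_derivative_transform_within_open[OF _ J(1,2)]) (simp add: cinv_cmap[OF c(1)] J(3))
  then show ?thesis using f by (simp add: dvec_def)
qed

lemma (in smooth_atlas) dvec_coord:
  "c \<in> A \<Longrightarrow> p \<in> cdom c \<Longrightarrow> dvec A c p \<eta> (\<lambda>q. cmap c q $ i) = \<eta> $ i"
  using components_dvec[of c p \<eta>] by (simp add: components_def vec_eq_iff)

context invariant_frame
begin

text \<open>Chart-free form of the geodesic equation: \<open>\<gamma>\<close> has velocity \<open>\<Sum>k. u\<^sub>k e\<^sub>k\<close>, tested against smooth
  functions, and \<open>u\<close> solves the Euler--Arnold equation.  Left translations act on such pairs.\<close>

definition framed :: "real set \<Rightarrow> (real \<Rightarrow> 'a) \<Rightarrow> (real \<Rightarrow> real^'n) \<Rightarrow> bool" where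
  "framed I \<gamma> u \<longleftrightarrow> open I \<and> continuous_on I \<gamma> \<and>
     (\<forall>t\<in>I. (u has_vector_derivative - \<omega> (u t) (u t)) (at t) \<and>
        (\<forall>f. smooth_near A (\<gamma> t) f \<longrightarrow>
           ((\<lambda>s. f (\<gamma> s)) has_real_derivative (\<Sum>k\<in>UNIV. u t $ k * e k (\<gamma> t) f)) (at t)))"

lemma framed_open: "framed I \<gamma> u \<Longrightarrow> open I"
  and framed_continuous: "framed I \<gamma> u \<Longrightarrow> continuous_on I \<gamma>"
  and framed_frame_derivative: "framed I \<gamma> u \<Longrightarrow> t \<in> I \<Longrightarrow> (u has_vector_derivative - \<omega> (u t) (u t)) (at t)"
  and framed_curve_derivative: "framed I \<gamma> u \<Longrightarrow> t \<in> I \<Longrightarrow> smooth_near A (\<gamma> t) f \<Longrightarrow>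
     ((\<lambda>s. f (\<gamma> s)) has_real_derivative (\<Sum>k\<in>UNIV. u t $ k * e k (\<gamma> t) f)) (at t)"
  by (simp_all add: framed_def)

lemma framed_local:
  assumes I: "open I"
    and loc: "\<And>t. t \<in> I \<Longrightarrow> \<exists>J \<gamma>' u'. framed J \<gamma>' u' \<and> t \<in> J \<and> (\<forall>s\<in>J. \<gamma>' s = \<gamma> s \<and> u' s = u s)"
  shows "framed I \<gamma> u"
  unfolding framed_def
proof (intro conjI I ballI allI impI)
  have "isCont \<gamma> t" if tI: "t \<in> I" for t
  proof -
    obtain J \<gamma>' u' where J: "framed J \<gamma>' u'" "t \<in> J" "\<forall>s\<in>J. \<gamma>' s = \<gamma> s \<and> u' s = u s"
      using loc[OF tI] by blast
    have "continuous_on J \<gamma>"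
      using framed_continuous[OF J(1)] J(3) by (simp cong: continuous_on_cong)
    then show ?thesis using framed_open[OF J(1)] J(2) by (simp add: continuous_on_eq_continuous_at)
  qed
  then show "continuous_on I \<gamma>" by (simp add: continuous_at_imp_continuous_on)
  fix t assume t: "t \<in> I"
  obtain J \<gamma>' u' where J: "framed J \<gamma>' u'" "t \<in> J" "\<forall>s\<in>J. \<gamma>' s = \<gamma> s \<and> u' s = u s"
    using loc[OF t] by blast
  note o = framed_open[OF J(1)]
  show "(u has_vector_derivative - \<omega> (u t) (u t)) (at t)"
    using has_vector_derivative_transform_within_open[OF framed_frame_derivative[OF J(1,2)] o J(2), of u] J(2,3) by auto
  fix f assume "smooth_near A (\<gamma> t) f"
  then show "((\<lambda>s. f (\<gamma> s)) has_real_derivative (\<Sum>k\<in>UNIV. u t $ k * e k (\<gamma> t) f)) (at t)"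
    using has_field_derivative_transform_within_open[OF framed_curve_derivative[OF J(1,2)] o J(2), of f "\<lambda>s. f (\<gamma> s)"] J(2,3)
    by auto
qed

lemma framed_subset: "framed I \<gamma> u \<Longrightarrow> open J \<Longrightarrow> J \<subseteq> I \<Longrightarrow> framed J \<gamma> u"
  using continuous_on_subset unfolding framed_def by blast

text \<open>The frame at the translated point is the image of the frame, and the equation for u does
  not mention the point, so u is unchanged.\<close>

lemma framed_translate:
  assumes "framed I \<gamma> u"
  shows "framed I (\<lambda>s. a \<otimes>\<^bsub>G\<^esub> \<gamma> s) u"
  unfolding framed_def
proof (intro conjI ballI allI impI)
  show "continuous_on I (\<lambda>s. a \<otimes>\<^bsub>G\<^esub> \<gamma> s)"
    by (rule continuous_on_compose2[OF continuous_on_left_translation[of UNIV] framed_continuous[OF assms]]) auto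
  fix t f assume t: "t \<in> I" and "smooth_near A (a \<otimes>\<^bsub>G\<^esub> \<gamma> t) f"
  from framed_curve_derivative[OF assms t smooth_near_left_translation[OF this(2)]]
  show "((\<lambda>s. f (a \<otimes>\<^bsub>G\<^esub> \<gamma> s)) has_real_derivative (\<Sum>k\<in>UNIV. u t $ k * e k (a \<otimes>\<^bsub>G\<^esub> \<gamma> t) f)) (at t)"
    by (simp add: frame_translate tangent_map_def comp_def)
qed (use assms in \<open>auto simp: framed_def\<close>)

lemma framed_shift:
  assumes "framed I \<gamma> u"
  shows "framed {s. s + h \<in> I} (\<lambda>s. \<gamma> (s + h)) (\<lambda>s. u (s + h))"
  unfolding framed_def
proof (intro conjI ballI allI impI)
  have "continuous_on UNIV (\<lambda>s. s + h)" by (intro continuous_intros)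
  from open_vimage[OF framed_open[OF assms] this] show "open {s. s + h \<in> I}" by (simp add: vimage_def)
  show "continuous_on {s. s + h \<in> I} (\<lambda>s. \<gamma> (s + h))"
    by (rule continuous_on_compose2[OF framed_continuous[OF assms]]) (auto intro!: continuous_intros)
  fix t assume t: "t \<in> {s. s + h \<in> I}"
  have "((\<lambda>s. s + h) has_vector_derivative 1) (at t)" by (auto intro!: derivative_eq_intros)
  from vector_diff_chain_at[OF this framed_frame_derivative[OF assms]] t
  show "((\<lambda>s. u (s + h)) has_vector_derivative - \<omega> (u (t + h)) (u (t + h))) (at t)" by (simp add: comp_def)
  fix f assume "smooth_near A (\<gamma> (t + h)) f"
  then show "((\<lambda>s. f (\<gamma> (s + h))) has_real_derivative (\<Sum>k\<in>UNIV. u (t + h) $ k * e k (\<gamma> (t + h)) f)) (at t)"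
    using framed_curve_derivative[OF assms, of "t + h" f] t by (simp add: DERIV_shift)
qed

text \<open>The derivative of |u|^2 is -2 times the product of u and \<omega> u u, which is 0 by
  skewness. Thus a bound on the initial velocity persists for all restarts.\<close>

lemma framed_norm_constant:
  assumes "framed I \<gamma> u" "connected I" "s \<in> I" "t \<in> I"
  shows "norm (u s) = norm (u t)"
proof -
  have "((\<lambda>t. u t \<bullet> u t) has_derivative (\<lambda>h. 0)) (at r)" if "r \<in> I" for r
  proof -
    have 1: "(u has_derivative (\<lambda>h. h *\<^sub>R - \<omega> (u r) (u r))) (at r)"
      using framed_frame_derivative[OF assms(1) that] by (simp add: has_vector_derivative_def)
    from has_derivative_inner[OF 1 1] show ?thesis
      by (simp add: skew_\<omega> inner_commute[of "\<omega> (u r) (u r)"])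
  qed
  from has_derivative_zero_unique_connected[OF framed_open[OF assms(1)] assms(2) this assms(3,4)]
  show ?thesis by (simp add: norm_eq)
qed

end

section \<open>The geodesic system in a chart\<close>

context invariant_frame_chart
begin

definition geodesic_field :: "(real^'n) \<times> (real^'n) \<Rightarrow> (real^'n) \<times> (real^'n)" where
  "geodesic_field z = (fr (fst z) (snd z), - \<omega> (snd z) (snd z))"

lemma open_phase: "open (\<Omega> \<times> (UNIV :: (real^'n) set))"
  by (intro open_Times open_\<Omega>) auto

lemma smooth_geodesic_field: "smooth_on (\<Omega> \<times> UNIV) geodesic_field"
proof -
  have "smooth_on (\<Omega> \<times> UNIV) (\<lambda>z. \<omega> (snd z) (snd z))"
    by (intro smooth_on_bilinear[OF bounded_bilinear_\<omega> open_phase] smooth_on_bounded_linear bounded_linear_snd)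
  then have "smooth_on (\<Omega> \<times> UNIV) (\<lambda>z. - \<omega> (snd z) (snd z))"
    by (rule smooth_on_linear_compose[OF bounded_linear_minus[OF bounded_linear_ident] open_phase])
  then show ?thesis
    unfolding geodesic_field_def
    by (rule smooth_on_Pair[OF open_phase smooth_on_linear_family[OF open_\<Omega> smooth_fr linear_fr]])
qed

lemma framed_chart_derivative:
  assumes "framed I \<gamma> u" "t \<in> I" "\<gamma> t \<in> cdom c"
  shows "((\<lambda>s. cmap c (\<gamma> s)) has_vector_derivative fr (cmap c (\<gamma> t)) (u t)) (at t)"
proof (rule has_vector_derivative_vecI)
  fix i
  have x: "cmap c (\<gamma> t) \<in> \<Omega>" using assms(3) by simp
  have "(\<Sum>k\<in>UNIV. u t $ k * e k (\<gamma> t) (\<lambda>q. cmap c q $ i)) = fr (cmap c (\<gamma> t)) (u t) $ i"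
    using fun_cong[OF randers_field_dvec[OF x, of "u t"], of "\<lambda>q. cmap c q $ i"]
    by (simp add: cinv_cmap[OF c assms(3)] dvec_coord[OF c assms(3)])
  then show "((\<lambda>s. cmap c (\<gamma> s) $ i) has_real_derivative fr (cmap c (\<gamma> t)) (u t) $ i) (at t)"
    using framed_curve_derivative[OF assms(1,2) smooth_near_coord[OF c assms(3)], of i] by simp
qed

lemma framed_geodesic_field:
  assumes "framed I \<gamma> u" "t \<in> I" "\<gamma> t \<in> cdom c"
  shows "((\<lambda>s. (cmap c (\<gamma> s), u s)) has_vector_derivative geodesic_field (cmap c (\<gamma> t), u t)) (at t)"
  using has_vector_derivative_Pair[OF framed_chart_derivative[OF assms] framed_frame_derivative[OF assms(1,2)]]
  by (simp add: geodesic_field_def)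

lemma curve_derivative_frame:
  assumes "open I" "t \<in> I" "continuous_on I \<gamma>" "\<gamma> t \<in> cdom c"
    and "((\<lambda>s. cmap c (\<gamma> s)) has_vector_derivative fr (cmap c (\<gamma> t)) v) (at t)" and "smooth_near A (\<gamma> t) f"
  shows "((\<lambda>s. f (\<gamma> s)) has_real_derivative (\<Sum>k\<in>UNIV. v $ k * e k (\<gamma> t) f)) (at t)"
  using curve_derivative_dvec[OF assms(1-3) c assms(4-6)]
    fun_cong[OF randers_field_dvec[of "cmap c (\<gamma> t)" v], of f] assms(4)
  by (simp add: cinv_cmap[OF c])

end

section \<open>Uniqueness, gluing and global existence of framed curves\<close>

context invariant_frame
begin

text \<open>The set of times of agreement is open by local uniqueness in a chart, its complement is
  open too, and the common interval is connected.\<close>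

lemma framed_unique:
  assumes F: "framed I \<gamma> u" "framed J \<gamma>' u'" and conn: "connected (I \<inter> J)"
    and t0: "t0 \<in> I \<inter> J" "\<gamma> t0 = \<gamma>' t0" "u t0 = u' t0" and t: "t \<in> I \<inter> J"
  shows "\<gamma> t = \<gamma>' t \<and> u t = u' t"
proof -
  let ?K = "I \<inter> J"
  define E where "E = {t \<in> ?K. \<gamma> t = \<gamma>' t \<and> u t = u' t}"
  have oK: "open ?K" using F by (intro open_Int framed_open)
  have c\<gamma>: "continuous_on ?K \<gamma>" "continuous_on ?K \<gamma>'"
    using framed_continuous[OF F(1)] framed_continuous[OF F(2)] by (auto intro: continuous_on_subset)
  have "\<forall>t\<in>I. isCont u t" "\<forall>t\<in>J. isCont u' t"
    using framed_frame_derivative[OF F(1)] framed_frame_derivative[OF F(2)]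
    by (auto intro: has_vector_derivative_continuous)
  then have cu: "continuous_on ?K u" "continuous_on ?K u'"
    by (auto intro!: continuous_at_imp_continuous_on)
  have "open E"
    unfolding open_contains_ball
  proof
    fix t1 assume t1: "t1 \<in> E"
    obtain c where cp: "c \<in> A" "\<gamma> t1 \<in> cdom c" by (rule chart_at)
    interpret invariant_frame_chart G A e g \<omega> b c by unfold_locales (rule cp)
    have t1K: "t1 \<in> ?K" "\<gamma>' t1 = \<gamma> t1" "u' t1 = u t1" using t1 by (auto simp: E_def)
    obtain J1 where J1: "open J1" "t1 \<in> J1" "J1 \<subseteq> ?K" "\<forall>s\<in>J1. \<gamma> s \<in> cdom c"
      using curve_chart_neighbourhood[OF oK t1K(1) c\<gamma>(1) cp] by blast
    obtain J2 where J2: "open J2" "t1 \<in> J2" "J2 \<subseteq> ?K" "\<forall>s\<in>J2. \<gamma>' s \<in> cdom c"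
      using curve_chart_neighbourhood[OF oK t1K(1) c\<gamma>(2) cp(1)] cp(2) t1K(2) by auto
    have "\<exists>\<delta>>0. ball t1 \<delta> \<subseteq> J1 \<inter> J2 \<and> (\<forall>t\<in>ball t1 \<delta>. (cmap c (\<gamma> t), u t) = (cmap c (\<gamma>' t), u' t))"
    proof (rule eventually_solutions_agree[OF smooth_geodesic_field open_phase])
      show "open (J1 \<inter> J2)" using J1 J2 by auto
      show "((\<lambda>t. (cmap c (\<gamma> t), u t)) has_vector_derivative geodesic_field (cmap c (\<gamma> t), u t)) (at t)"
        if "t \<in> J1 \<inter> J2" for t by (rule framed_geodesic_field[OF F(1)]) (use that J1 in auto)
      show "((\<lambda>t. (cmap c (\<gamma>' t), u' t)) has_vector_derivative geodesic_field (cmap c (\<gamma>' t), u' t)) (at t)"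
        if "t \<in> J1 \<inter> J2" for t by (rule framed_geodesic_field[OF F(2)]) (use that J2 in auto)
    qed (use t1K J1 J2 cp in auto)
    then obtain \<delta> where \<delta>: "\<delta> > 0" "ball t1 \<delta> \<subseteq> J1 \<inter> J2"
        "\<And>t. t \<in> ball t1 \<delta> \<Longrightarrow> cmap c (\<gamma> t) = cmap c (\<gamma>' t) \<and> u t = u' t" by auto
    have "ball t1 \<delta> \<subseteq> E"
    proof
      fix t assume t: "t \<in> ball t1 \<delta>"
      then have "\<gamma> t \<in> cdom c" "\<gamma>' t \<in> cdom c" "t \<in> ?K" using \<delta>(2) J1 J2 by auto
      moreover from this have "\<gamma> t = \<gamma>' t" using \<delta>(3)[OF t] cinv_cmap[OF cp(1)] by metis
      ultimately show "t \<in> E" using \<delta>(3)[OF t] by (simp add: E_def)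
    qed
    then show "\<exists>\<delta>>0. ball t1 \<delta> \<subseteq> E" using \<delta>(1) by blast
  qed
  \<comment> \<open>This is where the Hausdorff property of the group enters.\<close>
  moreover have "open (?K - E)"
  proof -
    have "open {z :: ('a \<times> (real^'n)) \<times> ('a \<times> (real^'n)). fst z \<noteq> snd z}"
      by (intro open_Collect_neq continuous_intros)
    moreover have "continuous_on ?K (\<lambda>t. ((\<gamma> t, u t), (\<gamma>' t, u' t)))"
      by (intro continuous_on_Pair c\<gamma> cu)
    ultimately have "open (?K \<inter> (\<lambda>t. ((\<gamma> t, u t), (\<gamma>' t, u' t))) -` {z. fst z \<noteq> snd z})"
      by (intro continuous_open_preimage oK)
    moreover have "?K \<inter> (\<lambda>t. ((\<gamma> t, u t), (\<gamma>' t, u' t))) -` {z. fst z \<noteq> snd z} = ?K - E"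
      by (auto simp: E_def)
    ultimately show ?thesis by simp
  qed
  ultimately have "E \<inter> ?K = {} \<or> (?K - E) \<inter> ?K = {}"
    by (intro connectedD[OF conn]) auto
  moreover have "t0 \<in> E \<inter> ?K" using t0 by (simp add: E_def)
  ultimately show ?thesis using t by (auto simp: E_def)
qed

lemma framed_glue:
  assumes F: "framed I \<gamma> u" "framed J \<gamma>' u'" and conn: "connected (I \<inter> J)"
    and t0: "t0 \<in> I \<inter> J" "\<gamma> t0 = \<gamma>' t0" "u t0 = u' t0"
  shows "framed (I \<union> J) (\<lambda>t. if t \<in> I then \<gamma> t else \<gamma>' t) (\<lambda>t. if t \<in> I then u t else u' t)"
proof (rule framed_local)
  show "open (I \<union> J)" using F by (intro open_Un framed_open)
  fix t assume "t \<in> I \<union> J"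
  then show "\<exists>J' \<gamma>'' u''. framed J' \<gamma>'' u'' \<and> t \<in> J' \<and>
     (\<forall>s\<in>J'. \<gamma>'' s = (if s \<in> I then \<gamma> s else \<gamma>' s) \<and> u'' s = (if s \<in> I then u s else u' s))"
  proof
    assume "t \<in> I"
    then show ?thesis using F(1) by (intro exI[of _ I] exI[of _ \<gamma>] exI[of _ u]) auto
  next
    assume "t \<in> J"
    then show ?thesis using F(2) framed_unique[OF F conn t0]
      by (intro exI[of _ J] exI[of _ \<gamma>'] exI[of _ u']) auto
  qed
qed

text \<open>T is common to all starting points and to all initial velocities of norm at most r; this
  uniformity is what allows repeated extension.\<close>

definition extends_to :: "real \<Rightarrow> real \<Rightarrow> bool" where
  "extends_to r T \<longleftrightarrow> (\<forall>p u0. norm u0 \<le> r \<longrightarrow>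
     (\<exists>\<gamma> u. framed {-T<..<T} \<gamma> u \<and> \<gamma> 0 = p \<and> u 0 = u0))"

text \<open>Initial data at the identity with |u| <= r form a compact set in a single chart, hence
  have a common time. Left translation transports it to every starting point.\<close>

lemma extends_locally:
  assumes r: "0 \<le> r"
  shows "\<exists>\<epsilon>>0. extends_to r \<epsilon>"
proof -
  obtain c where cp: "c \<in> A" "\<one>\<^bsub>G\<^esub> \<in> cdom c" by (rule chart_at)
  have x1: "cmap c \<one>\<^bsub>G\<^esub> \<in> cimg c" using cp(2) by (rule imageI)
  interpret invariant_frame_chart G A e g \<omega> b c by unfold_locales (rule cp)
  have "\<exists>\<epsilon>>0. \<forall>z0\<in>{cmap c \<one>\<^bsub>G\<^esub>} \<times> cball 0 r. \<exists>z. z 0 = z0 \<and>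
     (\<forall>t\<in>{-\<epsilon><..<\<epsilon>}. z t \<in> \<Omega> \<times> UNIV \<and> (z has_vector_derivative geodesic_field (z t)) (at t))"
    by (rule local_solution_uniform[OF smooth_geodesic_field open_phase])
      (use r x1 in \<open>auto intro: compact_Times\<close>)
  then obtain \<epsilon> where \<epsilon>: "\<epsilon> > 0" and sol: "\<And>z0. z0 \<in> {cmap c \<one>\<^bsub>G\<^esub>} \<times> cball 0 r \<Longrightarrow> \<exists>z. z 0 = z0 \<and>
     (\<forall>t\<in>{-\<epsilon><..<\<epsilon>}. z t \<in> \<Omega> \<times> UNIV \<and> (z has_vector_derivative geodesic_field (z t)) (at t))"
    by blast
  have "extends_to r \<epsilon>"
    unfolding extends_to_def
  proof (intro allI impI)
    fix p u0 assume u0: "norm (u0 :: real^'n) \<le> r"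
    let ?I = "{-\<epsilon><..<\<epsilon>}"
    have "(cmap c \<one>\<^bsub>G\<^esub>, u0) \<in> {cmap c \<one>\<^bsub>G\<^esub>} \<times> cball 0 r" using u0 by simp
    from sol[OF this] obtain z where z: "z 0 = (cmap c \<one>\<^bsub>G\<^esub>, u0)" "\<And>t. t \<in> ?I \<Longrightarrow> fst (z t) \<in> \<Omega>"
      "\<And>t. t \<in> ?I \<Longrightarrow> (z has_vector_derivative geodesic_field (z t)) (at t)" by (auto simp: mem_Times_iff)
    define \<gamma> where "\<gamma> t = cinv c (fst (z t))" for t
    define u where "u t = snd (z t)" for t
    have d1: "((\<lambda>t. fst (z t)) has_vector_derivative fr (fst (z t)) (u t)) (at t)"
      and d2: "(u has_vector_derivative - \<omega> (u t) (u t)) (at t)" if "t \<in> ?I" for t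
      using bounded_linear.has_vector_derivative[OF bounded_linear_fst z(3)[OF that]]
        bounded_linear.has_vector_derivative[OF bounded_linear_snd z(3)[OF that]]
      by (simp_all add: geodesic_field_def u_def[abs_def])
    have "continuous_on ?I (\<lambda>t. fst (z t))"
      by (intro continuous_at_imp_continuous_on ballI has_vector_derivative_continuous[OF d1])
    then have cont: "continuous_on ?I \<gamma>"
      unfolding \<gamma>_def by (rule continuous_on_compose2[OF continuous_on_cinv[OF cp(1)]]) (use z(2) in auto)
    have dom: "\<gamma> t \<in> cdom c" and cm: "cmap c (\<gamma> t) = fst (z t)" if "t \<in> ?I" for t
      unfolding \<gamma>_def by (rule cinv_in_cdom[OF cp(1) z(2)[OF that]] cmap_cinv[OF cp(1) z(2)[OF that]])+
    have "framed ?I \<gamma> u"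
      unfolding framed_def
    proof (intro conjI ballI allI impI open_greaterThanLessThan cont d2)
      fix t f assume t: "t \<in> ?I" and f: "smooth_near A (\<gamma> t) f"
      have "((\<lambda>s. cmap c (\<gamma> s)) has_vector_derivative fr (cmap c (\<gamma> t)) (u t)) (at t)"
        unfolding cm[OF t]
        by (rule has_vector_derivative_transform_within_open[OF d1[OF t] open_greaterThanLessThan t]) (simp add: cm)
      then show "((\<lambda>s. f (\<gamma> s)) has_real_derivative (\<Sum>k\<in>UNIV. u t $ k * e k (\<gamma> t) f)) (at t)"
        by (rule curve_derivative_frame[OF open_greaterThanLessThan t cont dom[OF t] _ f])
    qed
    from framed_translate[OF this, of p]
    have "framed ?I (\<lambda>s. p \<otimes>\<^bsub>G\<^esub> \<gamma> s) u" .
    moreover have "p \<otimes>\<^bsub>G\<^esub> \<gamma> 0 = p"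
      using monoid.r_one[OF group.is_monoid[OF group]] by (simp add: \<gamma>_def z(1) cinv_cmap[OF cp] carrier_UNIV)
    moreover have "u 0 = u0" by (simp add: u_def z(1))
    ultimately show "\<exists>\<gamma> u. framed ?I \<gamma> u \<and> \<gamma> 0 = p \<and> u 0 = u0" by blast
  qed
  then show ?thesis using \<epsilon> by blast
qed

text \<open>At T/2 and -T/2 the speed is still at most r, so a solution of half-length T can be
  restarted at each; glued together they reach T/2 + T on both sides.\<close>

lemma extends_further:
  assumes T: "T > 0" and P: "extends_to r T"
  shows "extends_to r (3/2 * T)"
  unfolding extends_to_def
proof (intro allI impI)
  fix p and u0 :: "real^'n" assume u0: "norm u0 \<le> r"
  obtain \<gamma> u where F: "framed {-T<..<T} \<gamma> u" and i: "\<gamma> 0 = p" "u 0 = u0"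
    using P u0 unfolding extends_to_def by blast
  have nrm: "norm (u t) \<le> r" if "t \<in> {-T<..<T}" for t
    using framed_norm_constant[OF F connected_Ioo that, of 0] T i u0 by auto
  have *: "\<exists>\<gamma>' u'. framed {h - T<..<h + T} \<gamma>' u' \<and> \<gamma>' h = \<gamma> h \<and> u' h = u h" if h: "h \<in> {-T<..<T}" for h
  proof -
    obtain \<gamma>' u' where F': "framed {-T<..<T} \<gamma>' u'" and i': "\<gamma>' 0 = \<gamma> h" "u' 0 = u h"
      using P nrm[OF h] unfolding extends_to_def by blast
    have "{s. s + - h \<in> {-T<..<T}} = {h - T<..<h + T}" by auto
    then show ?thesis
      using framed_shift[OF F', of "- h"] i' by (intro exI[of _ "\<lambda>s. \<gamma>' (s + - h)"] exI[of _ "\<lambda>s. u' (s + - h)"]) simp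
  qed
  have Th: "T / 2 \<in> {-T<..<T}" "- (T / 2) \<in> {-T<..<T}" using T by auto
  obtain \<gamma>1 u1 where F1: "framed {T/2 - T<..<T/2 + T} \<gamma>1 u1" "\<gamma>1 (T/2) = \<gamma> (T/2)" "u1 (T/2) = u (T/2)"
    using *[OF Th(1)] by blast
  obtain \<gamma>2 u2 where F2: "framed {- (T/2) - T<..<- (T/2) + T} \<gamma>2 u2" "\<gamma>2 (- (T/2)) = \<gamma> (- (T/2))" "u2 (- (T/2)) = u (- (T/2))"
    using *[OF Th(2)] by blast
  let ?I = "{-T<..<T}" and ?J1 = "{T/2 - T<..<T/2 + T}" and ?J2 = "{- (T/2) - T<..<- (T/2) + T}"
  define \<gamma>3 where "\<gamma>3 t = (if t \<in> ?I then \<gamma> t else \<gamma>1 t)" for t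
  define u3 where "u3 t = (if t \<in> ?I then u t else u1 t)" for t
  have F3: "framed (?I \<union> ?J1) \<gamma>3 u3"
    unfolding \<gamma>3_def u3_def
    by (rule framed_glue[OF F F1(1), of "T/2"]) (use T F1 in \<open>auto simp: Int_greaterThanLessThan connected_Ioo\<close>)
  have U: "?I \<union> ?J1 = {-T<..<3/2 * T}" using T by auto
  have "framed ({-T<..<3/2 * T} \<union> ?J2) (\<lambda>t. if t \<in> {-T<..<3/2 * T} then \<gamma>3 t else \<gamma>2 t)
      (\<lambda>t. if t \<in> {-T<..<3/2 * T} then u3 t else u2 t)"
    by (rule framed_glue[OF F3[unfolded U] F2(1), of "- (T/2)"])
      (use T F2 in \<open>auto simp: Int_greaterThanLessThan connected_Ioo \<gamma>3_def u3_def\<close>)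
  moreover have "{-T<..<3/2 * T} \<union> ?J2 = {- (3/2 * T)<..<3/2 * T}" using T by auto
  ultimately show "\<exists>\<gamma> u. framed {- (3/2 * T)<..<3/2 * T} \<gamma> u \<and> \<gamma> 0 = p \<and> u 0 = u0"
    using T i by (intro exI conjI, simp) (simp_all add: \<gamma>3_def u3_def)
qed

lemma extends_arbitrarily:
  assumes "0 \<le> r"
  shows "extends_to r T"
proof -
  obtain \<epsilon> where \<epsilon>: "\<epsilon> > 0" "extends_to r \<epsilon>" using extends_locally[OF assms] by blast
  have P: "extends_to r ((3/2)^n * \<epsilon>)" for n
  proof (induction n)
    case (Suc n)
    then show ?case using extends_further[of "(3/2)^n * \<epsilon>" r] \<epsilon>(1) by (simp add: mult.assoc)
  qed (use \<epsilon> in simp)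
  obtain n where n: "T / \<epsilon> < (3/2)^n" using real_arch_pow[of "3/2" "T / \<epsilon>"] by auto
  then have T: "T < (3/2)^n * \<epsilon>" using \<epsilon>(1) by (simp add: field_simps)
  then have sub: "{-T<..<T} \<subseteq> {-((3/2)^n * \<epsilon>)<..<(3/2)^n * \<epsilon>}" by auto
  show ?thesis
    unfolding extends_to_def
  proof (intro allI impI)
    fix p u0 assume "norm (u0 :: real^'n) \<le> r"
    then obtain \<gamma> u where "framed {-((3/2)^n * \<epsilon>)<..<(3/2)^n * \<epsilon>} \<gamma> u" "\<gamma> 0 = p" "u 0 = u0"
      using P[of n] unfolding extends_to_def by blast
    then show "\<exists>\<gamma> u. framed {-T<..<T} \<gamma> u \<and> \<gamma> 0 = p \<and> u 0 = u0"
      using framed_subset[OF _ open_greaterThanLessThan sub] by blast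
  qed
qed

lemma framed_global_existence:
  "\<exists>\<gamma> u. framed UNIV \<gamma> u \<and> \<gamma> t0 = p \<and> u t0 = u0"
proof -
  have "\<forall>T. \<exists>\<gamma> u. framed {-T<..<T} \<gamma> u \<and> \<gamma> 0 = p \<and> u 0 = u0"
    using extends_arbitrarily[OF norm_ge_zero] unfolding extends_to_def by blast
  then obtain \<gamma> u where sol: "\<And>T. framed {-T<..<T} (\<gamma> T) (u T)" "\<And>T. \<gamma> T 0 = p" "\<And>T. u T 0 = u0"
    by metis
  \<comment> \<open>The solution with T = |t| + 1 is certainly defined at t; by uniqueness the
    choice of T is immaterial.\<close>
  define \<gamma>' where "\<gamma>' t = \<gamma> (\<bar>t\<bar> + 1) t" for t
  define u' where "u' t = u (\<bar>t\<bar> + 1) t" for t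
  have "framed UNIV \<gamma>' u'"
  proof (rule framed_local[OF open_UNIV])
    fix t :: real
    let ?J = "{-(\<bar>t\<bar> + 1)<..<\<bar>t\<bar> + 1}"
    have "\<gamma> (\<bar>t\<bar> + 1) s = \<gamma>' s \<and> u (\<bar>t\<bar> + 1) s = u' s" if s: "s \<in> ?J" for s
      unfolding \<gamma>'_def u'_def
      by (rule framed_unique[OF sol(1) sol(1), where ?t0.0 = 0])
        (use s in \<open>auto simp: sol(2,3) Int_greaterThanLessThan connected_Ioo\<close>)
    then show "\<exists>J \<gamma>'' u''. framed J \<gamma>'' u'' \<and> t \<in> J \<and> (\<forall>s\<in>J. \<gamma>'' s = \<gamma>' s \<and> u'' s = u' s)"
      using sol(1)[of "\<bar>t\<bar> + 1"] by (intro exI[of _ ?J] exI[of _ "\<gamma> (\<bar>t\<bar> + 1)"] exI[of _ "u (\<bar>t\<bar> + 1)"]) auto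
  qed
  from framed_shift[OF this, of "- t0"] show ?thesis
    by (intro exI[of _ "\<lambda>s. \<gamma>' (s + - t0)"] exI[of _ "\<lambda>s. u' (s + - t0)"]) (simp add: \<gamma>'_def u'_def sol)
qed

text \<open>Frame components of the derivative of \<gamma>, independent of charts; the conditional
  reproduces the default value 0 of tangent vectors.\<close>

definition velocity :: "(real \<Rightarrow> 'a) \<Rightarrow> real \<Rightarrow> real^'n" where
  "velocity \<gamma> s = (\<chi> i. g (\<gamma> s) (e i (\<gamma> s)) (\<lambda>f. if smooth_near A (\<gamma> s) f then deriv (\<lambda>r. f (\<gamma> r)) s else 0))"

end

context invariant_frame_chart
begin

lemma velocity_eq:
  assumes "open I" "t \<in> I" "continuous_on I \<gamma>" "\<gamma> t \<in> cdom c"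
    and x: "((\<lambda>s. cmap c (\<gamma> s)) has_vector_derivative \<eta>) (at t)"
  shows "velocity \<gamma> t = \<theta> (cmap c (\<gamma> t)) \<eta>"
proof -
  have "(\<lambda>f. if smooth_near A (\<gamma> t) f then deriv (\<lambda>r. f (\<gamma> r)) t else 0) = dvec A c (\<gamma> t) \<eta>"
    using DERIV_imp_deriv[OF curve_derivative_dvec[OF assms(1-3) c assms(4) x]]
    by (auto simp: dvec_def)
  then show ?thesis by (simp add: velocity_def \<theta>_def cinv_cmap[OF c assms(4)])
qed

lemma \<theta>_curve_derivative:
  assumes "(x has_vector_derivative x') (at t)" "(h has_vector_derivative h') (at t)" "x t \<in> \<Omega>"
  shows "((\<lambda>s. \<theta> (x s) (h s)) has_vector_derivative d\<theta> (x t) x' (h t) + \<theta> (x t) h') (at t)"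
  unfolding d\<theta>_def
  by (rule has_vector_derivative_linear_family[OF open_\<Omega> smooth_\<theta> linear_\<theta> assms(3,1,2)])

text \<open>\<open>chern_eq\<close> holds for nonzero y. At y = 0 the coefficients are multiplied by
  zero components, which covers constant curves.\<close>

lemma geodesic_equation_rhs:
  assumes x: "x \<in> \<Omega>"
  shows "(\<chi> i. - (\<Sum>j\<in>UNIV. \<Sum>k\<in>UNIV. chern A F c i j k x y * y $ j * y $ k)) = - \<Gamma> x y y"
proof (cases "y = 0")
  case True
  have "\<Gamma> x 0 0 = 0" by (rule linear_0[OF linear_\<Gamma>[OF x]])
  then show ?thesis unfolding True by (simp add: vec_eq_iff)
next
  case False
  have "(\<Sum>j\<in>UNIV. \<Sum>k\<in>UNIV. chern A F c i j k x y * y $ j * y $ k) = \<Gamma> x y y $ i" for i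
  proof -
    have "(\<Sum>j\<in>UNIV. \<Sum>k\<in>UNIV. chern A F c i j k x y * y $ j * y $ k) =
        (\<Sum>j\<in>UNIV. y $ j * (\<Sum>k\<in>UNIV. y $ k * \<Gamma> x (axis k 1) (axis j 1) $ i))"
      by (simp add: chern_eq[OF x False] sum_distrib_left mult_ac)
    also have "\<dots> = (\<Sum>j\<in>UNIV. y $ j * \<Gamma> x (axis j 1) y $ i)"
      by (simp add: Gamma_scale_sum[OF x] sym_\<Gamma>[OF x, of y "axis _ 1"])
    finally show ?thesis by (simp add: Gamma_scale_sum[OF x])
  qed
  then show ?thesis by (simp add: vec_eq_iff)
qed

end

section \<open>Geodesics are framed curves, and completeness\<close>

context invariant_frame
begin

text \<open>Differentiating the frame components \<theta> x x' produces d\<theta> plus \<theta> of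
  the acceleration; inserting - \<Gamma> for the acceleration leaves - \<omega> u u.\<close>

lemma geodesic_imp_framed:
  assumes I: "open I" and geo: "geodesic A F I \<gamma>"
  shows "framed I \<gamma> (velocity \<gamma>)"
proof -
  have cont: "continuous_on I \<gamma>" using geo by (simp add: geodesic_def)
  have "(velocity \<gamma> has_vector_derivative - \<omega> (velocity \<gamma> t) (velocity \<gamma> t)) (at t) \<and>
     (\<forall>f. smooth_near A (\<gamma> t) f \<longrightarrow>
       ((\<lambda>s. f (\<gamma> s)) has_real_derivative (\<Sum>k\<in>UNIV. velocity \<gamma> t $ k * e k (\<gamma> t) f)) (at t))"
    if t: "t \<in> I" for t
  proof -
    obtain c where cp: "c \<in> A" "\<gamma> t \<in> cdom c" by (rule chart_at)
    have xt: "cmap c (\<gamma> t) \<in> cimg c" using cp(2) by (rule imageI)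
    interpret invariant_frame_chart G A e g \<omega> b c by unfold_locales (rule cp)
    define x where "x s = cmap c (\<gamma> s)" for s
    define x' where "x' s = vector_derivative x (at s)" for s
    have x_comp: "cmap c \<circ> \<gamma> = x" by (simp add: x_def fun_eq_iff)
    have ev: "\<forall>\<^sub>F s in nhds t. x differentiable (at s)"
      and x'': "(x' has_vector_derivative - \<Gamma> (x t) (x' t) (x' t)) (at t)"
    proof -
      have "(\<forall>\<^sub>F s in nhds t. (cmap c \<circ> \<gamma>) differentiable (at s)) \<and>
        ((\<lambda>s. vector_derivative (cmap c \<circ> \<gamma>) (at s)) has_vector_derivative
           (\<chi> i. - (\<Sum>j\<in>UNIV. \<Sum>k\<in>UNIV. chern A F c i j k ((cmap c \<circ> \<gamma>) t) (vector_derivative (cmap c \<circ> \<gamma>) (at t)) *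
            vector_derivative (cmap c \<circ> \<gamma>) (at t) $ j * vector_derivative (cmap c \<circ> \<gamma>) (at t) $ k))) (at t)"
        using geo t cp unfolding geodesic_def Let_def by blast
      moreover have "x t \<in> \<Omega>" using xt by (simp add: x_def)
      ultimately show "\<forall>\<^sub>F s in nhds t. x differentiable (at s)"
        and "(x' has_vector_derivative - \<Gamma> (x t) (x' t) (x' t)) (at t)"
        unfolding x_comp x'_def[abs_def] by (simp_all add: geodesic_equation_rhs)
    qed
    obtain J0 where J0: "open J0" "t \<in> J0" "\<And>s. s \<in> J0 \<Longrightarrow> x differentiable (at s)"
      using ev by (auto simp: eventually_nhds)
    obtain J1 where J1: "open J1" "t \<in> J1" "J1 \<subseteq> I" "\<And>s. s \<in> J1 \<Longrightarrow> \<gamma> s \<in> cdom c"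
      using curve_chart_neighbourhood[OF I t cont cp] by blast
    have xd: "(x has_vector_derivative x' s) (at s)" if "s \<in> J0" for s
      using J0(3)[OF that] by (simp add: x'_def vector_derivative_works)
    have vel: "velocity \<gamma> s = \<theta> (x s) (x' s)" if "s \<in> J0 \<inter> J1" for s
      unfolding x_def
      by (rule velocity_eq[OF I _ cont]) (use that J1 xd[of s] in \<open>auto simp: x_def[abs_def]\<close>)
    have "((\<lambda>s. \<theta> (x s) (x' s)) has_vector_derivative d\<theta> (x t) (x' t) (x' t) + \<theta> (x t) (- \<Gamma> (x t) (x' t) (x' t))) (at t)"
      by (rule \<theta>_curve_derivative[OF xd[OF J0(2)] x'']) (use xt in \<open>simp add: x_def\<close>)
    moreover have "d\<theta> (x t) (x' t) (x' t) + \<theta> (x t) (- \<Gamma> (x t) (x' t) (x' t)) = - \<omega> (velocity \<gamma> t) (velocity \<gamma> t)"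
      using xt J0 J1 by (simp add: vel x_def linear_neg[OF linear_\<theta>] \<theta>_\<Gamma>)
    ultimately have "((\<lambda>s. \<theta> (x s) (x' s)) has_vector_derivative - \<omega> (velocity \<gamma> t) (velocity \<gamma> t)) (at t)" by simp
    then have "(velocity \<gamma> has_vector_derivative - \<omega> (velocity \<gamma> t) (velocity \<gamma> t)) (at t)"
      by (rule has_vector_derivative_transform_within_open[of _ _ _ "J0 \<inter> J1"]) (use J0 J1 vel in auto)
    moreover have "((\<lambda>s. cmap c (\<gamma> s)) has_vector_derivative fr (cmap c (\<gamma> t)) (velocity \<gamma> t)) (at t)"
      using xd[OF J0(2)] J0(2) J1(2) xt by (simp add: vel fr_\<theta> x_def[abs_def])
    ultimately show ?thesis
      using curve_derivative_frame[OF I t cont cp(2)] by blast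
  qed
  then show ?thesis using I cont by (simp add: framed_def)
qed

text \<open>The chart velocity h is differentiable; computing the derivative of \<theta> x h both by
  the product rule and as u' identifies h' because \<theta> is injective.\<close>

lemma framed_imp_geodesic:
  assumes F: "framed I \<gamma> u"
  shows "geodesic A F I \<gamma>"
  unfolding geodesic_def Let_def
proof (intro conjI ballI impI)
  show cont: "continuous_on I \<gamma>" by (rule framed_continuous[OF F])
  fix t c assume t: "t \<in> I" and cp: "c \<in> A" "\<gamma> t \<in> cdom c"
  have xt: "cmap c (\<gamma> t) \<in> cimg c" using cp(2) by (rule imageI)
  interpret invariant_frame_chart G A e g \<omega> b c by unfold_locales (rule cp)
  define x where "x s = cmap c (\<gamma> s)" for s
  have x_comp: "cmap c \<circ> \<gamma> = x" by (simp add: x_def fun_eq_iff)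
  obtain J where J: "open J" "t \<in> J" "J \<subseteq> I" "\<And>s. s \<in> J \<Longrightarrow> \<gamma> s \<in> cdom c"
    using curve_chart_neighbourhood[OF framed_open[OF F] t cont cp] by blast
  have xd: "(x has_vector_derivative fr (x s) (u s)) (at s)" if "s \<in> J" for s
    using framed_chart_derivative[OF F, of s] J that by (auto simp: x_def[abs_def])
  then have vd: "vector_derivative x (at s) = fr (x s) (u s)" if "s \<in> J" for s
    using that by (simp add: vector_derivative_at)
  have "x differentiable (at s)" if "s \<in> J" for s
    using xd[OF that] by (auto simp: has_vector_derivative_def differentiable_def)
  then show "\<forall>\<^sub>F s in nhds t. (cmap c \<circ> \<gamma>) differentiable (at s)"
    unfolding x_comp using J by (auto simp: eventually_nhds)
  define h where "h s = fr (x s) (u s)" for s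
  have xt': "x t \<in> \<Omega>" using xt by (simp add: x_def)
  have "\<exists>h'. (h has_vector_derivative h') (at t)"
    unfolding h_def
    using has_vector_derivative_linear_family[OF open_\<Omega> smooth_fr linear_fr xt' xd[OF J(2)] framed_frame_derivative[OF F t]]
    by blast
  then obtain h' where h': "(h has_vector_derivative h') (at t)" by blast
  have "((\<lambda>s. \<theta> (x s) (h s)) has_vector_derivative d\<theta> (x t) (h t) (h t) + \<theta> (x t) h') (at t)"
    using \<theta>_curve_derivative[OF xd[OF J(2)] h' xt'] by (simp add: h_def)
  moreover have "((\<lambda>s. \<theta> (x s) (h s)) has_vector_derivative - \<omega> (u t) (u t)) (at t)"
    by (rule has_vector_derivative_transform_within_open[OF framed_frame_derivative[OF F t] J(1,2)])
      (simp add: h_def x_def \<theta>_fr J(4))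
  ultimately have "d\<theta> (x t) (h t) (h t) + \<theta> (x t) h' = - \<omega> (u t) (u t)"
    by (rule vector_derivative_unique_at)
  moreover have "\<theta> (x t) (h t) = u t" by (simp add: h_def \<theta>_fr[OF xt'])
  ultimately have "\<theta> (x t) h' = \<theta> (x t) (- \<Gamma> (x t) (h t) (h t))"
    by (simp add: linear_neg[OF linear_\<theta>[OF xt']] \<theta>_\<Gamma>[OF xt'] algebra_simps add_eq_0_iff)
  then have "h' = - \<Gamma> (x t) (h t) (h t)" by (metis fr_\<theta>[OF xt'])
  then have hd: "(h has_vector_derivative - \<Gamma> (x t) (h t) (h t)) (at t)" using h' by simp
  have "((\<lambda>s. vector_derivative x (at s)) has_vector_derivative - \<Gamma> (x t) (h t) (h t)) (at t)"
    by (rule has_vector_derivative_transform_within_open[OF hd J(1,2)]) (simp add: vd h_def)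
  then show "((\<lambda>s. vector_derivative (cmap c \<circ> \<gamma>) (at s)) has_vector_derivative
       (\<chi> i. - (\<Sum>j\<in>UNIV. \<Sum>k\<in>UNIV. chern A F c i j k ((cmap c \<circ> \<gamma>) t) (vector_derivative (cmap c \<circ> \<gamma>) (at t)) *
          vector_derivative (cmap c \<circ> \<gamma>) (at t) $ j * vector_derivative (cmap c \<circ> \<gamma>) (at t) $ k))) (at t)"
    unfolding x_comp geodesic_equation_rhs[OF xt'] vd[OF J(2)] by (simp add: h_def)
qed

theorem complete: "geodesically_complete A F"
  unfolding geodesically_complete_def
proof (intro allI impI, elim conjE)
  fix I \<gamma> assume I: "open I" "is_interval I" and geo: "geodesic A F I \<gamma>"
  show "\<exists>\<gamma>'. geodesic A F UNIV \<gamma>' \<and> (\<forall>t\<in>I. \<gamma>' t = \<gamma> t)"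
  proof (cases "I = {}")
    \<comment> \<open>Nothing has to be matched, so any global geodesic will do.\<close>
    case True
    then show ?thesis using framed_global_existence framed_imp_geodesic by blast
  next
    case False
    then obtain t0 where t0: "t0 \<in> I" by blast
    note F = geodesic_imp_framed[OF I(1) geo]
    obtain \<gamma>' u' where F': "framed UNIV \<gamma>' u'" "\<gamma>' t0 = \<gamma> t0" "u' t0 = velocity \<gamma> t0"
      using framed_global_existence by blast
    have "\<gamma>' t = \<gamma> t" if "t \<in> I" for t
      using framed_unique[OF F'(1) F, of t0 t] I(2) F' t0 that by (simp add: is_interval_connected)
    then show ?thesis using framed_imp_geodesic[OF F'(1)] by blast
  qed
qed

end

subsection \<open>The four-dimensional group\<close>

context invariant_frame
begin

lemma metric_frame_combinations:
  "g p (\<lambda>f. \<Sum>k\<in>UNIV. u $ k * e k p f) (\<lambda>f. \<Sum>k\<in>UNIV. v $ k * e k p f) = u \<bullet> v"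
proof -
  obtain c where cp: "c \<in> A" "p \<in> cdom c" by (rule chart_at)
  have x: "cmap c p \<in> cimg c" using cp(2) by (rule imageI)
  interpret invariant_frame_chart G A e g \<omega> b c by unfold_locales (rule cp)
  have "(\<lambda>f. \<Sum>k\<in>UNIV. u $ k * e k p f) = dvec A c p (fr (cmap c p) u)" for u
    using randers_field_dvec[OF x] by (simp add: cinv_cmap[OF cp])
  then show ?thesis
    using metric_eq_\<theta>[OF x, of "fr (cmap c p) u" "fr (cmap c p) v"]
    by (simp add: \<theta>_fr[OF x] cinv_cmap[OF cp])
qed

end

text \<open>\<open>\<omega> p s = \<nabla>\<^sub>p s\<close> in the frame \<open>X, Y, Z, W\<close>, read off from Koszul's formula.\<close>

definition connection4 :: "real^4 \<Rightarrow> real^4 \<Rightarrow> real^4" where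
  "connection4 p s = vector [p$1 * s$3 + p$4 * s$2, p$2 * s$3 - p$4 * s$1, - (p$1 * s$1 + p$2 * s$2), 0]"

lemma vector_4_nth [simp]:
  "(vector [a, b, c, d] :: real^4) $ 1 = a" "(vector [a, b, c, d] :: real^4) $ 2 = b"
  "(vector [a, b, c, d] :: real^4) $ 3 = c" "(vector [a, b, c, d] :: real^4) $ 4 = d"
  unfolding vector_def by simp_all

lemma bilinear_connection4: "bilinear connection4"
  unfolding bilinear_def
  by (auto intro!: linearI simp: connection4_def vec_eq_iff forall_4 algebra_simps)

lemma inner_real4: "u \<bullet> v = u$1 * v$1 + u$2 * v$2 + u$3 * v$3 + u$4 * v$4" for u v :: "real^4"
  by (simp add: inner_vec_def sum_4)

text \<open>Minus the squared area of the parallelogram projected to the span of X, Y, Z: the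
  curvature of hyperbolic 3-space times a line.\<close>

lemma curv_connection4:
  "curv connection4 v u \<bullet> v =
    - ((u$1 * v$2 - u$2 * v$1)\<^sup>2 + (u$1 * v$3 - u$3 * v$1)\<^sup>2 + (u$2 * v$3 - u$3 * v$2)\<^sup>2)"
  by (simp add: curv_def connection4_def inner_real4 power2_eq_square algebra_simps)

lemma lie_bracket_swap: "lie_bracket A V U = (\<lambda>x f. - lie_bracket A U V x f)"
  by (simp add: lie_bracket_def fun_eq_iff)

lemma lie_bracket_self: "lie_bracket A V V = (\<lambda>x f. 0)"
  by (simp add: lie_bracket_def fun_eq_iff)

theorem mainTheorem2:
  fixes G :: "('a::{t2_space,second_countable_topology}, 'm) monoid_scheme"
    and A :: "('a, real^4) chart set"
    and X Y Z W :: "'a vfield"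
    and g :: "'a \<Rightarrow> 'a tvec \<Rightarrow> 'a tvec \<Rightarrow> real"
    and q :: real
    and Q :: "'a vfield"
    and F :: "'a \<Rightarrow> 'a tvec \<Rightarrow> real"
  assumes "lie_group G A"
    and "simply_connected (UNIV :: 'a set)"
    and "lie_algebra_basis G A [X, Y, Z, W]"
    and "lie_bracket A X Z = X" and "lie_bracket A Y Z = Y"
    and "lie_bracket A X W = Y" and "lie_bracket A Y W = (\<lambda>x f. - X x f)"
    and "lie_bracket A X Y = (\<lambda>x f. 0)" and "lie_bracket A Z W = (\<lambda>x f. 0)"
    and "riemannian_metric A g"
    and "left_invariant_metric G A g"
    and "orthonormal (g \<one>\<^bsub>G\<^esub>) [X \<one>\<^bsub>G\<^esub>, Y \<one>\<^bsub>G\<^esub>, Z \<one>\<^bsub>G\<^esub>, W \<one>\<^bsub>G\<^esub>]"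
    and "0 < \<bar>q\<bar>" and "\<bar>q\<bar> < 1"
    and "Q = (\<lambda>x f. q * W x f)"
    and "F = randers g Q"
  shows "berwald_type A F \<and>
    geodesically_complete A F \<and>
    (\<forall>a b c d a' b' c' d' U V.
       U = lin_comb [a, b, c, d] [X, Y, Z, W] \<and>
       V = lin_comb [a', b', c', d'] [X, Y, Z, W] \<and>
       orthonormal (g \<one>\<^bsub>G\<^esub>) [U \<one>\<^bsub>G\<^esub>, V \<one>\<^bsub>G\<^esub>] \<longrightarrow>
       (\<forall>p. \<forall>\<kappa>\<in>A. p \<in> cdom \<kappa> \<longrightarrow>
          flag_curvature A F \<kappa> p U V =
            - ((a * b' - b * a')\<^sup>2 + (a * c' - c * a')\<^sup>2 + (b * c' - c * b')\<^sup>2) / (1 + d * q)\<^sup>2 \<and>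
          - ((a * b' - b * a')\<^sup>2 + (a * c' - c * a')\<^sup>2 + (b * c' - c * b')\<^sup>2) / (1 + d * q)\<^sup>2 \<le> 0)) \<and>
    nonpositive_flag_curvature A F"
proof -
  \<comment> \<open>The last branch is the index 4, which is the same element as 0 in the index
    type.\<close>
  define e :: "4 \<Rightarrow> 'a vfield" where "e i = (if i = 1 then X else if i = 2 then Y else if i = 3 then Z else W)" for i
  define w where "w = (vector [0, 0, 0, q] :: real^4)"
  have e: "e 1 = X" "e 2 = Y" "e 3 = Z" "e 4 = W" by (simp_all add: e_def)
  have o: "g \<one>\<^bsub>G\<^esub> ([X \<one>\<^bsub>G\<^esub>, Y \<one>\<^bsub>G\<^esub>, Z \<one>\<^bsub>G\<^esub>, W \<one>\<^bsub>G\<^esub>] ! i) ([X \<one>\<^bsub>G\<^esub>, Y \<one>\<^bsub>G\<^esub>, Z \<one>\<^bsub>G\<^esub>, W \<one>\<^bsub>G\<^esub>] ! j) =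
      (if i = j then 1 else 0)" if "i < 4" "j < 4" for i j
    using assms(12) that by (simp add: orthonormal_def)
  interpret fr: invariant_frame G A e g connection4 w
  proof unfold_locales
    show "smooth_manifold A" "lie_group G A" using assms(1) by (simp_all add: lie_group_def)
    show "riemannian_metric A g" "left_invariant_metric G A g" by fact+
    show "e i \<in> lie_algebra G A" for i
      using assms(3) by (simp add: lie_algebra_basis_def e_def)
    \<comment> \<open>List positions count from 0 and frame indices from 1.\<close>
    have "\<forall>i j. g \<one>\<^bsub>G\<^esub> (e i \<one>\<^bsub>G\<^esub>) (e j \<one>\<^bsub>G\<^esub>) = (if i = j then 1 else 0)"
      unfolding forall_4 e
      using o[of 0 0] o[of 0 1] o[of 0 2] o[of 0 3] o[of 1 0] o[of 1 1] o[of 1 2] o[of 1 3]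
        o[of 2 0] o[of 2 1] o[of 2 2] o[of 2 3] o[of 3 0] o[of 3 1] o[of 3 2] o[of 3 3]
      by simp
    then show "g \<one>\<^bsub>G\<^esub> (e i \<one>\<^bsub>G\<^esub>) (e j \<one>\<^bsub>G\<^esub>) = (if i = j then 1 else 0)" for i j by blast
    show "bilinear connection4" by (rule bilinear_connection4)
    \<comment> \<open>The sixteen brackets are the six given ones, their negatives and the zero
      diagonal.\<close>
    have "\<forall>i j. lie_bracket A (e i) (e j) =
       (\<lambda>x f. \<Sum>k\<in>UNIV. (connection4 (axis i 1) (axis j 1) - connection4 (axis j 1) (axis i 1)) $ k * e k x f)"
      unfolding forall_4 e
      using assms(4-9) lie_bracket_swap[of A Y X] lie_bracket_swap[of A Z X] lie_bracket_swap[of A Z Y]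
        lie_bracket_swap[of A W X] lie_bracket_swap[of A W Y] lie_bracket_swap[of A W Z]
      by (simp add: lie_bracket_self sum_4 e connection4_def axis_def)
    then show "lie_bracket A (e i) (e j) =
       (\<lambda>x f. \<Sum>k\<in>UNIV. (connection4 (axis i 1) (axis j 1) - connection4 (axis j 1) (axis i 1)) $ k * e k x f)" for i j
      by blast
    show "s \<bullet> connection4 p s = 0" for p s by (simp add: inner_real4 connection4_def algebra_simps)
    show "w \<bullet> connection4 p s = 0" for p s by (simp add: inner_real4 connection4_def w_def)
    show "norm w < 1" using assms(14) by (simp add: norm_eq_sqrt_inner inner_real4 w_def)
  qed
  have F: "fr.F = F"
    unfolding fr.F_def assms(15,16) by (simp add: sum_4 e w_def)
  have lc: "lin_comb [a, b, c, d] [X, Y, Z, W] = (\<lambda>x f. \<Sum>k\<in>UNIV. (vector [a, b, c, d] :: real^4) $ k * e k x f)"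
    for a b c d
    by (simp add: lin_comb_def sum_4 e numeral_eq_Suc lessThan_Suc fun_eq_iff)
  have "berwald_type A F" using fr.berwald by (simp only: F)
  moreover have "geodesically_complete A F" using fr.complete by (simp only: F)
  moreover have "nonpositive_flag_curvature A F"
    unfolding F[symmetric]
    by (rule fr.nonpositive_curvature, unfold curv_connection4 neg_le_0_iff_le)
      (intro add_nonneg_nonneg zero_le_power2)
  moreover have "flag_curvature A F \<kappa> p U V =
        - ((a * b' - b * a')\<^sup>2 + (a * c' - c * a')\<^sup>2 + (b * c' - c * b')\<^sup>2) / (1 + d * q)\<^sup>2"
    if UV: "U = lin_comb [a, b, c, d] [X, Y, Z, W]" "V = lin_comb [a', b', c', d'] [X, Y, Z, W]"
      and orth: "orthonormal (g \<one>\<^bsub>G\<^esub>) [U \<one>\<^bsub>G\<^esub>, V \<one>\<^bsub>G\<^esub>]" and \<kappa>: "\<kappa> \<in> A" "p \<in> cdom \<kappa>"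
    for a b c d a' b' c' d' U V p \<kappa>
  proof -
    define u v where "u = (vector [a, b, c, d] :: real^4)" and "v = (vector [a', b', c', d'] :: real^4)"
    have U: "U = (\<lambda>x f. \<Sum>k\<in>UNIV. u $ k * e k x f)" and V: "V = (\<lambda>x f. \<Sum>k\<in>UNIV. v $ k * e k x f)"
      unfolding UV lc u_def v_def by (rule refl)+
    have o2: "g \<one>\<^bsub>G\<^esub> ([U \<one>\<^bsub>G\<^esub>, V \<one>\<^bsub>G\<^esub>] ! i) ([U \<one>\<^bsub>G\<^esub>, V \<one>\<^bsub>G\<^esub>] ! j) = (if i = j then 1 else 0)" if "i < 2" "j < 2" for i j
      using orth that by (simp add: orthonormal_def)
    have "u \<bullet> u = 1" "u \<bullet> v = 0" "v \<bullet> v = 1"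
      using o2[of 0 0] o2[of 0 1] o2[of 1 1] by (simp_all add: U V fr.metric_frame_combinations)
    then have "flag_curvature A fr.F \<kappa> p U V = curv connection4 v u \<bullet> v / (1 + w \<bullet> u)\<^sup>2"
      unfolding U V by (intro fr.flag_curvature_frame_combination \<kappa>) (simp_all add: norm_eq_sqrt_inner)
    then show ?thesis
      unfolding F curv_connection4 by (simp add: u_def v_def w_def inner_real4 mult.commute)
  qed
  moreover have "- (x\<^sup>2 + y\<^sup>2 + z\<^sup>2) / r\<^sup>2 \<le> 0" for x y z r :: real
    by (rule divide_nonpos_nonneg[OF neg_le_0_iff_le[THEN iffD2]]) (intro add_nonneg_nonneg zero_le_power2)+
  ultimately show ?thesis by blast
qed

end
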